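(* Let $a,b>0$, $p>6$, and let $h:\mathbb{Z}^3\to\mathbb{R}$ satisfy conditions $(h_1)$ and $(h_2)$ of the context, with $\Omega=\{x\in\mathbb{Z}^3:h(x)=0\}$. Let $(\lambda_k)$ be any sequence of positive numbers with $\lambda_k\to\infty$, and for each $k$ let $u_{\lambda_k}\in\mathcal{H}_{\lambda_k}$ be a least energy sign-changing solution of $$-\left(a+b\int_{\mathbb{Z}^3}|\nabla u|^2\,d\mu\right)\Delta u+(\lambda_kh(x)+1)u=|u|^{p-2}u\log u^2,\qquad x\in\mathbb{Z}^3.$$ Then, up to a subsequence, $u_{\lambda_k}$ converges in $H^1(\mathbb{Z}^3)$ to (the extension by zero of) a least energy sign-changing solution of $$-\left(a+b\int_{\Omega\cup\partial\Omega}|\nabla u|^2\,d\mu\right)\Delta u+u=|u|^{p-2}u\log u^2\ \text{ in }\Omega,\qquad u=0\ \text{ on }\partial\Omega.$$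
   Context: $\mathbb{Z}^3$ is the integer lattice graph: $x\sim y$ iff $\sum_{i=1}^3|x_i-y_i|=1$. $\mu$ is the counting measure, so $\int_Au\,d\mu=\sum_{x\in A}u(x)$. $\Delta u(x)=\sum_{y\sim x}(u(y)-u(x))$, $\nabla u\nabla v(x)=\frac12\sum_{y\sim x}(u(y)-u(x))(v(y)-v(x))$, $|\nabla u|^2=\nabla u\nabla u$. $u^+=\max\{u,0\}$, $u^-=\min\{u,0\}$. Convention: $|t|^{p-2}t\log t^2$ and $|t|^p\log t^2$ are $0$ at $t=0$. Conditions on $h$: $(h_1)$ $h(x)\ge0$ and $\Omega=\{x\in\mathbb{Z}^3:h(x)=0\}$ is a nonempty, connected and bounded domain in $\mathbb{Z}^3$; $(h_2)$ there exists $M>0$ such that $\mu(\{x\in\mathbb{Z}^3:h(x)<M\})<\infty$. Problem on $\mathbb{Z}^3$. $H^1(\mathbb{Z}^3)$ is the completion of the finitely supported functions under $\|u\|_{H^1}=\left(\int_{\mathbb{Z}^3}(|\nabla u|^2+u^2)\,d\mu\right)^{1/2}$. For $\lambda>0$ put $h_\lambda=\lambda h+1$ and $\mathcal{H}_\lambda=\{u\in H^1(\mathbb{Z}^3):\int_{\mathbb{Z}^3}\lambda hu^2\,d\mu<\infty\}$ with norm $\|u\|_{\mathcal{H}_\lambda}^2=\int_{\mathbb{Z}^3}(a|\nabla u|^2+h_\lambda u^2)\,d\mu$. The energy functional is $$J_\lambda(u)=\frac12\|u\|_{\mathcal{H}_\lambda}^2+\frac b4\left(\int_{\mathbb{Z}^3}|\nabla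 u|^2d\mu\right)^2+\frac2{p^2}\int_{\mathbb{Z}^3}|u|^pd\mu-\frac1p\int_{\mathbb{Z}^3}|u|^p\log u^2\,d\mu,\quad u\in\mathcal{H}_\lambda,$$ a $C^1$ functional; $(J_\lambda'(u),\phi)$ denotes its derivative at $u$ applied to $\phi$. $\mathcal{M}_\lambda=\{u\in\mathcal{H}_\lambda:u^\pm\ne0,\ (J_\lambda'(u),u^+)=(J_\lambda'(u),u^-)=0\}$, $m_\lambda=\inf_{\mathcal{M}_\lambda}J_\lambda$. A sign-changing solution is $u\in\mathcal{H}_\lambda$ with $J_\lambda'(u)=0$ and $u^\pm\not\equiv0$; it is of least energy if $J_\lambda(u)=m_\lambda$. Limit problem. $\partial\Omega=\{y\in\mathbb{Z}^3\setminus\Omega:\exists x\in\Omega,\ x\sim y\}$. $\mathcal{H}_0^1(\Omega)$ is the completion of $C_c(\Omega)$ (functions on $\Omega$ with finite support, extended by $0$ outside $\Omega$) under $\|u\|_{\mathcal{H}_0^1(\Omega)}^2=\int_{\Omega\cup\partial\Omega}a|\nabla u|^2d\mu+\int_\Omega u^2d\mu$. The energy functional is $$J_\Omega(u)=\frac12\|u\|_{\mathcal{H}_0^1(\Omega)}^2+\frac b4\left(\int_{\Omega\cup\partial\Omega}|\nabla u|^2d\mu\right)^2+\frac2{p^2}\int_\Omega|u|^pd\mu-\frac1p\int_\Omega|u|^p\log u^2\,d\mu,\quad u\in\mathcal{H}_0^1(\Omega),$$ a $C^1$ functional with derivative $(J_\Omega'(u),\phi)$. $\mathcal{M}_\Omega=\{u\in\mathcal{H}_0^1(\Omega):u^\pm\ne0,\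 (J_\Omega'(u),u^+)=(J_\Omega'(u),u^-)=0\}$, $m_\Omega=\inf_{\mathcal{M}_\Omega}J_\Omega$. A sign-changing solution is $u\in\mathcal{H}_0^1(\Omega)$ with $J_\Omega'(u)=0$ and $u^\pm\not\equiv0$; it is of least energy if $J_\Omega(u)=m_\Omega$.
   Formalization: It is additionally assumed that Ω is not a single point: if Ω has one point, the limit problem has no sign-changing functions at all, so the claim fails (for example for h(x)=|x|², where Ω={0}). *)

theory Defs
  imports "HOL-Analysis.Analysis"
begin

text \<open>Functions on the integer lattice \<open>\<int>\<^sup>3\<close> are functions on \<^typ>\<open>int ^ 3\<close>.  The measure on the lattice
  is the counting measure, so integrals over sets of lattice points are unordered sums
  (\<^const>\<open>infsum\<close>).  Functions on a subset of the lattice are represented by their extension by zero.\<close>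

definition adj :: "int ^ 3 \<Rightarrow> int ^ 3 \<Rightarrow> bool" (infix "\<sim>\<^sub>Z" 50) where
  "x \<sim>\<^sub>Z y \<longleftrightarrow> (\<Sum>i\<in>UNIV. \<bar>x $ i - y $ i\<bar>) = 1"

definition graph_connected :: "(int ^ 3) set \<Rightarrow> bool" where
  "graph_connected A \<longleftrightarrow> (\<forall>x\<in>A. \<forall>y\<in>A. (\<lambda>v w. v \<in> A \<and> w \<in> A \<and> v \<sim>\<^sub>Z w)\<^sup>*\<^sup>* x y)"

text \<open>Boundedness in the graph distance, which on the lattice is \<open>\<Sum>\<^sub>i \<bar>x\<^sub>i - y\<^sub>i\<bar>\<close>.\<close>

definition lattice_bounded :: "(int ^ 3) set \<Rightarrow> bool" where
  "lattice_bounded A \<longleftrightarrow> (\<exists>R. \<forall>x\<in>A. \<forall>y\<in>A. (\<Sum>i\<in>UNIV. \<bar>x $ i - y $ i\<bar>) \<le> R)"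

definition vertex_boundary :: "(int ^ 3) set \<Rightarrow> (int ^ 3) set" where
  "vertex_boundary A = {y. y \<notin> A \<and> (\<exists>x\<in>A. x \<sim>\<^sub>Z y)}"

definition grad_prod :: "(int ^ 3 \<Rightarrow> real) \<Rightarrow> (int ^ 3 \<Rightarrow> real) \<Rightarrow> int ^ 3 \<Rightarrow> real" where
  "grad_prod u v x = 1/2 * (\<Sum>y | x \<sim>\<^sub>Z y. (u y - u x) * (v y - v x))"

abbreviation grad_sq :: "(int ^ 3 \<Rightarrow> real) \<Rightarrow> int ^ 3 \<Rightarrow> real" where
  "grad_sq u \<equiv> grad_prod u u"

definition pos_part :: "('x \<Rightarrow> real) \<Rightarrow> 'x \<Rightarrow> real" where
  "pos_part u = (\<lambda>x. max (u x) 0)"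

text \<open>The negative part is nonpositive: \<open>u = u\<^sup>+ + u\<^sup>-\<close>.\<close>

definition neg_part :: "('x \<Rightarrow> real) \<Rightarrow> 'x \<Rightarrow> real" where
  "neg_part u = (\<lambda>x. min (u x) 0)"


subsection \<open>Function spaces\<close>

definition fin_supp_on :: "'x set \<Rightarrow> ('x \<Rightarrow> real) set" where
  "fin_supp_on A = {\<phi>. finite {x. \<phi> x \<noteq> 0} \<and> (\<forall>x. x \<notin> A \<longrightarrow> \<phi> x = 0)}"

text \<open>The completion of the finitely supported functions on \<open>A\<close> under a norm \<open>N\<close>, realized as a space
  of functions: the class of a Cauchy sequence is identified with its pointwise limit.  For the norms
  used below this is the usual completion, because they dominate all point values (so Cauchy sequences
  converge pointwise, equivalent ones to the same limit), and a Cauchy sequence with pointwise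
  limit 0 is a null sequence.\<close>

definition completion_of_fin_supp :: "'x set \<Rightarrow> (('x \<Rightarrow> real) \<Rightarrow> real) \<Rightarrow> ('x \<Rightarrow> real) set" where
  "completion_of_fin_supp A N =
    {u. \<exists>\<phi>. (\<forall>n::nat. \<phi> n \<in> fin_supp_on A) \<and>
            (\<forall>e>0. \<exists>n0. \<forall>m\<ge>n0. \<forall>n\<ge>n0. N (\<lambda>x. \<phi> m x - \<phi> n x) < e) \<and>
            (\<forall>x. (\<lambda>n. \<phi> n x) \<longlonglongrightarrow> u x)}"

definition H1_norm :: "(int ^ 3 \<Rightarrow> real) \<Rightarrow> real" where
  "H1_norm u = sqrt (\<Sum>\<^sub>\<infinity>x. grad_sq u x + (u x)\<^sup>2)"

definition H1 :: "(int ^ 3 \<Rightarrow> real) set" where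
  "H1 = completion_of_fin_supp UNIV H1_norm"

definition Hlam :: "(int ^ 3 \<Rightarrow> real) \<Rightarrow> real \<Rightarrow> (int ^ 3 \<Rightarrow> real) set" where
  "Hlam h l = {u \<in> H1. (\<lambda>x. l * h x * (u x)\<^sup>2) summable_on UNIV}"

definition Hlam_norm :: "real \<Rightarrow> (int ^ 3 \<Rightarrow> real) \<Rightarrow> real \<Rightarrow> (int ^ 3 \<Rightarrow> real) \<Rightarrow> real" where
  "Hlam_norm a h l u = sqrt (\<Sum>\<^sub>\<infinity>x. a * grad_sq u x + (l * h x + 1) * (u x)\<^sup>2)"

definition H01_norm :: "real \<Rightarrow> (int ^ 3) set \<Rightarrow> (int ^ 3 \<Rightarrow> real) \<Rightarrow> real" where
  "H01_norm a \<Omega> u =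
    sqrt ((\<Sum>\<^sub>\<infinity>x\<in>\<Omega> \<union> vertex_boundary \<Omega>. a * grad_sq u x) + (\<Sum>\<^sub>\<infinity>x\<in>\<Omega>. (u x)\<^sup>2))"

definition H01 :: "real \<Rightarrow> (int ^ 3) set \<Rightarrow> (int ^ 3 \<Rightarrow> real) set" where
  "H01 a \<Omega> = completion_of_fin_supp \<Omega> (H01_norm a \<Omega>)"


subsection \<open>Energy functionals\<close>

text \<open>The convention \<open>|t|\<^sup>p log t\<^sup>2 = 0\<close> at \<open>t = 0\<close> holds since \<open>0 powr p = 0\<close>.\<close>

definition J_lam :: "real \<Rightarrow> real \<Rightarrow> real \<Rightarrow> (int ^ 3 \<Rightarrow> real) \<Rightarrow> real \<Rightarrow> (int ^ 3 \<Rightarrow> real) \<Rightarrow> real" where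
  "J_lam a b p h l u =
     1/2 * (Hlam_norm a h l u)\<^sup>2
     + b/4 * (\<Sum>\<^sub>\<infinity>x. grad_sq u x)\<^sup>2
     + 2/p\<^sup>2 * (\<Sum>\<^sub>\<infinity>x. \<bar>u x\<bar> powr p)
     - 1/p * (\<Sum>\<^sub>\<infinity>x. \<bar>u x\<bar> powr p * ln ((u x)\<^sup>2))"

definition J_Omega :: "real \<Rightarrow> real \<Rightarrow> real \<Rightarrow> (int ^ 3) set \<Rightarrow> (int ^ 3 \<Rightarrow> real) \<Rightarrow> real" where
  "J_Omega a b p \<Omega> u =
     1/2 * (H01_norm a \<Omega> u)\<^sup>2
     + b/4 * (\<Sum>\<^sub>\<infinity>x\<in>\<Omega> \<union> vertex_boundary \<Omega>. grad_sq u x)\<^sup>2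
     + 2/p\<^sup>2 * (\<Sum>\<^sub>\<infinity>x\<in>\<Omega>. \<bar>u x\<bar> powr p)
     - 1/p * (\<Sum>\<^sub>\<infinity>x\<in>\<Omega>. \<bar>u x\<bar> powr p * ln ((u x)\<^sup>2))"

text \<open>Frechet derivative at \<open>u\<close> of a functional \<open>J\<close> on a linear space \<open>V\<close> of functions normed by \<open>N\<close>.
  The library's \<^const>\<open>has_derivative\<close> needs a normed space that is a whole type, whereas the spaces and norms
  here depend on \<open>a\<close>, \<open>h\<close>, \<open>\<lambda>\<close> and \<open>\<Omega>\<close>.\<close>

definition has_frechet_on ::
  "('x \<Rightarrow> real) set \<Rightarrow> (('x \<Rightarrow> real) \<Rightarrow> real) \<Rightarrow> (('x \<Rightarrow> real) \<Rightarrow> real) \<Rightarrow> ('x \<Rightarrow> real)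
    \<Rightarrow> (('x \<Rightarrow> real) \<Rightarrow> real) \<Rightarrow> bool" where
  "has_frechet_on V N J u L \<longleftrightarrow>
     (\<forall>\<phi>\<in>V. \<forall>\<psi>\<in>V. L (\<lambda>x. \<phi> x + \<psi> x) = L \<phi> + L \<psi>) \<and>
     (\<forall>c. \<forall>\<phi>\<in>V. L (\<lambda>x. c * \<phi> x) = c * L \<phi>) \<and>
     (\<exists>K. \<forall>\<phi>\<in>V. \<bar>L \<phi>\<bar> \<le> K * N \<phi>) \<and>
     (\<forall>e>0. \<exists>d>0. \<forall>\<phi>\<in>V. N \<phi> < d \<longrightarrow> \<bar>J (\<lambda>x. u x + \<phi> x) - J u - L \<phi>\<bar> \<le> e * N \<phi>)"

text \<open>\<open>frechet_on V N J u \<phi>\<close> is \<open>(J'(u), \<phi>)\<close>; as for \<^const>\<open>frechet_derivative\<close>, it is meaningful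
  when \<open>J\<close> is differentiable at \<open>u\<close>, and then it is determined for \<open>\<phi> \<in> V\<close>.\<close>

definition frechet_on ::
  "('x \<Rightarrow> real) set \<Rightarrow> (('x \<Rightarrow> real) \<Rightarrow> real) \<Rightarrow> (('x \<Rightarrow> real) \<Rightarrow> real) \<Rightarrow> ('x \<Rightarrow> real)
    \<Rightarrow> (('x \<Rightarrow> real) \<Rightarrow> real)" where
  "frechet_on V N J u = (SOME L. has_frechet_on V N J u L)"


subsection \<open>Least energy sign-changing solutions\<close>

definition sc_nehari ::
  "('x \<Rightarrow> real) set \<Rightarrow> (('x \<Rightarrow> real) \<Rightarrow> real) \<Rightarrow> (('x \<Rightarrow> real) \<Rightarrow> real) \<Rightarrow> ('x \<Rightarrow> real) set" where
  "sc_nehari V N J =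
    {u \<in> V. pos_part u \<noteq> (\<lambda>_. 0) \<and> neg_part u \<noteq> (\<lambda>_. 0) \<and>
            frechet_on V N J u (pos_part u) = 0 \<and> frechet_on V N J u (neg_part u) = 0}"

definition sc_solution ::
  "('x \<Rightarrow> real) set \<Rightarrow> (('x \<Rightarrow> real) \<Rightarrow> real) \<Rightarrow> (('x \<Rightarrow> real) \<Rightarrow> real) \<Rightarrow> ('x \<Rightarrow> real) \<Rightarrow> bool" where
  "sc_solution V N J u \<longleftrightarrow>
     u \<in> V \<and> (\<forall>\<phi>\<in>V. frechet_on V N J u \<phi> = 0) \<and>
     pos_part u \<noteq> (\<lambda>_. 0) \<and> neg_part u \<noteq> (\<lambda>_. 0)"

definition least_energy_sc_solution ::
  "('x \<Rightarrow> real) set \<Rightarrow> (('x \<Rightarrow> real) \<Rightarrow> real) \<Rightarrow> (('x \<Rightarrow> real) \<Rightarrow> real) \<Rightarrow> ('x \<Rightarrow> real) \<Rightarrow> bool" where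
  "least_energy_sc_solution V N J u \<longleftrightarrow>
     sc_solution V N J u \<and> J u = (INF v\<in>sc_nehari V N J. J v)"

text \<open>On \<open>\<Omega>\<close> with a single point there are no sign-changing functions, hence no sign-changing solutions
  of the limit problem.\<close>

lemma no_sign_changing_on_singleton:
  assumes "u \<in> H01 a {x0}"
  shows "pos_part u = (\<lambda>_. 0) \<or> neg_part u = (\<lambda>_. 0)"
proof -
  obtain \<phi> where \<phi>: "\<And>n::nat. \<phi> n \<in> fin_supp_on {x0}" "\<And>x. (\<lambda>n. \<phi> n x) \<longlonglongrightarrow> u x"
    using assms unfolding H01_def completion_of_fin_supp_def by blast
  have off: "u x = 0" if "x \<noteq> x0" for x
  proof -
    have "\<phi> n x = 0" for n
      using \<phi>(1)[of n] that by (auto simp: fin_supp_on_def)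
    then show ?thesis
      using \<phi>(2)[of x] by (simp add: LIMSEQ_const_iff)
  qed
  show ?thesis
  proof (cases "u x0 \<le> 0")
    case True
    then have "max (u x) 0 = 0" for x using off[of x] by (cases "x = x0") auto
    then show ?thesis by (simp add: pos_part_def)
  next
    case False
    then have "min (u x) 0 = 0" for x using off[of x] by (cases "x = x0") auto
    then show ?thesis by (simp add: neg_part_def)
  qed
qed

end

theory Submission
  imports Defs
begin

text \<open>Write \<open>J\<close> for either functional. On sign-changing Nehari functions \<open>J(u) = J(u) - (J'(u), u) / p\<close> is a sum of
  nonnegative terms controlling the norm, and the Nehari set of the limit problem (nonempty, by
  maximising \<open>J(s e\<^sub>1 + t e\<^sub>2)\<close> over \<open>s, t \<ge> 0\<close> for two lattice points of \<open>\<Omega>\<close>) lies in that of the problem on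
  the lattice with the same energies. Hence the solutions \<open>u\<^sub>k\<close> are bounded, uniformly in \<open>k\<close>.
  Since \<open>\<lambda>\<^sub>k \<Sum> h u\<^sub>k\<^sup>2\<close> is bounded and \<open>h \<ge> M\<close> off a finite set, a subsequence that converges on the finite
  set \<open>\<Omega>\<close> converges in \<open>\<ell>\<^sup>2\<close>, which is \<open>H\<^sup>1\<close> because the lattice has bounded degree. The limit solves the
  limit problem; its sign parts do not vanish because those of \<open>u\<^sub>k\<close> exceed 1 in absolute value
  somewhere; and its energy is minimal since the above expression for \<open>J\<close> passes to the limit after dropping
  the nonnegative contributions from outside \<open>\<Omega>\<close>.\<close>

subsection \<open>Weighted square-summable functions and the Dirichlet form\<close>

text \<open>Both problems are instances of one functional \<open>energy a b p w\<close> on functions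
  on the whole lattice: the weight is \<open>lam k * h x + 1\<close> for the first, and 1 on
  functions vanishing off \<Omega> for the second. The weights agree on \<Omega>, which gives the
  inclusion of the Nehari sets and also makes \<open>lam k\<close> disappear from the equation of
  \<open>u k\<close> tested with functions supported in \<Omega>. The multiple 1/p is dictated by
  the nonlinearity: it is the one for which the logarithms cancel, so that no term of indefinite
  sign is left; the quartic term survives with the coefficient b (1/4 - 1/p) > 0. Two definitions
  shape the argument. The derivative \<open>frechet_on\<close> is selected by \<open>SOME\<close>,
  so it must first be identified with an explicit formula. The least energy is a real
  \<open>INF\<close>, which is informative only for a nonempty set of values bounded below; hence
  the construction of a Nehari function on two points of \<Omega>, supplied by
  \<open>nondegenerate\<close> (on a single point nothing changes sign).\<close>

lemma has_sum_sum:
  fixes f :: "'i \<Rightarrow> 'x \<Rightarrow> real"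
  assumes "finite I" "\<And>i. i \<in> I \<Longrightarrow> (f i has_sum s i) A"
  shows "((\<lambda>x. \<Sum>i\<in>I. f i x) has_sum (\<Sum>i\<in>I. s i)) A"
  using assms by (induction I rule: finite_induct) (simp_all add: has_sum_add)

lemma
  fixes f :: "'i \<Rightarrow> 'x \<Rightarrow> real"
  assumes "finite I" "\<And>i. i \<in> I \<Longrightarrow> f i summable_on A"
  shows summable_on_sum: "(\<lambda>x. \<Sum>i\<in>I. f i x) summable_on A"
    and infsum_sum: "(\<Sum>\<^sub>\<infinity>x\<in>A. \<Sum>i\<in>I. f i x) = (\<Sum>i\<in>I. infsum (f i) A)"
  using has_sum_sum[OF assms(1), where f=f and s="\<lambda>i. infsum (f i) A" and A=A] assms(2)
  by (auto simp: summable_on_def infsumI)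

lemma summable_on_bounded_real:
  fixes f g :: "'x \<Rightarrow> real"
  assumes "g summable_on A" "\<And>x. x \<in> A \<Longrightarrow> \<bar>f x\<bar> \<le> g x"
  shows "f summable_on A"
proof -
  have "(\<lambda>x. norm (f x)) summable_on A"
  proof (rule Infinite_Sum.abs_summable_on_comparison_test[where g=g])
    show "(\<lambda>x. norm (g x)) summable_on A"
      using assms(1) summable_on_iff_abs_summable_on_real by blast
    show "norm (f x) \<le> norm (g x)" if "x \<in> A" for x
      using assms(2)[OF that] by auto
  qed
  then show ?thesis by (rule abs_summable_summable)
qed

lemma abs_infsum_le:
  fixes f g :: "'x \<Rightarrow> real"
  assumes "g summable_on A" "\<And>x. x \<in> A \<Longrightarrow> \<bar>f x\<bar> \<le> g x"
  shows "\<bar>infsum f A\<bar> \<le> infsum g A"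
proof -
  have f: "f summable_on A" by (rule summable_on_bounded_real[OF assms])
  have f': "(\<lambda>x. - f x) summable_on A" using f by (simp add: summable_on_uminus)
  have "infsum f A \<le> infsum g A"
    using assms by (intro infsum_mono f) (auto simp: abs_le_iff)
  moreover have "infsum (\<lambda>x. - f x) A \<le> infsum g A"
    using assms by (intro infsum_mono f') (auto simp: abs_le_iff)
  ultimately show ?thesis by (simp add: infsum_uminus)
qed

text \<open>The unweighted condition is kept separate because the weight may vanish: the Dirichlet
  form below has weight 0 and still needs the domain l^2. The simp rule \<open>wl2_zero\<close>
  identifies the two domains, so general facts about \<open>form\<close> specialize
  directly.\<close>

definition wl2 :: "('x \<Rightarrow> real) \<Rightarrow> ('x \<Rightarrow> real) set" where
  "wl2 w = {u. (\<lambda>x. (u x)\<^sup>2) summable_on UNIV \<and> (\<lambda>x. w x * (u x)\<^sup>2) summable_on UNIV}"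

lemma wl2_zero [simp]: "wl2 (\<lambda>_. 0) = wl2 (\<lambda>_. 1)"
  by (simp add: wl2_def)

lemma wl2_subset: "wl2 w \<subseteq> wl2 (\<lambda>_. 1)"
  by (auto simp: wl2_def)

lemma wl2_bounded:
  assumes w: "\<And>x. w x \<ge> (0::real)" and u: "u \<in> wl2 w" and v: "\<And>x. \<bar>v x\<bar> \<le> \<bar>u x\<bar>"
  shows "v \<in> wl2 w"
proof -
  have le: "(v x)\<^sup>2 \<le> (u x)\<^sup>2" for x using v[of x] by (simp add: abs_le_square_iff)
  have "(\<lambda>x. (v x)\<^sup>2) summable_on UNIV"
    by (rule summable_on_bounded_real[where g="\<lambda>x. (u x)\<^sup>2"]) (use u le in \<open>auto simp: wl2_def\<close>)
  moreover have "(\<lambda>x. w x * (v x)\<^sup>2) summable_on UNIV"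
    by (rule summable_on_bounded_real[where g="\<lambda>x. w x * (u x)\<^sup>2"])
      (use u le w in \<open>auto simp: wl2_def abs_mult mult_left_mono\<close>)
  ultimately show ?thesis by (simp add: wl2_def)
qed

lemma wl2_scale:
  assumes "u \<in> wl2 w"
  shows "(\<lambda>x. c * u x) \<in> wl2 w"
proof -
  have "w x * (c * u x)\<^sup>2 = c\<^sup>2 * (w x * (u x)\<^sup>2)" for x by (simp add: power_mult_distrib)
  then have "(\<lambda>x. w x * (c * u x)\<^sup>2) summable_on UNIV"
    using assms by (simp only: wl2_def mem_Collect_eq summable_on_cmult_right)
  then show ?thesis using assms
    by (simp only: wl2_def mem_Collect_eq) (simp add: power_mult_distrib summable_on_cmult_right)
qed

lemma wl2_add:
  assumes w: "\<And>x. w x \<ge> (0::real)" and u: "u \<in> wl2 w" and v: "v \<in> wl2 w"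
  shows "(\<lambda>x. u x + v x) \<in> wl2 w"
proof -
  have le: "(u x + v x)\<^sup>2 \<le> 2 * ((u x)\<^sup>2 + (v x)\<^sup>2)" for x
    using sum_squares_bound[of "u x" "v x"] by (simp add: power2_sum)
  have "(\<lambda>x. (u x + v x)\<^sup>2) summable_on UNIV"
    by (rule summable_on_bounded_real[where g="\<lambda>x. 2 * ((u x)\<^sup>2 + (v x)\<^sup>2)"])
      (use u v le in \<open>auto simp: wl2_def intro!: summable_on_cmult_right summable_on_add\<close>)
  moreover have "(\<lambda>x. w x * (u x + v x)\<^sup>2) summable_on UNIV"
  proof (rule summable_on_bounded_real[where g="\<lambda>x. 2 * (w x * (u x)\<^sup>2 + w x * (v x)\<^sup>2)"])
    show "(\<lambda>x. 2 * (w x * (u x)\<^sup>2 + w x * (v x)\<^sup>2)) summable_on UNIV"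
      using u v by (auto simp: wl2_def intro!: summable_on_cmult_right summable_on_add)
    show "\<bar>w x * (u x + v x)\<^sup>2\<bar> \<le> 2 * (w x * (u x)\<^sup>2 + w x * (v x)\<^sup>2)" for x
      using mult_left_mono[OF le w, of x] w[of x] by (simp add: abs_mult algebra_simps)
  qed
  ultimately show ?thesis by (simp add: wl2_def)
qed

lemma wl2_diff:
  assumes "\<And>x. w x \<ge> (0::real)" "u \<in> wl2 w" "v \<in> wl2 w"
  shows "(\<lambda>x. u x - v x) \<in> wl2 w"
  using wl2_add[OF assms(1,2) wl2_scale[OF assms(3), of "-1"]] by simp

lemma wl2_finite_support:
  assumes "finite A" "\<And>x. x \<notin> A \<Longrightarrow> u x = 0"
  shows "u \<in> wl2 w"
proof -
  have "(\<lambda>x. c x * (u x)\<^sup>2) summable_on UNIV \<longleftrightarrow> (\<lambda>x. c x * (u x)\<^sup>2) summable_on A" for c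
    using assms(2) by (intro summable_on_cong_neutral) auto
  from this[of "\<lambda>_. 1"] this[of w] show ?thesis using assms(1) by (simp add: wl2_def)
qed

lemma wl2_mult_summable:
  assumes w: "\<And>x. w x \<ge> (0::real)" and u: "u \<in> wl2 w" and v: "v \<in> wl2 w"
  shows "(\<lambda>x. w x * u x * v x) summable_on UNIV"
proof (rule summable_on_bounded_real[where g="\<lambda>x. w x * (u x)\<^sup>2 + w x * (v x)\<^sup>2"])
  show "(\<lambda>x. w x * (u x)\<^sup>2 + w x * (v x)\<^sup>2) summable_on UNIV"
    using u v by (auto simp: wl2_def intro!: summable_on_add)
  have "\<bar>u x * v x\<bar> \<le> (u x)\<^sup>2 + (v x)\<^sup>2" for x
    using sum_squares_bound[of "\<bar>u x\<bar>" "\<bar>v x\<bar>"] mult_nonneg_nonneg[of "\<bar>u x\<bar>" "\<bar>v x\<bar>"]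
    unfolding abs_mult power2_abs by linarith
  from mult_left_mono[OF this w]
  show "\<bar>w x * u x * v x\<bar> \<le> w x * (u x)\<^sup>2 + w x * (v x)\<^sup>2" for x
    using w[of x] by (simp add: abs_mult algebra_simps)
qed

lemma l2_mult_summable:
  assumes "u \<in> wl2 (\<lambda>_. 1)" "v \<in> wl2 (\<lambda>_. 1)"
  shows "(\<lambda>x. u x * v x) summable_on UNIV"
  using wl2_mult_summable[of "\<lambda>_. 1", OF _ assms] by simp

section \<open>Lattice translations and the gradient\<close>

lemma finite_lattice_ball: "finite {y :: int ^ 3. (\<Sum>i\<in>UNIV. \<bar>x $ i - y $ i\<bar>) \<le> R}"
proof (rule finite_subset)
  show "finite (vec_lambda ` PiE UNIV (\<lambda>i::3. {x $ i - R..x $ i + R}))"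
    by (intro finite_imageI finite_PiE) auto
  show "{y :: int ^ 3. (\<Sum>i\<in>UNIV. \<bar>x $ i - y $ i\<bar>) \<le> R} \<subseteq> vec_lambda ` PiE UNIV (\<lambda>i::3. {x $ i - R..x $ i + R})"
  proof
    fix y assume "y \<in> {y :: int ^ 3. (\<Sum>i\<in>UNIV. \<bar>x $ i - y $ i\<bar>) \<le> R}"
    then have s: "(\<Sum>i\<in>UNIV. \<bar>x $ i - y $ i\<bar>) \<le> R" by simp
    have "\<bar>x $ i - y $ i\<bar> \<le> (\<Sum>i\<in>UNIV. \<bar>x $ i - y $ i\<bar>)" for i
      by (rule member_le_sum) auto
    then have "\<bar>x $ i - y $ i\<bar> \<le> R" for i by (rule order_trans[OF _ s])
    then have "x $ i - R \<le> y $ i \<and> y $ i \<le> x $ i + R" for i by (smt (verit))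
    then have "vec_nth y \<in> PiE UNIV (\<lambda>i::3. {x $ i - R..x $ i + R})"
      by auto
    then show "y \<in> vec_lambda ` PiE UNIV (\<lambda>i::3. {x $ i - R..x $ i + R})"
      by (intro image_eqI[where x="vec_nth y"]) simp_all
  qed
qed

text \<open>Writing the neighbours of x as x + s turns gradient sums into sums over a fixed finite
  set of translates of u, and the l^2 norm is translation invariant.\<close>

definition unit_steps :: "(int ^ 3) set" where
  "unit_steps = {s. 0 \<sim>\<^sub>Z s}"

lemma finite_unit_steps: "finite unit_steps"
  by (rule finite_subset[OF _ finite_lattice_ball[of 0 1]]) (auto simp: unit_steps_def adj_def)

lemma grad_prod_steps:
  "grad_prod u v x = (\<Sum>s\<in>unit_steps. (u (x + s) - u x) * (v (x + s) - v x)) / 2"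
proof -
  have "bij_betw (\<lambda>s. x + s) unit_steps {y. x \<sim>\<^sub>Z y}"
    by (rule bij_betwI[where g="\<lambda>y. y - x"]) (auto simp: unit_steps_def adj_def abs_minus_commute)
  then show ?thesis
    unfolding grad_prod_def
    by (subst sum.reindex_bij_betw[symmetric]) auto
qed

lemma grad_prod_commute: "grad_prod u v = grad_prod v u"
  by (simp add: grad_prod_def fun_eq_iff mult.commute)

lemma grad_prod_add:
  "grad_prod u (\<lambda>x. v x + w x) x = grad_prod u v x + grad_prod u w x"
  by (simp add: grad_prod_def algebra_simps sum.distrib[symmetric])

lemma grad_prod_scale: "grad_prod u (\<lambda>x. c * v x) x = c * grad_prod u v x"
  by (simp add: grad_prod_def sum_distrib_left algebra_simps)

lemma l2_shift:
  fixes u :: "int ^ 3 \<Rightarrow> real"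
  assumes "u \<in> wl2 (\<lambda>_. 1)"
  shows "(\<lambda>x. u (x + s)) \<in> wl2 (\<lambda>_. 1)"
    and "(\<Sum>\<^sub>\<infinity>x. (u (x + s))\<^sup>2) = (\<Sum>\<^sub>\<infinity>x. (u x)\<^sup>2)"
proof -
  have bij: "bij_betw (\<lambda>x. x + s) UNIV UNIV"
    by (rule bij_betwI[where g="\<lambda>y. y - s"]) auto
  show "(\<lambda>x. u (x + s)) \<in> wl2 (\<lambda>_. 1)"
    using assms summable_on_reindex_bij_betw[OF bij, of "\<lambda>x. (u x)\<^sup>2"] by (simp add: wl2_def)
  show "(\<Sum>\<^sub>\<infinity>x. (u (x + s))\<^sup>2) = (\<Sum>\<^sub>\<infinity>x. (u x)\<^sup>2)"
    by (rule infsum_reindex_bij_betw[OF bij, of "\<lambda>x. (u x)\<^sup>2"])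
qed

lemma grad_prod_summable:
  assumes "u \<in> wl2 (\<lambda>_. 1)" "v \<in> wl2 (\<lambda>_. 1)"
  shows "grad_prod u v summable_on UNIV"
proof -
  have "(\<lambda>x. (u (x + s) - u x) * (v (x + s) - v x)) summable_on UNIV" for s
    using assms by (intro l2_mult_summable wl2_diff l2_shift) auto
  then have "(\<lambda>x. \<Sum>s\<in>unit_steps. (u (x + s) - u x) * (v (x + s) - v x)) summable_on UNIV"
    by (intro summable_on_sum finite_unit_steps)
  then have "(\<lambda>x. 1 / 2 * (\<Sum>s\<in>unit_steps. (u (x + s) - u x) * (v (x + s) - v x))) summable_on UNIV"
    by (rule summable_on_cmult_right)
  then show ?thesis
    by (simp add: grad_prod_steps[abs_def])
qed

text \<open>One bilinear form serves for all inner products in use: the one of \<open>Hlam\<close>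
  (c = a, weight \<open>l * h x + 1\<close>), of \<open>H1\<close> (c = 1, weight 1), the Dirichlet
  form and the l^2 product. Bilinearity and Cauchy-Schwarz are thus proved once.\<close>

definition form :: "real \<Rightarrow> (int ^ 3 \<Rightarrow> real) \<Rightarrow> (int ^ 3 \<Rightarrow> real) \<Rightarrow> (int ^ 3 \<Rightarrow> real) \<Rightarrow> real" where
  "form c w u v = (\<Sum>\<^sub>\<infinity>x. c * grad_prod u v x + w x * u x * v x)"

abbreviation dirichlet :: "(int ^ 3 \<Rightarrow> real) \<Rightarrow> (int ^ 3 \<Rightarrow> real) \<Rightarrow> real" where
  "dirichlet \<equiv> form 1 (\<lambda>_. 0)"

abbreviation l2_inner :: "(int ^ 3 \<Rightarrow> real) \<Rightarrow> (int ^ 3 \<Rightarrow> real) \<Rightarrow> real" where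
  "l2_inner \<equiv> form 0 (\<lambda>_. 1)"

lemma l2_inner_self: "l2_inner u u = (\<Sum>\<^sub>\<infinity>x. (u x)\<^sup>2)"
  by (simp add: form_def power2_eq_square)

lemma dirichlet_self: "dirichlet u u = (\<Sum>\<^sub>\<infinity>x. grad_sq u x)"
  by (simp add: form_def)

lemma form_commute: "form c w u v = form c w v u"
  by (simp add: form_def grad_prod_commute[of u] mult_ac)

lemma form_summable:
  assumes "\<And>x. w x \<ge> 0" "u \<in> wl2 w" "v \<in> wl2 w"
  shows "(\<lambda>x. c * grad_prod u v x + w x * u x * v x) summable_on UNIV"
  using assms wl2_subset by (intro summable_on_add summable_on_cmult_right grad_prod_summable wl2_mult_summable) blast+

lemma form_add_right:
  assumes w: "\<And>x. w x \<ge> 0" "u \<in> wl2 w" "v1 \<in> wl2 w" "v2 \<in> wl2 w"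
  shows "form c w u (\<lambda>x. v1 x + v2 x) = form c w u v1 + form c w u v2"
proof -
  have "form c w u (\<lambda>x. v1 x + v2 x)
    = (\<Sum>\<^sub>\<infinity>x. (c * grad_prod u v1 x + w x * u x * v1 x) + (c * grad_prod u v2 x + w x * u x * v2 x))"
    unfolding form_def by (rule infsum_cong) (simp add: grad_prod_add algebra_simps)
  also have "\<dots> = form c w u v1 + form c w u v2"
    unfolding form_def using assms by (intro infsum_add form_summable)
  finally show ?thesis .
qed

lemma form_scale_right: "form c w u (\<lambda>x. k * v x) = k * form c w u v"
proof -
  have "form c w u (\<lambda>x. k * v x) = (\<Sum>\<^sub>\<infinity>x. k * (c * grad_prod u v x + w x * u x * v x))"
    unfolding form_def by (rule infsum_cong) (simp add: grad_prod_scale algebra_simps)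
  then show ?thesis by (simp add: form_def infsum_cmult_right')
qed

lemma form_uminus: "form c w (\<lambda>x. - u x) (\<lambda>x. - v x) = form c w u v"
  using form_scale_right[of c w "\<lambda>x. -1 * u x" "-1" v] form_scale_right[of c w v "-1" u]
  by (simp add: form_commute)

lemma form_add_self:
  assumes w: "\<And>x. w x \<ge> 0" "u \<in> wl2 w" "v \<in> wl2 w"
  shows "form c w (\<lambda>x. u x + v x) (\<lambda>x. u x + v x) = form c w u u + 2 * form c w u v + form c w v v"
proof -
  have uv: "(\<lambda>x. u x + v x) \<in> wl2 w" using assms by (rule wl2_add)
  have "form c w (\<lambda>x. u x + v x) (\<lambda>x. u x + v x)
     = form c w u (\<lambda>x. u x + v x) + form c w v (\<lambda>x. u x + v x)"
    using form_add_right[OF w(1) uv w(2,3)] by (simp add: form_commute)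
  then show ?thesis using form_add_right[OF w(1,2,2,3)] form_add_right[OF w(1,3,2,3)]
    by (simp add: form_commute)
qed

lemma grad_sq_nonneg: "grad_sq u x \<ge> 0"
  by (auto simp: grad_prod_def intro!: sum_nonneg)

lemma form_nonneg:
  assumes "c \<ge> 0" "\<And>x. w x \<ge> 0"
  shows "form c w u u \<ge> 0"
  unfolding form_def using assms by (intro infsum_nonneg) (simp add: grad_sq_nonneg mult.assoc)

lemma form_split:
  assumes w: "\<And>x. w x \<ge> 0" "u \<in> wl2 w" "v \<in> wl2 w"
  shows "form c w u v = c * dirichlet u v + form 0 w u v"
proof -
  have l2: "u \<in> wl2 (\<lambda>_. 1)" "v \<in> wl2 (\<lambda>_. 1)" using assms wl2_subset by blast+
  have "form c w u v = (\<Sum>\<^sub>\<infinity>x. c * grad_prod u v x) + (\<Sum>\<^sub>\<infinity>x. w x * u x * v x)"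
    unfolding form_def
    using assms l2 by (intro infsum_add wl2_mult_summable summable_on_cmult_right grad_prod_summable)
  then show ?thesis by (simp add: form_def infsum_cmult_right')
qed

text \<open>The quadratic polynomial t \<mapsto> form(u + t v, u + t v) is nonnegative, so its
  discriminant is not positive. The form may be degenerate, which is why \<open>?C = 0\<close> is a
  separate case.\<close>

lemma form_Cauchy_Schwarz:
  fixes u v :: "int ^ 3 \<Rightarrow> real"
  assumes c: "c \<ge> 0" and w: "\<And>x. w x \<ge> 0" "u \<in> wl2 w" "v \<in> wl2 w"
  shows "\<bar>form c w u v\<bar> \<le> sqrt (form c w u u) * sqrt (form c w v v)"
proof -
  let ?A = "form c w u u" and ?B = "form c w u v" and ?C = "form c w v v"
  have quad: "?A + 2 * t * ?B + t\<^sup>2 * ?C \<ge> 0" for t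
    using form_add_self[OF w(1,2) wl2_scale[OF w(3), of t], of c]
      form_nonneg[OF c, of w, OF w(1), where u="\<lambda>x. u x + t * v x"]
      form_commute[of c w "\<lambda>x. t * v x" v]
    by (simp add: form_scale_right power2_eq_square)
  have "?B\<^sup>2 \<le> ?A * ?C"
  proof (cases "?C = 0")
    case True
    have "?B = 0"
    proof (rule ccontr)
      assume "?B \<noteq> 0"
      \<comment> \<open>At this t the affine function \<open>?A + 2 * t * ?B\<close> equals
        -1.\<close>
      then show False using quad[of "- (?A + 1) / (2 * ?B)"] True by (simp add: field_simps)
    qed
    then show ?thesis using True by simp
  next
    case False
    then have C: "?C > 0" using form_nonneg[OF c, of w, OF w(1), where u=v] by simp
    from quad[of "- ?B / ?C"] have "0 \<le> ?A - ?B\<^sup>2 / ?C"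
      using C by (simp add: power2_eq_square field_simps)
    then show ?thesis using C by (simp add: field_simps)
  qed
  then show ?thesis
    by (metis real_sqrt_abs real_sqrt_le_iff real_sqrt_mult)
qed

lemma form_mono:
  assumes c: "0 \<le> c" "c \<le> c'" and w: "\<And>x. 0 \<le> w x" "\<And>x. w x \<le> w' x" and u: "u \<in> wl2 w'"
  shows "form c w u u \<le> form c' w' u u"
proof -
  have w': "0 \<le> w' x" for x using w order_trans by blast
  have le: "c * grad_sq u x + w x * u x * u x \<le> c' * grad_sq u x + w' x * u x * u x" for x
    using c w grad_sq_nonneg[of u x] by (simp add: add_mono mult_right_mono mult.assoc)
  have nn: "0 \<le> c * grad_sq u x + w x * u x * u x" for x
    using c w grad_sq_nonneg[of u x] by (simp add: mult.assoc)
  show ?thesis unfolding form_def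
    using summable_on_bounded_real[OF form_summable[OF w' u u, of c'], of "\<lambda>x. c * grad_sq u x + w x * u x * u x"]
    by (intro infsum_mono form_summable[OF w' u u]) (use le nn in auto)
qed

text \<open>This is bounded degree at work: each squared difference is at most twice the sum of the
  two squares, and after summation over x every step contributes at most twice the squared l^2 norm.
  It is the reason why the gradient adds nothing to the l^2 topology.\<close>

lemma dirichlet_le_l2:
  assumes u: "u \<in> wl2 (\<lambda>_. 1)"
  shows "dirichlet u u \<le> 2 * card unit_steps * l2_inner u u"
proof -
  have s: "(\<lambda>x. (u (x + s))\<^sup>2) summable_on UNIV" for s
    using l2_shift[OF u, of s] by (simp add: wl2_def)
  have s0: "(\<lambda>x. (u x)\<^sup>2) summable_on UNIV" using u by (simp add: wl2_def)
  have ss: "(\<lambda>x. \<Sum>s\<in>unit_steps. (u (x + s))\<^sup>2 + (u x)\<^sup>2) summable_on UNIV"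
    using s s0 by (intro summable_on_sum finite_unit_steps summable_on_add)
  have le: "grad_sq u x \<le> (\<Sum>s\<in>unit_steps. (u (x + s))\<^sup>2 + (u x)\<^sup>2)" for x
  proof -
    have "(u (x + s) - u x) * (u (x + s) - u x) \<le> 2 * ((u (x + s))\<^sup>2 + (u x)\<^sup>2)" for s
      using sum_squares_bound[of "u (x + s)" "- u x"] by (simp add: power2_eq_square algebra_simps)
    then show ?thesis
      unfolding grad_prod_steps sum_divide_distrib by (intro sum_mono) (simp add: field_simps)
  qed
  have "dirichlet u u \<le> (\<Sum>\<^sub>\<infinity>x. \<Sum>s\<in>unit_steps. (u (x + s))\<^sup>2 + (u x)\<^sup>2)"
    unfolding dirichlet_self by (intro infsum_mono grad_prod_summable u ss le)
  also have "\<dots> = (\<Sum>s\<in>unit_steps. \<Sum>\<^sub>\<infinity>x. (u (x + s))\<^sup>2 + (u x)\<^sup>2)"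
    using s s0 by (intro infsum_sum finite_unit_steps summable_on_add)
  also have "\<dots> = (\<Sum>s\<in>unit_steps. 2 * l2_inner u u)"
    using l2_shift(2)[OF u] s s0 by (intro sum.cong) (simp_all add: infsum_add l2_inner_self)
  finally show ?thesis by simp
qed

text \<open>On a discrete space this replaces the Sobolev embedding: norm bounds become sup bounds,
  so local estimates on the nonlinearity suffice.\<close>

lemma abs_le_l2:
  assumes "u \<in> wl2 (\<lambda>_. 1)"
  shows "\<bar>u x\<bar> \<le> sqrt (l2_inner u u)"
proof -
  have "sum (\<lambda>x. (u x)\<^sup>2) {x} \<le> (\<Sum>\<^sub>\<infinity>x. (u x)\<^sup>2)"
    using assms by (intro finite_sum_le_infsum) (auto simp: wl2_def)
  then show ?thesis by (intro real_le_rsqrt) (simp add: l2_inner_self)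
qed

subsection \<open>The logarithmic nonlinearity\<close>

text \<open>This is the antiderivative, vanishing at 0, of the negated nonlinearity
  \<open>log_term\<close>; the coefficient \<open>2 / p\<^sup>2\<close> is what integration by parts
  of |t|^(p-2) t log t^2 leaves behind.\<close>

definition log_prim :: "real \<Rightarrow> real \<Rightarrow> real" where
  "log_prim p t = 2 / p\<^sup>2 * \<bar>t\<bar> powr p - 1 / p * (\<bar>t\<bar> powr p * ln (t\<^sup>2))"

definition log_term :: "real \<Rightarrow> real \<Rightarrow> real" where
  "log_term p t = - (t * \<bar>t\<bar> powr (p - 2) * ln (t\<^sup>2))"

lemma log_prim_0 [simp]: "log_prim p 0 = 0" and log_term_0 [simp]: "log_term p 0 = 0"
  by (simp_all add: log_prim_def log_term_def)

lemma log_prim_uminus [simp]: "log_prim p (- t) = log_prim p t"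
  by (simp add: log_prim_def)

lemma abs_powr_split: "\<bar>t::real\<bar> powr p = t\<^sup>2 * \<bar>t\<bar> powr (p - 2)"
proof (cases "t = 0")
  case False
  then show ?thesis using powr_add[of "\<bar>t\<bar>" 2 "p - 2"] by simp
qed auto

text \<open>The logarithms cancel and a power with positive coefficient remains. All energy bounds
  rest on this cancellation.\<close>

lemma log_prim_minus_log_term:
  assumes "p > 0"
  shows "log_prim p t - 1 / p * (log_term p t * t) = 2 / p\<^sup>2 * \<bar>t\<bar> powr p"
  by (simp add: log_prim_def log_term_def abs_powr_split[of t p] power2_eq_square algebra_simps)

text \<open>Since |ln x| \<le> (x^q + x^(-q)) / q for all x > 0, multiplication by x^q gives (x^(2q)
  + 1) / q, with no singularity at 0; the factor 2 comes from ln t^2 = 2 ln |t|.\<close>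

lemma abs_powr_ln_bound:
  fixes q t R :: real
  assumes q: "q > 0" and t: "\<bar>t\<bar> \<le> R"
  shows "\<bar>\<bar>t\<bar> powr q * ln (t\<^sup>2)\<bar> \<le> 2 * (R powr (2 * q) + 1) / q"
proof (cases "t = 0")
  case True
  then show ?thesis using q by simp
next
  case False
  define x where "x = \<bar>t\<bar>"
  have x: "x > 0" using False by (simp add: x_def)
  have lnx: "ln (t\<^sup>2) = 2 * ln x"
    using ln_realpow[of x 2] x by (simp add: x_def)
  have "\<bar>ln x\<bar> \<le> (x powr q + x powr (- q)) / q"
  proof (cases "x \<ge> 1")
    case True
    then have "\<bar>ln x\<bar> \<le> x powr q / q" using ln_powr_bound[OF True q] by simp
    also have "\<dots> \<le> (x powr q + x powr (- q)) / q" using q by (simp add: divide_right_mono)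
    finally show ?thesis .
  next
    case False
    then have "ln (1 / x) \<le> (1 / x) powr q / q" using x q by (intro ln_powr_bound) auto
    then have "\<bar>ln x\<bar> \<le> x powr (- q) / q"
      using False x by (simp add: ln_div powr_divide powr_minus_divide)
    also have "\<dots> \<le> (x powr q + x powr (- q)) / q" using q by (simp add: divide_right_mono)
    finally show ?thesis .
  qed
  then have "x powr q * \<bar>ln x\<bar> \<le> x powr q * ((x powr q + x powr (- q)) / q)"
    by (intro mult_left_mono) auto
  also have "\<dots> = (x powr (2 * q) + 1) / q"
    using x by (simp add: algebra_simps add_divide_distrib powr_add[symmetric])
  also have "\<dots> \<le> (R powr (2 * q) + 1) / q"
    using q t x by (intro divide_right_mono add_right_mono powr_mono2) (auto simp: x_def)
  finally have "x powr q * \<bar>ln x\<bar> \<le> (R powr (2 * q) + 1) / q" .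
  moreover have "\<bar>\<bar>t\<bar> powr q * ln (t\<^sup>2)\<bar> = 2 * (x powr q * \<bar>ln x\<bar>)"
    using lnx by (simp add: x_def abs_mult)
  moreover have "2 * (R powr (2 * q) + 1) / q = 2 * ((R powr (2 * q) + 1) / q)" by simp
  ultimately show ?thesis by linarith
qed

lemma abs_powr_has_derivative:
  fixes t :: real
  assumes "t \<noteq> 0"
  shows "((\<lambda>t. \<bar>t\<bar> powr q) has_real_derivative q * \<bar>t\<bar> powr (q - 2) * t) (at t)"
proof (cases "t > 0")
  case True
  have "((\<lambda>t. t powr q) has_real_derivative q * \<bar>t\<bar> powr (q - 2) * t) (at t)"
    using True powr_mult_base[of t "q - 2"]
    by (auto intro!: derivative_eq_intros simp: mult_ac)
  then show ?thesis
    by (rule has_field_derivative_transform_within_open[where S="{0<..}"]) (use True in auto)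
next
  case False
  then have neg: "t < 0" using assms by simp
  have "((\<lambda>t. (- t) powr q) has_real_derivative q * \<bar>t\<bar> powr (q - 2) * t) (at t)"
  proof -
    have "t * (- t) powr (q - 2) = - ((- t) powr (q - 1))" using neg powr_mult_base[of "-t" "q - 2"] by simp
    then show ?thesis using neg by (auto intro!: derivative_eq_intros simp: mult_ac)
  qed
  then show ?thesis
    by (rule has_field_derivative_transform_within_open[where S="{..<0}"]) (use neg in auto)
qed

lemma ln_square_has_derivative:
  fixes t :: real
  assumes "t \<noteq> 0"
  shows "((\<lambda>t. ln (t\<^sup>2)) has_real_derivative 2 / t) (at t)"
proof -
  have "((\<lambda>t. ln (t\<^sup>2)) has_real_derivative 1 / t\<^sup>2 * (2 * t)) (at t)"
    using assms by (auto intro!: derivative_eq_intros)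
  then show ?thesis using assms by (simp add: power2_eq_square)
qed

lemma quadratic_bound_derivative_0:
  fixes f :: "real \<Rightarrow> real"
  assumes "\<And>t. \<bar>t\<bar> \<le> 1 \<Longrightarrow> \<bar>f t\<bar> \<le> C * t\<^sup>2"
  shows "(f has_real_derivative 0) (at 0)"
proof -
  have f0: "f 0 = 0" using assms[of 0] by simp
  have "((\<lambda>t. f t / t) \<longlongrightarrow> 0) (at 0)"
  proof (rule Lim_null_comparison)
    show "((\<lambda>t::real. C * \<bar>t\<bar>) \<longlongrightarrow> 0) (at 0)"
      by (auto intro!: tendsto_eq_intros)
    have "\<forall>\<^sub>F t in at (0::real). \<bar>t\<bar> \<le> 1 \<and> t \<noteq> 0"
      by (auto simp: eventually_at intro!: exI[of _ 1])
    then show "\<forall>\<^sub>F t in at 0. norm (f t / t) \<le> C * \<bar>t\<bar>"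
    proof eventually_elim
      case (elim t)
      then have "\<bar>f t\<bar> \<le> C * \<bar>t\<bar> * \<bar>t\<bar>" using assms[of t] by (simp add: power2_eq_square mult.assoc)
      then show ?case using elim by (simp add: abs_divide pos_divide_le_eq)
    qed
  qed
  then show ?thesis using f0 by (simp add: has_field_derivative_iff)
qed

lemma log_prim_has_derivative:
  assumes p: "p > 2"
  shows "(log_prim p has_real_derivative log_term p t) (at t)"
proof (cases "t = 0")
  case True
  \<comment> \<open>Factoring t^2 out of \<open>log_prim p t\<close> leaves powers with exponent p -
    2 > 0, which \<open>abs_powr_ln_bound\<close> controls on |t| \<le> 1.\<close>
  let ?C = "2 / p\<^sup>2 + 1 / p * (2 * (1 powr (2 * (p - 2)) + 1) / (p - 2))"
  have "\<bar>log_prim p t\<bar> \<le> ?C * t\<^sup>2" if t: "\<bar>t\<bar> \<le> 1" for t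
  proof -
    have 1: "\<bar>t\<bar> powr (p - 2) \<le> 1"
      using t p powr_mono2[of "p - 2" "\<bar>t\<bar>" 1] by simp
    have "log_prim p t = t\<^sup>2 * (2 / p\<^sup>2 * \<bar>t\<bar> powr (p - 2) - 1 / p * (\<bar>t\<bar> powr (p - 2) * ln (t\<^sup>2)))"
      by (simp add: log_prim_def abs_powr_split[of t p] algebra_simps)
    moreover have "\<bar>2 / p\<^sup>2 * \<bar>t\<bar> powr (p - 2) - 1 / p * (\<bar>t\<bar> powr (p - 2) * ln (t\<^sup>2))\<bar>
        \<le> \<bar>2 / p\<^sup>2 * \<bar>t\<bar> powr (p - 2)\<bar> + \<bar>1 / p * (\<bar>t\<bar> powr (p - 2) * ln (t\<^sup>2))\<bar>"
      by (rule abs_triangle_ineq4)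
    moreover have "\<bar>2 / p\<^sup>2 * \<bar>t\<bar> powr (p - 2)\<bar> \<le> 2 / p\<^sup>2"
      using mult_left_mono[OF 1, of "2 / p\<^sup>2"] by (simp add: abs_mult)
    moreover have "\<bar>1 / p * (\<bar>t\<bar> powr (p - 2) * ln (t\<^sup>2))\<bar>
        \<le> 1 / p * (2 * (1 powr (2 * (p - 2)) + 1) / (p - 2))"
      using mult_left_mono[OF abs_powr_ln_bound[of "p - 2" t 1], of "1 / p"] p t
      by (simp add: abs_mult)
    ultimately show ?thesis
      by (simp add: abs_mult mult.commute[of _ "t\<^sup>2"] mult_left_mono)
  qed
  then show ?thesis using quadratic_bound_derivative_0[of "log_prim p" ?C] True by simp
next
  case False
  have "(log_prim p has_real_derivative 2 / p\<^sup>2 * (p * \<bar>t\<bar> powr (p - 2) * t)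
      - 1 / p * (p * \<bar>t\<bar> powr (p - 2) * t * ln (t\<^sup>2) + 2 / t * \<bar>t\<bar> powr p)) (at t)"
    unfolding log_prim_def[abs_def]
    by (intro DERIV_diff DERIV_cmult DERIV_mult abs_powr_has_derivative ln_square_has_derivative False)
  then show ?thesis
    using False p by (simp add: abs_powr_split[of t p] log_term_def field_simps power2_eq_square)
qed

definition log_term_deriv :: "real \<Rightarrow> real \<Rightarrow> real" where
  "log_term_deriv p t = - ((p - 1) * (\<bar>t\<bar> powr (p - 2) * ln (t\<^sup>2)) + 2 * \<bar>t\<bar> powr (p - 2))"

text \<open>Here the threshold p > 3 arises: at 0, factoring t^2 out of t |t|^(p-2) leaves the
  exponent p - 3, which must be positive to absorb the logarithm.\<close>

lemma log_term_has_derivative: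
  assumes p: "p > 3"
  shows "(log_term p has_real_derivative log_term_deriv p t) (at t)"
proof (cases "t = 0")
  case True
  let ?C = "2 * (1 powr (2 * (p - 3)) + 1) / (p - 3)"
  have "\<bar>log_term p t\<bar> \<le> ?C * t\<^sup>2" if t: "\<bar>t\<bar> \<le> 1" for t
  proof -
    have "\<bar>t\<bar> powr (p - 2) = \<bar>t\<bar> * \<bar>t\<bar> powr (p - 3)"
      by (cases "t = 0") (simp_all add: powr_mult_base)
    then have "\<bar>log_term p t\<bar> = \<bar>\<bar>t\<bar> powr (p - 3) * ln (t\<^sup>2)\<bar> * t\<^sup>2"
      by (simp add: log_term_def abs_mult power2_eq_square mult_ac)
    also have "\<dots> \<le> ?C * t\<^sup>2"
      using abs_powr_ln_bound[of "p - 3" t 1] p t by (intro mult_right_mono) auto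
    finally show ?thesis .
  qed
  then show ?thesis using quadratic_bound_derivative_0[of "log_term p" ?C] True
    by (simp add: log_term_deriv_def)
next
  case False
  have "\<bar>t\<bar> powr (p - 2) = t\<^sup>2 * \<bar>t\<bar> powr (p - 4)" using abs_powr_split[of t "p - 2"] by simp
  then have sq: "t * ((p - 2) * \<bar>t\<bar> powr (p - 2 - 2) * t) = (p - 2) * \<bar>t\<bar> powr (p - 2)"
    by (simp add: power2_eq_square)
  have "(log_term p has_real_derivative
      - ((1 * \<bar>t\<bar> powr (p - 2) + ((p - 2) * \<bar>t\<bar> powr (p - 2 - 2) * t) * t) * ln (t\<^sup>2)
        + 2 / t * (t * \<bar>t\<bar> powr (p - 2)))) (at t)"
    unfolding log_term_def[abs_def]
    by (intro DERIV_minus DERIV_mult DERIV_ident abs_powr_has_derivative ln_square_has_derivative False)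
  moreover have "- ((1 * \<bar>t\<bar> powr (p - 2) + ((p - 2) * \<bar>t\<bar> powr (p - 2 - 2) * t) * t) * ln (t\<^sup>2)
        + 2 / t * (t * \<bar>t\<bar> powr (p - 2))) = log_term_deriv p t"
  proof -
    have sq': "(p - 2) * \<bar>t\<bar> powr (p - 2 - 2) * t * t = (p - 2) * \<bar>t\<bar> powr (p - 2)"
      using sq by (simp only: mult_ac)
    show ?thesis using False unfolding sq' log_term_deriv_def by (simp add: algebra_simps)
  qed
  ultimately show ?thesis by simp
qed

lemma log_term_Lipschitz:
  assumes p: "p > 3"
  obtains C where "C \<ge> 0" "\<And>s t. \<bar>s\<bar> \<le> R \<Longrightarrow> \<bar>t\<bar> \<le> R \<Longrightarrow> \<bar>log_term p s - log_term p t\<bar> \<le> C * \<bar>s - t\<bar>"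
proof
  \<comment> \<open>A bound for \<open>log_term_deriv p\<close> on [-R, R], to be used in the mean
    value inequality.\<close>
  let ?C = "\<bar>p - 1\<bar> * (2 * (R powr (2 * (p - 2)) + 1) / (p - 2)) + 2 * R powr (p - 2)"
  show "?C \<ge> 0" using p by simp
  have bd: "norm (log_term_deriv p t) \<le> ?C" if t: "\<bar>t\<bar> \<le> R" for t
  proof -
    have "\<bar>log_term_deriv p t\<bar> \<le> \<bar>(p - 1) * (\<bar>t\<bar> powr (p - 2) * ln (t\<^sup>2))\<bar> + \<bar>2 * \<bar>t\<bar> powr (p - 2)\<bar>"
      unfolding log_term_deriv_def abs_minus_cancel by (rule abs_triangle_ineq)
    moreover have "\<bar>t\<bar> powr (p - 2) \<le> R powr (p - 2)"
      using t p by (intro powr_mono2) auto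
    moreover have "\<bar>(p - 1) * (\<bar>t\<bar> powr (p - 2) * ln (t\<^sup>2))\<bar> \<le> \<bar>p - 1\<bar> * (2 * (R powr (2 * (p - 2)) + 1) / (p - 2))"
      unfolding abs_mult[of "p - 1"] using abs_powr_ln_bound[of "p - 2" t R] p t by (intro mult_left_mono) auto
    ultimately show ?thesis by simp
  qed
  show "\<bar>log_term p s - log_term p t\<bar> \<le> ?C * \<bar>s - t\<bar>" if "\<bar>s\<bar> \<le> R" "\<bar>t\<bar> \<le> R" for s t
    using field_differentiable_bound[of "{-R..R}" "log_term p" "log_term_deriv p" ?C s t]
      has_field_derivative_at_within[OF log_term_has_derivative[OF p]] bd that
    by (auto simp: abs_le_iff)
qed

text \<open>Taylor's formula of first order without a second derivative of \<open>log_prim\<close>: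
  the function z \<mapsto> G(z) - g(t) z has derivative g(z) - g(t), which is at most C |s| on the
  segment from t to t + s by the Lipschitz bound. The last two estimates are the case of base point
  0.\<close>

lemma log_prim_remainder:
  assumes p: "p > 3"
  obtains C where "C \<ge> 0" "\<And>s t. \<bar>t\<bar> \<le> R \<Longrightarrow> \<bar>t + s\<bar> \<le> R \<Longrightarrow>
    \<bar>log_prim p (t + s) - log_prim p t - log_term p t * s\<bar> \<le> C * s\<^sup>2"
    "\<And>t. \<bar>t\<bar> \<le> R \<Longrightarrow> \<bar>log_term p t\<bar> \<le> C * \<bar>t\<bar>"
    "\<And>t. \<bar>t\<bar> \<le> R \<Longrightarrow> \<bar>log_prim p t\<bar> \<le> C * t\<^sup>2"
proof -
  obtain C where C: "C \<ge> 0" "\<And>s t. \<bar>s\<bar> \<le> R \<Longrightarrow> \<bar>t\<bar> \<le> R \<Longrightarrow> \<bar>log_term p s - log_term p t\<bar> \<le> C * \<bar>s - t\<bar>"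
    using log_term_Lipschitz[OF p, of R] by metis
  have rem: "\<bar>log_prim p (t + s) - log_prim p t - log_term p t * s\<bar> \<le> C * s\<^sup>2"
    if t: "\<bar>t\<bar> \<le> R" "\<bar>t + s\<bar> \<le> R" for s t
  proof -
    let ?S = "closed_segment t (t + s)"
    have "norm ((log_prim p (t + s) - log_term p t * (t + s)) - (log_prim p t - log_term p t * t))
        \<le> C * \<bar>s\<bar> * norm (t + s - t)"
    proof (rule field_differentiable_bound[where S="?S" and f'="\<lambda>z. log_term p z - log_term p t"
          and f="\<lambda>z. log_prim p z - log_term p t * z"])
      fix z assume z: "z \<in> ?S"
      show "((\<lambda>z. log_prim p z - log_term p t * z) has_real_derivative log_term p z - log_term p t) (at z within ?S)"
        using p by (auto intro!: derivative_eq_intros has_field_derivative_at_within[OF log_prim_has_derivative])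
      have "\<bar>z\<bar> \<le> R" "\<bar>z - t\<bar> \<le> \<bar>s\<bar>" using z t by (auto simp: closed_segment_eq_real_ivl abs_le_iff split: if_splits)
      then show "norm (log_term p z - log_term p t) \<le> C * \<bar>s\<bar>"
        using C(2)[of z t] t C(1) mult_left_mono[of "\<bar>z - t\<bar>" "\<bar>s\<bar>" C] by simp
    qed auto
    then show ?thesis by (simp add: algebra_simps power2_eq_square)
  qed
  show ?thesis
  proof (rule that[OF C(1) rem])
    show "\<bar>log_term p t\<bar> \<le> C * \<bar>t\<bar>" if "\<bar>t\<bar> \<le> R" for t using C(2)[of t 0] that by simp
    show "\<bar>log_prim p t\<bar> \<le> C * t\<^sup>2" if "\<bar>t\<bar> \<le> R" for t using rem[of 0 t] that by simp
  qed
qed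

lemma log_prim_summable:
  assumes p: "p > 3" and u: "u \<in> wl2 (\<lambda>_. 1)"
  shows "(\<lambda>x :: int ^ 3. log_prim p (u x)) summable_on UNIV"
proof -
  obtain C where C: "\<And>t. \<bar>t\<bar> \<le> sqrt (l2_inner u u) \<Longrightarrow> \<bar>log_prim p t\<bar> \<le> C * t\<^sup>2"
    using log_prim_remainder[OF p, of "sqrt (l2_inner u u)"] by metis
  have "(\<lambda>x. C * (u x)\<^sup>2) summable_on UNIV"
    using u by (intro summable_on_cmult_right) (simp add: wl2_def)
  then show ?thesis by (rule summable_on_bounded_real) (rule C[OF abs_le_l2[OF u]])
qed

lemma log_term_l2:
  assumes p: "p > 3" and u: "u \<in> wl2 (\<lambda>_. 1)"
  shows "(\<lambda>x :: int ^ 3. log_term p (u x)) \<in> wl2 (\<lambda>_. 1)"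
proof -
  obtain C where C: "C \<ge> 0" "\<And>t. \<bar>t\<bar> \<le> sqrt (l2_inner u u) \<Longrightarrow> \<bar>log_term p t\<bar> \<le> C * \<bar>t\<bar>"
    using log_prim_remainder[OF p, of "sqrt (l2_inner u u)"] by metis
  show ?thesis
  proof (rule wl2_bounded[OF _ wl2_scale[OF u, of C]])
    show "\<bar>log_term p (u x)\<bar> \<le> \<bar>C * u x\<bar>" for x
      using C(2)[OF abs_le_l2[OF u, of x]] C(1) by (simp add: abs_mult)
  qed simp
qed

lemma abs_powr_summable:
  assumes p: "p > 2" and u: "u \<in> wl2 (\<lambda>_. 1)"
  shows "(\<lambda>x :: int ^ 3. \<bar>u x\<bar> powr p) summable_on UNIV"
proof (rule summable_on_bounded_real[where g="\<lambda>x. (sqrt (l2_inner u u)) powr (p - 2) * (u x)\<^sup>2"])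
  show "(\<lambda>x. (sqrt (l2_inner u u)) powr (p - 2) * (u x)\<^sup>2) summable_on UNIV"
    using u by (auto simp: wl2_def intro!: summable_on_cmult_right)
  show "\<bar>\<bar>u x\<bar> powr p\<bar> \<le> (sqrt (l2_inner u u)) powr (p - 2) * (u x)\<^sup>2" for x
    unfolding abs_powr_split[of "u x" p]
    using powr_mono2[of "p - 2" "\<bar>u x\<bar>" "sqrt (l2_inner u u)"] p abs_le_l2[OF u, of x]
    by (simp add: mult.commute mult_left_mono)
qed

subsection \<open>Frechet derivative of the energy\<close>

text \<open>The gradient terms and the sums run over the whole lattice for every weight, so
  differentiability is proved once and both functionals inherit it.\<close>

definition energy :: "real \<Rightarrow> real \<Rightarrow> real \<Rightarrow> (int ^ 3 \<Rightarrow> real) \<Rightarrow> (int ^ 3 \<Rightarrow> real) \<Rightarrow> real" where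
  "energy a b p w u = 1/2 * form a w u u + b/4 * (dirichlet u u)\<^sup>2 + (\<Sum>\<^sub>\<infinity>x. log_prim p (u x))"

definition energy_deriv ::
  "real \<Rightarrow> real \<Rightarrow> real \<Rightarrow> (int ^ 3 \<Rightarrow> real) \<Rightarrow> (int ^ 3 \<Rightarrow> real) \<Rightarrow> (int ^ 3 \<Rightarrow> real) \<Rightarrow> real" where
  "energy_deriv a b p w u \<phi> =
     form a w u \<phi> + b * dirichlet u u * dirichlet u \<phi> + (\<Sum>\<^sub>\<infinity>x. log_term p (u x) * \<phi> x)"

text \<open>\<open>frechet_on\<close> is a Hilbert choice, so it is computable only through
  uniqueness: two candidates differ by o(N) along multiples t \<phi>, and by linearity the factor t
  cancels.\<close>

lemma frechet_on_eqI:
  assumes L: "has_frechet_on V N J u L" and \<phi>: "\<phi> \<in> V"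
    and V: "\<And>c \<psi>. \<psi> \<in> V \<Longrightarrow> (\<lambda>x. c * \<psi> x) \<in> V"
    and N: "\<And>c \<psi>. \<psi> \<in> V \<Longrightarrow> N (\<lambda>x. c * \<psi> x) = \<bar>c\<bar> * N \<psi>" "\<And>\<psi>. \<psi> \<in> V \<Longrightarrow> N \<psi> \<ge> 0"
  shows "frechet_on V N J u \<phi> = L \<phi>"
proof -
  define L' where "L' = frechet_on V N J u"
  have L': "has_frechet_on V N J u L'"
    unfolding L'_def frechet_on_def using L by (rule someI[where P="has_frechet_on V N J u"])
  have "\<bar>L' \<phi> - L \<phi>\<bar> \<le> 0"
  proof (rule field_le_epsilon)
    fix \<epsilon> :: real assume \<epsilon>: "\<epsilon> > 0"
    define e where "e = \<epsilon> / (2 * (N \<phi> + 1))"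
    have N0: "N \<phi> \<ge> 0" using N(2)[OF \<phi>] .
    have e: "e > 0" using \<epsilon> N0 by (simp add: e_def)
    obtain d where d: "d > 0" "\<And>\<psi>. \<psi> \<in> V \<Longrightarrow> N \<psi> < d \<Longrightarrow> \<bar>J (\<lambda>x. u x + \<psi> x) - J u - L \<psi>\<bar> \<le> e * N \<psi>"
      using L e unfolding has_frechet_on_def by meson
    obtain d' where d': "d' > 0" "\<And>\<psi>. \<psi> \<in> V \<Longrightarrow> N \<psi> < d' \<Longrightarrow> \<bar>J (\<lambda>x. u x + \<psi> x) - J u - L' \<psi>\<bar> \<le> e * N \<psi>"
      using L' e unfolding has_frechet_on_def by meson
    \<comment> \<open>This makes N(t \<phi>) < min d d'; the added 1 covers N \<phi> = 0.\<close>
    define t where "t = min d d' / (N \<phi> + 1)"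
    have t: "t > 0" using d(1) d'(1) N0 by (simp add: t_def)
    let ?\<psi> = "\<lambda>x. t * \<phi> x"
    have N\<psi>: "N ?\<psi> = t * N \<phi>" using N(1)[OF \<phi>, of t] t by simp
    have "t * (N \<phi> + 1) = min d d'" using N0 by (simp add: t_def)
    then have less: "N ?\<psi> < min d d'" using t unfolding N\<psi> distrib_left by linarith
    have "L ?\<psi> = t * L \<phi>" "L' ?\<psi> = t * L' \<phi>"
      using L L' \<phi> unfolding has_frechet_on_def by auto
    then have "\<bar>t * L' \<phi> - t * L \<phi>\<bar> \<le> 2 * (e * (t * N \<phi>))"
      using d(2)[OF V[OF \<phi>], of t] d'(2)[OF V[OF \<phi>], of t] less unfolding N\<psi> by (simp add: N\<psi>)
    moreover have "\<bar>t * L' \<phi> - t * L \<phi>\<bar> = t * \<bar>L' \<phi> - L \<phi>\<bar>"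
      using t by (simp add: abs_mult right_diff_distrib[symmetric])
    ultimately have "t * \<bar>L' \<phi> - L \<phi>\<bar> \<le> t * (2 * e * N \<phi>)" by (simp add: mult_ac)
    then have "\<bar>L' \<phi> - L \<phi>\<bar> \<le> 2 * e * N \<phi>" using t by simp
    also have "\<dots> \<le> \<epsilon>" using \<epsilon> N0 by (simp add: e_def field_simps)
    finally show "\<bar>L' \<phi> - L \<phi>\<bar> \<le> 0 + \<epsilon>" by simp
  qed
  then show ?thesis by (simp add: L'_def)
qed

lemma wl2_ge_1:
  assumes w: "\<And>x. w x \<ge> (1::real)" and u: "u \<in> wl2 w"
  shows "l2_inner u u \<le> form c w u u - c * dirichlet u u"
proof -
  have w0: "w x \<ge> 0" for x using w[of x] by simp
  have "l2_inner u u \<le> form 0 w u u" using w u by (intro form_mono) auto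
  then show ?thesis using form_split[OF w0 u u, of c] by simp
qed

text \<open>D + 2d + e is the Dirichlet energy of u + \<phi>, and 4Dd is the linear part of its
  square. The rest is 4d^2 + e^2 + 2De + 4de, where 4d^2 \<le> 4De and |4de| \<le> 2De +
  2e^2.\<close>

lemma square_expansion_bound:
  fixes D d e :: real
  assumes D: "D \<ge> 0" and e: "e \<ge> 0" and d: "d\<^sup>2 \<le> D * e" "\<bar>d\<bar> \<le> (D + e) / 2"
  shows "\<bar>(D + 2 * d + e)\<^sup>2 - D\<^sup>2 - 4 * D * d\<bar> \<le> 8 * D * e + 3 * e\<^sup>2"
proof -
  have "2 * (\<bar>d\<bar> * e) \<le> D * e + e * e" using mult_right_mono[OF d(2) e] by (simp add: algebra_simps)
  moreover have "d * e \<le> \<bar>d\<bar> * e" "- (d * e) \<le> \<bar>d\<bar> * e"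
    using mult_right_mono[OF abs_ge_self e] mult_right_mono[OF abs_ge_minus_self e] by auto
  moreover have "D * e \<ge> 0" "e * e \<ge> 0" "d * d \<ge> 0" "d * d \<le> D * e"
    using D e d by (auto simp: power2_eq_square)
  moreover have "(D + 2 * d + e)\<^sup>2 - D\<^sup>2 - 4 * D * d = 4 * (d * d) + e * e + 2 * (D * e) + 4 * (d * e)"
    "8 * D * e + 3 * e\<^sup>2 = 8 * (D * e) + 3 * (e * e)"
    by (simp_all add: power2_eq_square algebra_simps)
  ultimately show ?thesis by (simp only:)
qed

text \<open>A quadratic remainder, stronger than differentiability: it yields the Frechet derivative
  and, later, stationarity at a maximum along a line.\<close>

lemma energy_remainder:
  assumes a: "a > 0" and b: "b > 0" and p: "p > 3"
    and w: "\<And>x. w x \<ge> 1" and u: "u \<in> wl2 w"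
  obtains K where "K \<ge> 0" "\<And>\<phi>. \<phi> \<in> wl2 w \<Longrightarrow> form a w \<phi> \<phi> \<le> 1 \<Longrightarrow>
    \<bar>energy a b p w (\<lambda>x. u x + \<phi> x) - energy a b p w u - energy_deriv a b p w u \<phi>\<bar> \<le> K * form a w \<phi> \<phi>"
proof -
  have w0: "w x \<ge> 0" for x using w[of x] by simp
  have l2: "v \<in> wl2 (\<lambda>_. 1)" if "v \<in> wl2 w" for v using that wl2_subset by blast
  \<comment> \<open>The 1 leaves room for the perturbation: since the weight is at least 1,
    \<open>form a w \<phi> \<phi> \<le> 1\<close> forces |\<phi> x| \<le> 1 everywhere.\<close>
  let ?R = "sqrt (l2_inner u u) + 1"
  obtain C where C: "C \<ge> 0" "\<And>s t. \<bar>t\<bar> \<le> ?R \<Longrightarrow> \<bar>t + s\<bar> \<le> ?R \<Longrightarrow>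
    \<bar>log_prim p (t + s) - log_prim p t - log_term p t * s\<bar> \<le> C * s\<^sup>2"
    using log_prim_remainder[OF p, of ?R] by metis
  let ?D = "dirichlet u u"
  have D0: "?D \<ge> 0" by (rule form_nonneg) auto
  \<comment> \<open>The three summands come from the quadratic term, from
    \<open>square_expansion_bound\<close> with e \<le> A/a and e^2 \<le> A/a^2 (as A \<le> 1), and
    from the remainder of \<open>log_prim\<close>.\<close>
  let ?K = "1/2 + b/4 * (8 * ?D / a + 3 / a\<^sup>2) + C"
  show ?thesis
  proof
    show "?K \<ge> 0" using a b D0 C(1) by simp
    fix \<phi> assume \<phi>: "\<phi> \<in> wl2 w" and small: "form a w \<phi> \<phi> \<le> 1"
    let ?A = "form a w \<phi> \<phi>" and ?d = "dirichlet u \<phi>" and ?e = "dirichlet \<phi> \<phi>"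
    let ?r = "\<lambda>x. log_prim p (u x + \<phi> x) - log_prim p (u x) - log_term p (u x) * \<phi> x"
    have A0: "?A \<ge> 0" using a w0 by (intro form_nonneg) auto
    have e0: "?e \<ge> 0" by (rule form_nonneg) auto
    have l20: "l2_inner \<phi> \<phi> \<ge> 0" by (rule form_nonneg) auto
    have sum: "l2_inner \<phi> \<phi> + a * ?e \<le> ?A" using wl2_ge_1[OF w \<phi>, of a] by simp
    have l2A: "l2_inner \<phi> \<phi> \<le> ?A" using sum mult_nonneg_nonneg[of a ?e] a e0 by linarith
    have ea: "?e \<le> ?A / a" using sum l20 a by (simp add: field_simps)
    have \<phi>1: "\<bar>\<phi> x\<bar> \<le> 1" for x
      using abs_le_l2[OF l2[OF \<phi>], of x] l2A small real_sqrt_le_mono[of "l2_inner \<phi> \<phi>" 1]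
      unfolding real_sqrt_one by linarith
    have u1: "\<bar>u x\<bar> \<le> sqrt (l2_inner u u)" for x by (rule abs_le_l2[OF l2[OF u]])
    have r: "\<bar>?r x\<bar> \<le> C * (\<phi> x)\<^sup>2" for x
      using \<phi>1[of x] u1[of x] by (intro C(2)) auto
    have up: "(\<lambda>x. u x + \<phi> x) \<in> wl2 w" using w0 u \<phi> by (rule wl2_add)
    have s\<phi>: "(\<lambda>x. (\<phi> x)\<^sup>2) summable_on UNIV" using \<phi> by (simp add: wl2_def)
    have split: "(\<Sum>\<^sub>\<infinity>x. log_prim p (u x + \<phi> x))
        = (\<Sum>\<^sub>\<infinity>x. log_prim p (u x)) + (\<Sum>\<^sub>\<infinity>x. log_term p (u x) * \<phi> x) + (\<Sum>\<^sub>\<infinity>x. ?r x)"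
    proof -
      have s1: "(\<lambda>x. log_prim p (u x)) summable_on UNIV" using log_prim_summable[OF p l2[OF u]] .
      have s2: "(\<lambda>x. log_term p (u x) * \<phi> x) summable_on UNIV"
        using l2_mult_summable[OF log_term_l2[OF p l2[OF u]] l2[OF \<phi>]] .
      have s3: "?r summable_on UNIV"
        by (rule summable_on_bounded_real[OF summable_on_cmult_right[OF s\<phi>, of C]]) (use r in auto)
      have "(\<Sum>\<^sub>\<infinity>x. log_prim p (u x + \<phi> x)) = (\<Sum>\<^sub>\<infinity>x. (log_prim p (u x) + log_term p (u x) * \<phi> x) + ?r x)"
        by (rule infsum_cong) simp
      also have "\<dots> = (\<Sum>\<^sub>\<infinity>x. log_prim p (u x) + log_term p (u x) * \<phi> x) + (\<Sum>\<^sub>\<infinity>x. ?r x)"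
        by (intro infsum_add summable_on_add s1 s2 s3)
      also have "\<dots> = (\<Sum>\<^sub>\<infinity>x. log_prim p (u x)) + (\<Sum>\<^sub>\<infinity>x. log_term p (u x) * \<phi> x) + (\<Sum>\<^sub>\<infinity>x. ?r x)"
        by (simp only: infsum_add[OF s1 s2])
      finally show ?thesis .
    qed
    have "\<bar>\<Sum>\<^sub>\<infinity>x. ?r x\<bar> \<le> (\<Sum>\<^sub>\<infinity>x. C * (\<phi> x)\<^sup>2)"
      by (rule abs_infsum_le[OF summable_on_cmult_right[OF s\<phi>]]) (use r in auto)
    also have "\<dots> = C * l2_inner \<phi> \<phi>" by (simp add: infsum_cmult_right' l2_inner_self)
    also have "\<dots> \<le> C * ?A" using l2A C(1) by (rule mult_left_mono)
    finally have R: "\<bar>\<Sum>\<^sub>\<infinity>x. ?r x\<bar> \<le> C * ?A" .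
    have du: "dirichlet (\<lambda>x. u x + \<phi> x) (\<lambda>x. u x + \<phi> x) = ?D + 2 * ?d + ?e"
      using l2[OF u] l2[OF \<phi>] by (intro form_add_self) auto
    have Au: "form a w (\<lambda>x. u x + \<phi> x) (\<lambda>x. u x + \<phi> x) = form a w u u + 2 * form a w u \<phi> + ?A"
      using w0 u \<phi> by (rule form_add_self)
    have dd: "\<bar>?d\<bar> \<le> sqrt ?D * sqrt ?e" using l2[OF u] l2[OF \<phi>] by (intro form_Cauchy_Schwarz) auto
    have d2: "?d\<^sup>2 \<le> ?D * ?e"
    proof -
      have "\<bar>?d\<bar>\<^sup>2 \<le> (sqrt ?D * sqrt ?e)\<^sup>2" using dd by (intro power_mono) auto
      then show ?thesis using D0 e0 by (simp add: power_mult_distrib)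
    qed
    have d1: "\<bar>?d\<bar> \<le> (?D + ?e) / 2"
      using dd arith_geo_mean_sqrt[OF D0 e0] by (simp add: real_sqrt_mult)
    let ?Q = "(?D + 2 * ?d + ?e)\<^sup>2 - ?D\<^sup>2 - 4 * ?D * ?d"
    have "\<bar>?Q\<bar> \<le> 8 * ?D * ?e + 3 * ?e\<^sup>2"
      by (rule square_expansion_bound[OF D0 e0 d2 d1])
    also have "\<dots> \<le> 8 * ?D * (?A / a) + 3 * (?A / a\<^sup>2)"
    proof -
      have "?e\<^sup>2 \<le> (?A / a)\<^sup>2" using ea e0 by (rule power_mono)
      also have "\<dots> = ?A * ?A / a\<^sup>2" by (simp add: power2_eq_square)
      also have "\<dots> \<le> ?A / a\<^sup>2" using small A0 mult_left_mono[OF small A0] by (intro divide_right_mono) auto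
      finally have "?e\<^sup>2 \<le> ?A / a\<^sup>2" .
      then show ?thesis using mult_left_mono[OF ea, of "8 * ?D"] D0 by simp
    qed
    also have "\<dots> = (8 * ?D / a + 3 / a\<^sup>2) * ?A" by (simp add: algebra_simps)
    finally have Q: "\<bar>?Q\<bar> \<le> (8 * ?D / a + 3 / a\<^sup>2) * ?A" .
    have eq: "energy a b p w (\<lambda>x. u x + \<phi> x) - energy a b p w u - energy_deriv a b p w u \<phi>
        = 1/2 * ?A + b/4 * ?Q + (\<Sum>\<^sub>\<infinity>x. ?r x)"
      unfolding energy_def energy_deriv_def split du Au by (simp add: field_simps)
    have "\<bar>b/4 * ?Q\<bar> \<le> b/4 * ((8 * ?D / a + 3 / a\<^sup>2) * ?A)"
      using mult_left_mono[OF Q, of "b/4"] b by (simp only: abs_mult) simp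
    then have "\<bar>1/2 * ?A + b/4 * ?Q + (\<Sum>\<^sub>\<infinity>x. ?r x)\<bar> \<le> 1/2 * ?A + b/4 * ((8 * ?D / a + 3 / a\<^sup>2) * ?A) + C * ?A"
      using R A0 by (simp only: abs_le_iff) linarith
    then show "\<bar>energy a b p w (\<lambda>x. u x + \<phi> x) - energy a b p w u - energy_deriv a b p w u \<phi>\<bar> \<le> ?K * ?A"
      unfolding eq by (simp only: distrib_right mult.assoc)
  qed
qed

lemma energy_deriv_add:
  assumes p: "p > 3" and w: "\<And>x. w x \<ge> 0" and u: "u \<in> wl2 w" and v: "v1 \<in> wl2 w" "v2 \<in> wl2 w"
  shows "energy_deriv a b p w u (\<lambda>x. v1 x + v2 x) = energy_deriv a b p w u v1 + energy_deriv a b p w u v2"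
proof -
  have l2: "v \<in> wl2 (\<lambda>_. 1)" if "v \<in> wl2 w" for v using that wl2_subset by blast
  have "(\<Sum>\<^sub>\<infinity>x. log_term p (u x) * (v1 x + v2 x))
     = (\<Sum>\<^sub>\<infinity>x. log_term p (u x) * v1 x) + (\<Sum>\<^sub>\<infinity>x. log_term p (u x) * v2 x)"
    using l2_mult_summable[OF log_term_l2[OF p l2[OF u]] l2[OF v(1)]]
      l2_mult_summable[OF log_term_l2[OF p l2[OF u]] l2[OF v(2)]]
    by (simp add: infsum_add[symmetric] distrib_left)
  moreover have "dirichlet u (\<lambda>x. v1 x + v2 x) = dirichlet u v1 + dirichlet u v2"
    using l2 u v by (intro form_add_right) auto
  ultimately show ?thesis
    using form_add_right[OF w u v, of a] by (simp add: energy_deriv_def algebra_simps)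
qed

lemma energy_deriv_scale:
  "energy_deriv a b p w u (\<lambda>x. k * v x) = k * energy_deriv a b p w u v"
proof -
  have "(\<Sum>\<^sub>\<infinity>x. log_term p (u x) * (k * v x)) = k * (\<Sum>\<^sub>\<infinity>x. log_term p (u x) * v x)"
    by (simp add: infsum_cmult_right'[symmetric] mult_ac)
  then show ?thesis by (simp add: energy_deriv_def form_scale_right algebra_simps)
qed

lemma energy_deriv_bounded:
  assumes a: "a > 0" and b: "b > 0" and p: "p > 3" and w: "\<And>x. w x \<ge> 1" and u: "u \<in> wl2 w"
  obtains K where "\<And>\<phi>. \<phi> \<in> wl2 w \<Longrightarrow> \<bar>energy_deriv a b p w u \<phi>\<bar> \<le> K * sqrt (form a w \<phi> \<phi>)"
proof -
  have w0: "w x \<ge> 0" for x using w[of x] by simp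
  have l2: "v \<in> wl2 (\<lambda>_. 1)" if "v \<in> wl2 w" for v using that wl2_subset by blast
  let ?g = "\<lambda>x. log_term p (u x)" and ?D = "dirichlet u u"
  have g: "?g \<in> wl2 (\<lambda>_. 1)" by (rule log_term_l2[OF p l2[OF u]])
  \<comment> \<open>One Cauchy-Schwarz constant per term of the derivative;
    \<open>sqrt (1 / a)\<close> converts the Dirichlet norm of \<phi> into its
    \<open>form a w\<close> norm.\<close>
  let ?K = "sqrt (form a w u u) + b * ?D * (sqrt ?D * sqrt (1 / a)) + sqrt (l2_inner ?g ?g)"
  have D0: "?D \<ge> 0" by (rule form_nonneg) auto
  have "\<bar>energy_deriv a b p w u \<phi>\<bar> \<le> ?K * sqrt (form a w \<phi> \<phi>)" if \<phi>: "\<phi> \<in> wl2 w" for \<phi>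
  proof -
    let ?A = "form a w \<phi> \<phi>" and ?e = "dirichlet \<phi> \<phi>"
    have e0: "?e \<ge> 0" by (rule form_nonneg) auto
    have l20: "l2_inner \<phi> \<phi> \<ge> 0" by (rule form_nonneg) auto
    have sum: "l2_inner \<phi> \<phi> + a * ?e \<le> ?A" using wl2_ge_1[OF w \<phi>, of a] by simp
    have l2A: "l2_inner \<phi> \<phi> \<le> ?A" using sum mult_nonneg_nonneg[of a ?e] a e0 by linarith
    have ea: "?e \<le> 1 / a * ?A" using sum l20 a by (simp add: field_simps)
    have 1: "\<bar>form a w u \<phi>\<bar> \<le> sqrt (form a w u u) * sqrt ?A"
      using a w0 u \<phi> by (intro form_Cauchy_Schwarz) auto
    have "\<bar>dirichlet u \<phi>\<bar> \<le> sqrt ?D * sqrt ?e"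
      using l2[OF u] l2[OF \<phi>] by (intro form_Cauchy_Schwarz) auto
    also have "\<dots> \<le> sqrt ?D * (sqrt (1 / a) * sqrt ?A)"
      using real_sqrt_le_mono[OF ea] D0 unfolding real_sqrt_mult by (intro mult_left_mono) auto
    finally have "b * ?D * \<bar>dirichlet u \<phi>\<bar> \<le> b * ?D * (sqrt ?D * (sqrt (1 / a) * sqrt ?A))"
      using b D0 by (intro mult_left_mono) auto
    then have 2: "\<bar>b * ?D * dirichlet u \<phi>\<bar> \<le> b * ?D * (sqrt ?D * sqrt (1 / a)) * sqrt ?A"
      using b D0 by (simp add: abs_mult mult.assoc)
    have "\<bar>l2_inner ?g \<phi>\<bar> \<le> sqrt (l2_inner ?g ?g) * sqrt (l2_inner \<phi> \<phi>)"
      using g l2[OF \<phi>] by (intro form_Cauchy_Schwarz) auto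
    also have "\<dots> \<le> sqrt (l2_inner ?g ?g) * sqrt ?A"
      using real_sqrt_le_mono[OF l2A] by (intro mult_left_mono) (auto intro: form_nonneg)
    finally have 3: "\<bar>\<Sum>\<^sub>\<infinity>x. ?g x * \<phi> x\<bar> \<le> sqrt (l2_inner ?g ?g) * sqrt ?A" by (simp add: form_def)
    have "\<bar>energy_deriv a b p w u \<phi>\<bar> \<le> \<bar>form a w u \<phi>\<bar> + \<bar>b * ?D * dirichlet u \<phi>\<bar> + \<bar>\<Sum>\<^sub>\<infinity>x. ?g x * \<phi> x\<bar>"
      unfolding energy_deriv_def by linarith
    also have "\<dots> \<le> ?K * sqrt ?A" using add_mono[OF add_mono[OF 1 2] 3] by (simp only: distrib_right)
    finally show ?thesis .
  qed
  then show ?thesis using that by blast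
qed

text \<open>Stated for a set \<open>V\<close> closed under addition, so that it covers
  \<open>Hlam\<close> and also \<open>H01\<close> with weight 1. \<open>N\<close> and
  \<open>J\<close> are compared with \<open>form\<close> and \<open>energy\<close> only on
  \<open>V\<close>: the norm and functional of the limit problem agree with them only for functions
  vanishing off \<Omega>.\<close>

lemma has_frechet_energy:
  assumes a: "a > 0" and b: "b > 0" and p: "p > 3" and w: "\<And>x. w x \<ge> 1"
    and V: "V \<subseteq> wl2 w" "\<And>u v. u \<in> V \<Longrightarrow> v \<in> V \<Longrightarrow> (\<lambda>x. u x + v x) \<in> V"
    and N: "\<And>v. v \<in> V \<Longrightarrow> N v = sqrt (form a w v v)"
    and J: "\<And>v. v \<in> V \<Longrightarrow> J v = energy a b p w v"
    and u: "u \<in> V"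
  shows "has_frechet_on V N J u (energy_deriv a b p w u)"
  unfolding has_frechet_on_def
proof (intro conjI ballI allI impI)
  have w0: "w x \<ge> 0" for x using w[of x] by simp
  have u': "u \<in> wl2 w" using u V(1) by blast
  show "energy_deriv a b p w u (\<lambda>x. \<phi> x + \<psi> x) = energy_deriv a b p w u \<phi> + energy_deriv a b p w u \<psi>"
    if "\<phi> \<in> V" "\<psi> \<in> V" for \<phi> \<psi> using that V(1) by (intro energy_deriv_add[OF p w0 u']) auto
  show "energy_deriv a b p w u (\<lambda>x. c * \<phi> x) = c * energy_deriv a b p w u \<phi>" for c \<phi>
    by (rule energy_deriv_scale)
  show "\<exists>K. \<forall>\<phi>\<in>V. \<bar>energy_deriv a b p w u \<phi>\<bar> \<le> K * N \<phi>"
  proof -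
    obtain K where "\<And>\<phi>. \<phi> \<in> wl2 w \<Longrightarrow> \<bar>energy_deriv a b p w u \<phi>\<bar> \<le> K * sqrt (form a w \<phi> \<phi>)"
      using energy_deriv_bounded[OF a b p w u'] by blast
    then show ?thesis using N V(1) by (intro exI[of _ K]) auto
  qed
  fix e :: real assume e: "e > 0"
  obtain K where K: "K \<ge> 0" "\<And>\<phi>. \<phi> \<in> wl2 w \<Longrightarrow> form a w \<phi> \<phi> \<le> 1 \<Longrightarrow>
    \<bar>energy a b p w (\<lambda>x. u x + \<phi> x) - energy a b p w u - energy_deriv a b p w u \<phi>\<bar> \<le> K * form a w \<phi> \<phi>"
    using energy_remainder[OF a b p w u'] by blast
  show "\<exists>d>0. \<forall>\<phi>\<in>V. N \<phi> < d \<longrightarrow> \<bar>J (\<lambda>x. u x + \<phi> x) - J u - energy_deriv a b p w u \<phi>\<bar> \<le> e * N \<phi>"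
  proof (intro exI[of _ "min 1 (e / (K + 1))"] conjI ballI impI)
    show "0 < min 1 (e / (K + 1))" using e K(1) by simp
    fix \<phi> assume \<phi>: "\<phi> \<in> V" and small: "N \<phi> < min 1 (e / (K + 1))"
    have A0: "form a w \<phi> \<phi> \<ge> 0" using a w0 by (intro form_nonneg) auto
    have N0: "N \<phi> \<ge> 0" and sq: "form a w \<phi> \<phi> = N \<phi> * N \<phi>" using N[OF \<phi>] A0 by simp_all
    have "form a w \<phi> \<phi> \<le> 1" using small N[OF \<phi>] by simp
    then have "\<bar>J (\<lambda>x. u x + \<phi> x) - J u - energy_deriv a b p w u \<phi>\<bar> \<le> K * form a w \<phi> \<phi>"
      using K(2)[of \<phi>] J[OF V(2)[OF u \<phi>]] J[OF u] \<phi> V(1) by auto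
    also have "\<dots> = (K * N \<phi>) * N \<phi>" by (simp add: sq)
    also have "\<dots> \<le> e * N \<phi>"
    proof (rule mult_right_mono[OF _ N0])
      have "K * N \<phi> \<le> (K + 1) * N \<phi>" using N0 by (simp add: mult_right_mono)
      also have "\<dots> \<le> e" using small K(1) by (simp add: field_simps)
      finally show "K * N \<phi> \<le> e" .
    qed
    finally show "\<bar>J (\<lambda>x. u x + \<phi> x) - J u - energy_deriv a b p w u \<phi>\<bar> \<le> e * N \<phi>" .
  qed
qed

lemma frechet_energy:
  assumes a: "a > 0" and b: "b > 0" and p: "p > 3" and w: "\<And>x. w x \<ge> 1"
    and V: "V \<subseteq> wl2 w" "\<And>u v. u \<in> V \<Longrightarrow> v \<in> V \<Longrightarrow> (\<lambda>x. u x + v x) \<in> V"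
      "\<And>c v. v \<in> V \<Longrightarrow> (\<lambda>x. c * v x) \<in> V"
    and N: "\<And>v. v \<in> V \<Longrightarrow> N v = sqrt (form a w v v)"
    and J: "\<And>v. v \<in> V \<Longrightarrow> J v = energy a b p w v"
    and u: "u \<in> V" and \<phi>: "\<phi> \<in> V"
  shows "frechet_on V N J u \<phi> = energy_deriv a b p w u \<phi>"
proof (rule frechet_on_eqI[OF has_frechet_energy[OF a b p w V(1,2) N J u] \<phi> V(3)])
  have w0: "w x \<ge> 0" for x using w[of x] by simp
  fix c \<psi> assume \<psi>: "\<psi> \<in> V"
  have "form a w (\<lambda>x. c * \<psi> x) (\<lambda>x. c * \<psi> x) = c\<^sup>2 * form a w \<psi> \<psi>"
    using form_commute[of a w "\<lambda>x. c * \<psi> x" \<psi>] by (simp add: form_scale_right power2_eq_square)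
  then show "N (\<lambda>x. c * \<psi> x) = \<bar>c\<bar> * N \<psi>" using N[OF \<psi>] N[OF V(3)[OF \<psi>]] by (simp add: real_sqrt_mult)
  show "N \<psi> \<ge> 0" using N[OF \<psi>] a w0 by (simp add: form_nonneg)
qed auto

subsection \<open>The function spaces and functionals in explicit form\<close>

lemma const_form_le_l2:
  assumes "c \<ge> 0" "u \<in> wl2 (\<lambda>_. 1)"
  shows "form c (\<lambda>_. d) u u \<le> (2 * c * card unit_steps + d) * l2_inner u u"
proof -
  have "form 0 (\<lambda>_. d) u u = d * l2_inner u u"
    by (simp add: form_def mult.assoc infsum_cmult_right')
  moreover have "form c (\<lambda>_. d) u u = c * dirichlet u u + form 0 (\<lambda>_. d) u u"
  proof -
    have "(\<Sum>\<^sub>\<infinity>x. c * grad_sq u x + d * u x * u x) = (\<Sum>\<^sub>\<infinity>x. c * grad_sq u x) + (\<Sum>\<^sub>\<infinity>x. d * (u x * u x))"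
      using assms by (simp add: mult.assoc) (intro infsum_add summable_on_cmult_right grad_prod_summable l2_mult_summable)
    then show ?thesis by (simp add: form_def infsum_cmult_right' mult.assoc)
  qed
  ultimately show ?thesis
    using mult_left_mono[OF dirichlet_le_l2[OF assms(2)] assms(1)] by (simp add: algebra_simps)
qed

lemma H1_norm_form: "H1_norm u = sqrt (form 1 (\<lambda>_. 1) u u)"
  by (simp add: H1_norm_def form_def power2_eq_square)

lemma l2_le_H1_norm:
  assumes "u \<in> wl2 (\<lambda>_. 1)"
  shows "l2_inner u u \<le> (H1_norm u)\<^sup>2"
proof -
  have "dirichlet u u \<ge> 0" "form 1 (\<lambda>_. 1) u u \<ge> 0" by (intro form_nonneg; simp)+
  then show ?thesis using wl2_ge_1[OF _ assms, of 1] by (simp add: H1_norm_form)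
qed

lemma H1_norm_le_l2:
  assumes "u \<in> wl2 (\<lambda>_. 1)"
  shows "H1_norm u \<le> sqrt ((2 * real (card unit_steps) + 1) * l2_inner u u)"
  using const_form_le_l2[OF _ assms, of 1 1] by (simp add: H1_norm_form add.commute)

lemma fin_supp_on_wl2: "\<phi> \<in> fin_supp_on A \<Longrightarrow> \<phi> \<in> wl2 w"
  unfolding fin_supp_on_def by (rule wl2_finite_support[of "{x. \<phi> x \<noteq> 0}"]) auto

lemma l2_inner_add_le:
  assumes "u \<in> wl2 (\<lambda>_. 1)" "v \<in> wl2 (\<lambda>_. 1)"
  shows "l2_inner (\<lambda>x. u x + v x) (\<lambda>x. u x + v x) \<le> 2 * (l2_inner u u + l2_inner v v)"
proof -
  have l0: "form 0 (\<lambda>_. 1) (\<lambda>x. u x - v x) (\<lambda>x. u x - v x) \<ge> 0"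
    by (rule form_nonneg) auto
  have "form 0 (\<lambda>_. 1) (\<lambda>x. u x + (-1) * v x) (\<lambda>x. u x + (-1) * v x)
      = l2_inner u u - 2 * l2_inner u v + l2_inner v v"
    using form_add_self[OF _ assms(1) wl2_scale[OF assms(2), of "-1"], of 0]
      form_uminus[of 0 "\<lambda>_. 1" v v] form_scale_right[of 0 "\<lambda>_. 1" u "-1" v] by simp
  moreover have "l2_inner (\<lambda>x. u x + v x) (\<lambda>x. u x + v x) = l2_inner u u + 2 * l2_inner u v + l2_inner v v"
    using assms by (intro form_add_self) auto
  ultimately show ?thesis using l0 by simp
qed

text \<open>The gradient is bounded on l^2, so the completion is l^2. For one inclusion, finite
  partial sums of squares pass to the pointwise limit and stay below a bound for the Cauchy
  sequence; for the other, u is approximated by its restrictions to finite sets with small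
  tails.\<close>

lemma H1_eq_l2: "H1 = wl2 (\<lambda>_. 1)"
proof (intro equalityI subsetI)
  fix u assume "u \<in> H1"
  then obtain \<phi> where \<phi>: "\<And>n. \<phi> n \<in> fin_supp_on UNIV"
      "\<And>e. e > 0 \<Longrightarrow> \<exists>n0. \<forall>m\<ge>n0. \<forall>n\<ge>n0. H1_norm (\<lambda>x. \<phi> m x - \<phi> n x) < e"
      "\<And>x. (\<lambda>n. \<phi> n x) \<longlonglongrightarrow> u x"
    unfolding H1_def completion_of_fin_supp_def by blast
  have l2: "\<phi> n \<in> wl2 (\<lambda>_. 1)" for n using \<phi>(1) by (rule fin_supp_on_wl2)
  obtain n0 where n0: "\<And>m n. m \<ge> n0 \<Longrightarrow> n \<ge> n0 \<Longrightarrow> H1_norm (\<lambda>x. \<phi> m x - \<phi> n x) < 1"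
    using \<phi>(2)[of 1] by auto
  let ?B = "2 * (1 + l2_inner (\<phi> n0) (\<phi> n0))"
  have bound: "l2_inner (\<phi> n) (\<phi> n) \<le> ?B" if "n \<ge> n0" for n
  proof -
    let ?d = "\<lambda>x. \<phi> n x - \<phi> n0 x"
    have d: "?d \<in> wl2 (\<lambda>_. 1)" using l2 by (intro wl2_diff) auto
    have "(H1_norm ?d)\<^sup>2 \<le> 1"
      using n0[OF that order_refl] by (intro power_le_one) (auto simp: H1_norm_form intro: form_nonneg)
    then have "l2_inner ?d ?d \<le> 1" using l2_le_H1_norm[OF d] by simp
    then show ?thesis using l2_inner_add_le[OF d l2[of n0]] by simp
  qed
  have "(\<lambda>x. (u x)\<^sup>2) summable_on UNIV"
  proof (rule nonneg_bdd_above_summable_on)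
    show "bdd_above (sum (\<lambda>x. (u x)\<^sup>2) ` {F. F \<subseteq> UNIV \<and> finite F})"
    proof (rule bdd_aboveI2)
      fix F :: "(int ^ 3) set" assume "F \<in> {F. F \<subseteq> UNIV \<and> finite F}"
      then have F: "finite F" by simp
      show "(\<Sum>x\<in>F. (u x)\<^sup>2) \<le> ?B"
      proof (rule LIMSEQ_le_const2)
        show "(\<lambda>n. \<Sum>x\<in>F. (\<phi> n x)\<^sup>2) \<longlonglongrightarrow> (\<Sum>x\<in>F. (u x)\<^sup>2)"
          by (intro tendsto_sum tendsto_power \<phi>(3))
        have "(\<Sum>x\<in>F. (\<phi> n x)\<^sup>2) \<le> l2_inner (\<phi> n) (\<phi> n)" for n
          unfolding l2_inner_self using l2[of n] F by (intro finite_sum_le_infsum) (auto simp: wl2_def)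
        then show "\<exists>N. \<forall>n\<ge>N. (\<Sum>x\<in>F. (\<phi> n x)\<^sup>2) \<le> ?B"
          using bound order_trans by blast
      qed
    qed
  qed auto
  then show "u \<in> wl2 (\<lambda>_. 1)" by (simp add: wl2_def)
next
  fix u :: "int ^ 3 \<Rightarrow> real" assume u: "u \<in> wl2 (\<lambda>_. 1)"
  let ?f = "\<lambda>x. (u x)\<^sup>2"
  have s: "?f summable_on UNIV" using u by (simp add: wl2_def)
  have "\<exists>F. finite F \<and> dist (sum ?f F) (infsum ?f UNIV) \<le> inverse (real (Suc n))" for n
    using infsum_finite_approximation[OF s, of "inverse (real (Suc n))"] by auto
  then obtain F where F: "\<And>n. finite (F n)" "\<And>n. dist (sum ?f (F n)) (infsum ?f UNIV) \<le> inverse (real (Suc n))"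
    by metis
  define \<phi> where "\<phi> n x = (if x \<in> F n then u x else 0)" for n x
  let ?d = "\<lambda>n x. u x - \<phi> n x"
  have \<phi>l2: "\<phi> n \<in> wl2 (\<lambda>_. 1)" for n
    using F(1)[of n] by (intro wl2_finite_support[of "F n"]) (auto simp: \<phi>_def)
  have dl2: "?d n \<in> wl2 (\<lambda>_. 1)" for n using u \<phi>l2 by (intro wl2_diff) auto
  have small: "l2_inner (?d n) (?d n) \<le> inverse (real (Suc n))" for n
  proof -
    have sm: "?f summable_on A" for A using summable_on_subset_banach[OF s] by blast
    have "l2_inner (?d n) (?d n) = infsum ?f (- F n)"
      unfolding l2_inner_self by (rule infsum_cong_neutral) (auto simp: \<phi>_def)
    moreover have "infsum ?f UNIV = sum ?f (F n) + infsum ?f (- F n)"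
      using infsum_Un_disjoint[OF sm sm, of "F n" "- F n"] F(1)[of n] by simp
    ultimately show ?thesis using F(2)[of n] by (simp add: dist_real_def)
  qed
  have lim0: "(\<lambda>n. inverse (real (Suc n))) \<longlonglongrightarrow> 0" by (rule LIMSEQ_inverse_real_of_nat)
  show "u \<in> H1"
    unfolding H1_def completion_of_fin_supp_def mem_Collect_eq
  proof (intro exI[of _ \<phi>] conjI allI impI)
    show "\<phi> n \<in> fin_supp_on UNIV" for n
      unfolding fin_supp_on_def by (auto simp: \<phi>_def intro: finite_subset[OF _ F(1)[of n]])
    show "(\<lambda>n. \<phi> n x) \<longlonglongrightarrow> u x" for x
    proof -
      have "(\<lambda>n. ?d n x) \<longlonglongrightarrow> 0"
      proof (rule Lim_null_comparison)
        show "(\<lambda>n. sqrt (inverse (real (Suc n)))) \<longlonglongrightarrow> 0"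
          using tendsto_real_sqrt[OF lim0] by simp
        have "\<bar>?d n x\<bar> \<le> sqrt (inverse (real (Suc n)))" for n
          using abs_le_l2[OF dl2[of n], of x] real_sqrt_le_mono[OF small[of n]] by (rule order_trans)
        then show "\<forall>\<^sub>F n in sequentially. norm (?d n x) \<le> sqrt (inverse (real (Suc n)))" by simp
      qed
      from tendsto_diff[OF tendsto_const[of "u x"] this] show ?thesis by simp
    qed
    fix e :: real assume e: "e > 0"
    define C where "C = 2 * real (card unit_steps) + 1"
    have C: "C > 0" by (simp add: C_def)
    \<comment> \<open>Two restrictions of u differ by the difference of two tails, whose squared
      norm is at most twice the sum of theirs, hence less than e^2 / C; C is the norm equivalence
      constant of \<open>H1_norm_le_l2\<close>.\<close>
    have "\<forall>\<^sub>F n in sequentially. inverse (real (Suc n)) < e\<^sup>2 / (4 * C)"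
      using order_tendstoD(2)[OF lim0, of "e\<^sup>2 / (4 * C)"] e C by simp
    then obtain n0 where n0: "\<And>n. n \<ge> n0 \<Longrightarrow> inverse (real (Suc n)) < e\<^sup>2 / (4 * C)"
      by (auto simp: eventually_sequentially)
    have "H1_norm (\<lambda>x. \<phi> m x - \<phi> n x) < e" if mn: "m \<ge> n0" "n \<ge> n0" for m n
    proof -
      let ?w = "\<lambda>x. \<phi> m x - \<phi> n x"
      have "l2_inner ?w ?w \<le> 2 * (l2_inner (?d n) (?d n) + l2_inner (?d m) (?d m))"
        using l2_inner_add_le[OF dl2[of n] wl2_scale[OF dl2[of m], of "-1"]] form_uminus[of 0 "\<lambda>_. 1" "?d m" "?d m"]
        by simp
      also have "\<dots> < e\<^sup>2 / C" using small[of n] small[of m] n0[OF mn(1)] n0[OF mn(2)] by simp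
      finally have "C * l2_inner ?w ?w < e\<^sup>2" using C by (simp add: field_simps)
      moreover have "H1_norm ?w \<le> sqrt (C * l2_inner ?w ?w)"
        unfolding C_def by (rule H1_norm_le_l2, rule wl2_diff) (use \<phi>l2 in auto)
      ultimately show ?thesis using e real_sqrt_less_mono[of "C * l2_inner ?w ?w" "e\<^sup>2"] by simp
    qed
    then show "\<exists>n0. \<forall>m\<ge>n0. \<forall>n\<ge>n0. H1_norm (\<lambda>x. \<phi> m x - \<phi> n x) < e" by blast
  qed
qed

lemma Hlam_eq: "Hlam h l = wl2 (\<lambda>x. l * h x + 1)"
proof -
  have "(\<lambda>x. (l * h x + 1) * (u x)\<^sup>2) summable_on UNIV \<longleftrightarrow> (\<lambda>x. l * h x * (u x)\<^sup>2) summable_on UNIV"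
    if s: "(\<lambda>x. (u x)\<^sup>2) summable_on UNIV" for u :: "int ^ 3 \<Rightarrow> real"
  proof
    assume "(\<lambda>x. (l * h x + 1) * (u x)\<^sup>2) summable_on UNIV"
    from summable_on_add[OF this summable_on_uminus[THEN iffD2, OF s]]
    show "(\<lambda>x. l * h x * (u x)\<^sup>2) summable_on UNIV" by (simp add: algebra_simps)
  next
    assume "(\<lambda>x. l * h x * (u x)\<^sup>2) summable_on UNIV"
    from summable_on_add[OF this s]
    show "(\<lambda>x. (l * h x + 1) * (u x)\<^sup>2) summable_on UNIV" by (simp add: algebra_simps)
  qed
  then show ?thesis unfolding Hlam_def H1_eq_l2 wl2_def by auto
qed

lemma Hlam_norm_form: "Hlam_norm a h l u = sqrt (form a (\<lambda>x. l * h x + 1) u u)"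
  by (simp add: Hlam_norm_def form_def power2_eq_square mult.assoc)

lemma infsum_log_prim:
  assumes p: "p > 3" and u: "u \<in> wl2 (\<lambda>_. 1)"
  shows "(\<Sum>\<^sub>\<infinity>x :: int ^ 3. log_prim p (u x))
    = 2 / p\<^sup>2 * (\<Sum>\<^sub>\<infinity>x. \<bar>u x\<bar> powr p) - 1 / p * (\<Sum>\<^sub>\<infinity>x. \<bar>u x\<bar> powr p * ln ((u x)\<^sup>2))"
proof -
  have s1: "(\<lambda>x. 2 / p\<^sup>2 * \<bar>u x\<bar> powr p) summable_on UNIV"
    using p u by (intro summable_on_cmult_right abs_powr_summable) auto
  \<comment> \<open>The logarithmic summand enters as a difference of two summable families, which
    supplies its summability.\<close>
  have s2: "(\<lambda>x. 2 / p\<^sup>2 * \<bar>u x\<bar> powr p - log_prim p (u x)) summable_on UNIV"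
    using summable_on_add[OF s1 summable_on_uminus[THEN iffD2, OF log_prim_summable[OF p u]]] by simp
  have "(\<Sum>\<^sub>\<infinity>x. 2 / p\<^sup>2 * \<bar>u x\<bar> powr p)
      = (\<Sum>\<^sub>\<infinity>x. (2 / p\<^sup>2 * \<bar>u x\<bar> powr p - log_prim p (u x)) + log_prim p (u x))" by simp
  also have "\<dots> = (\<Sum>\<^sub>\<infinity>x. 2 / p\<^sup>2 * \<bar>u x\<bar> powr p - log_prim p (u x)) + (\<Sum>\<^sub>\<infinity>x. log_prim p (u x))"
    by (rule infsum_add[OF s2 log_prim_summable[OF p u]])
  also have "(\<Sum>\<^sub>\<infinity>x. 2 / p\<^sup>2 * \<bar>u x\<bar> powr p - log_prim p (u x)) = (\<Sum>\<^sub>\<infinity>x. 1 / p * (\<bar>u x\<bar> powr p * ln ((u x)\<^sup>2)))"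
    by (simp add: log_prim_def)
  finally show ?thesis by (simp only: infsum_cmult_right')
qed

lemma J_lam_energy:
  assumes "a \<ge> 0" "p > 3" "\<And>x. l * h x \<ge> 0" "u \<in> wl2 (\<lambda>_. 1)"
  shows "J_lam a b p h l u = energy a b p (\<lambda>x. l * h x + 1) u"
proof -
  have "form a (\<lambda>x. l * h x + 1) u u \<ge> 0" using assms by (intro form_nonneg) (auto intro: add_nonneg_nonneg)
  then show ?thesis
    by (simp add: J_lam_def energy_def Hlam_norm_form infsum_log_prim[OF assms(2,4)] dirichlet_self)
qed

section \<open>The limit problem, expressed on the whole lattice\<close>

lemma H01_eq:
  assumes "finite \<Omega>"
  shows "H01 a \<Omega> = {u. \<forall>x. x \<notin> \<Omega> \<longrightarrow> u x = 0}"
proof (intro equalityI subsetI)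
  fix u assume "u \<in> H01 a \<Omega>"
  then obtain \<phi> where \<phi>: "\<And>n::nat. \<phi> n \<in> fin_supp_on \<Omega>" "\<And>x. (\<lambda>n. \<phi> n x) \<longlonglongrightarrow> u x"
    unfolding H01_def completion_of_fin_supp_def by blast
  have "u x = 0" if "x \<notin> \<Omega>" for x
  proof -
    have "\<phi> n x = 0" for n using \<phi>(1)[of n] that by (auto simp: fin_supp_on_def)
    then show ?thesis using \<phi>(2)[of x] by (simp add: LIMSEQ_const_iff)
  qed
  then show "u \<in> {u. \<forall>x. x \<notin> \<Omega> \<longrightarrow> u x = 0}" by simp
next
  fix u :: "int ^ 3 \<Rightarrow> real" assume u: "u \<in> {u. \<forall>x. x \<notin> \<Omega> \<longrightarrow> u x = 0}"
  \<comment> \<open>Such a function is itself admissible, so a constant sequence represents it and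
    the completion adds nothing.\<close>
  have "finite {x. u x \<noteq> 0}" by (rule finite_subset[OF _ assms]) (use u in auto)
  then show "u \<in> H01 a \<Omega>"
    using u unfolding H01_def completion_of_fin_supp_def
    by (auto simp: fin_supp_on_def H01_norm_def grad_prod_def intro!: exI[of _ "\<lambda>_. u"])
qed

text \<open>Only one argument has to be supported in \<Omega>. Therefore the equation of
  \<open>u k\<close>, which lives on the whole lattice, also loses its weight when tested with
  functions supported in \<Omega>.\<close>

lemma form_support_cong:
  assumes "\<And>x. x \<notin> \<Omega> \<Longrightarrow> \<phi> x = 0" "\<And>x. x \<in> \<Omega> \<Longrightarrow> w x = w' x"
  shows "form c w u \<phi> = form c w' u \<phi>"
proof -
  have "w x * u x * \<phi> x = w' x * u x * \<phi> x" for x using assms by (cases "x \<in> \<Omega>") auto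
  then show ?thesis unfolding form_def by (intro infsum_cong) (simp only:)
qed

lemma energy_support_cong:
  assumes "\<And>x. x \<notin> \<Omega> \<Longrightarrow> u x = 0" "\<And>x. x \<in> \<Omega> \<Longrightarrow> w x = w' x"
  shows "energy a b p w u = energy a b p w' u"
  using form_support_cong[OF assms] by (simp add: energy_def)

lemma energy_deriv_support_cong:
  assumes "\<And>x. x \<notin> \<Omega> \<Longrightarrow> \<phi> x = 0" "\<And>x. x \<in> \<Omega> \<Longrightarrow> w x = w' x"
  shows "energy_deriv a b p w u \<phi> = energy_deriv a b p w' u \<phi>"
  using form_support_cong[OF assms] by (simp add: energy_deriv_def)

text \<open>A point outside \<Omega> and its boundary has no neighbour in \<Omega>, so the gradient
  vanishes there.\<close>

lemma dirichlet_support: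
  assumes "\<And>x. x \<notin> \<Omega> \<Longrightarrow> u x = 0"
  shows "(\<Sum>\<^sub>\<infinity>x\<in>\<Omega> \<union> vertex_boundary \<Omega>. grad_sq u x) = dirichlet u u"
  unfolding dirichlet_self
proof (rule infsum_cong_neutral)
  fix x assume x: "x \<in> UNIV - (\<Omega> \<union> vertex_boundary \<Omega>)"
  have "u y = u x" if "x \<sim>\<^sub>Z y" for y
  proof -
    have "y \<sim>\<^sub>Z x" using that by (simp add: adj_def abs_minus_commute)
    then have "y \<notin> \<Omega>" using x by (auto simp: vertex_boundary_def)
    then show ?thesis using x assms by auto
  qed
  then show "grad_sq u x = 0" by (simp add: grad_prod_def)
qed auto

lemma H01_norm_form:
  assumes fin: "finite \<Omega>" and u: "\<And>x. x \<notin> \<Omega> \<Longrightarrow> u x = 0"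
  shows "H01_norm a \<Omega> u = sqrt (form a (\<lambda>_. 1) u u)"
proof -
  have u2: "u \<in> wl2 (\<lambda>_. 1)" by (rule wl2_finite_support[OF fin u])
  have "(\<Sum>\<^sub>\<infinity>x\<in>\<Omega>. (u x)\<^sup>2) = l2_inner u u"
    unfolding l2_inner_self by (rule infsum_cong_neutral) (use u in auto)
  moreover have "form a (\<lambda>_. 1) u u = a * dirichlet u u + l2_inner u u"
    using u2 by (intro form_split) auto
  ultimately show ?thesis using dirichlet_support[OF u] by (simp add: H01_norm_def infsum_cmult_right')
qed

lemma J_Omega_energy:
  assumes a: "a \<ge> 0" and p: "p > 3" and fin: "finite \<Omega>" and u: "\<And>x. x \<notin> \<Omega> \<Longrightarrow> u x = 0"
  shows "J_Omega a b p \<Omega> u = energy a b p (\<lambda>_. 1) u"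
proof -
  have u2: "u \<in> wl2 (\<lambda>_. 1)" by (rule wl2_finite_support[OF fin u])
  have "(\<Sum>\<^sub>\<infinity>x\<in>\<Omega>. \<bar>u x\<bar> powr p) = (\<Sum>\<^sub>\<infinity>x. \<bar>u x\<bar> powr p)"
    "(\<Sum>\<^sub>\<infinity>x\<in>\<Omega>. \<bar>u x\<bar> powr p * ln ((u x)\<^sup>2)) = (\<Sum>\<^sub>\<infinity>x. \<bar>u x\<bar> powr p * ln ((u x)\<^sup>2))"
    by (rule infsum_cong_neutral; use u in auto)+
  moreover have "form a (\<lambda>_. 1) u u \<ge> 0" using a by (intro form_nonneg) auto
  ultimately show ?thesis
    by (simp add: J_Omega_def energy_def H01_norm_form[OF fin u] dirichlet_support[OF u] infsum_log_prim[OF p u2])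
qed

section \<open>Sign parts and the energy on the Nehari set\<close>

lemma pos_neg_part_sum: "pos_part u x + neg_part u x = u x"
  by (simp add: pos_part_def neg_part_def)

lemma abs_pos_part_le: "\<bar>pos_part u x\<bar> \<le> \<bar>u x\<bar>" and abs_neg_part_le: "\<bar>neg_part u x\<bar> \<le> \<bar>u x\<bar>"
  by (auto simp: pos_part_def neg_part_def)

text \<open>\<open>frechet_on\<close> is determined only on \<open>V\<close>; closure of
  \<open>V\<close> under pointwise domination places the sign parts there.\<close>

lemma sc_nehari_energy:
  assumes a: "a > 0" and b: "b > 0" and p: "p > 3" and w: "\<And>x. w x \<ge> 1"
    and V: "V \<subseteq> wl2 w" "\<And>u v. u \<in> V \<Longrightarrow> v \<in> V \<Longrightarrow> (\<lambda>x. u x + v x) \<in> V"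
      "\<And>c v. v \<in> V \<Longrightarrow> (\<lambda>x. c * v x) \<in> V" "\<And>u v. u \<in> V \<Longrightarrow> (\<And>x. \<bar>v x\<bar> \<le> \<bar>u x\<bar>) \<Longrightarrow> v \<in> V"
    and N: "\<And>v. v \<in> V \<Longrightarrow> N v = sqrt (form a w v v)"
    and J: "\<And>v. v \<in> V \<Longrightarrow> J v = energy a b p w v"
  shows "sc_nehari V N J = {u \<in> V. pos_part u \<noteq> (\<lambda>_. 0) \<and> neg_part u \<noteq> (\<lambda>_. 0) \<and>
      energy_deriv a b p w u (pos_part u) = 0 \<and> energy_deriv a b p w u (neg_part u) = 0}"
proof -
  have eq: "frechet_on V N J u \<phi> = energy_deriv a b p w u \<phi>" if "u \<in> V" "\<phi> \<in> V" for u \<phi>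
    by (rule frechet_energy[where w=w and V=V and N=N and J=J]) (fact a b p w V N J that)+
  have pn: "pos_part u \<in> V" "neg_part u \<in> V" if "u \<in> V" for u
    by (rule V(4)[OF that], rule abs_pos_part_le, rule V(4)[OF that], rule abs_neg_part_le)
  have "frechet_on V N J u (pos_part u) = energy_deriv a b p w u (pos_part u)"
    "frechet_on V N J u (neg_part u) = energy_deriv a b p w u (neg_part u)" if "u \<in> V" for u
    by (rule eq[OF that pn(1)[OF that]], rule eq[OF that pn(2)[OF that]])
  then show ?thesis unfolding sc_nehari_def by (simp cong: conj_cong)
qed

text \<open>By \<open>log_prim_minus_log_term\<close> the multiple 1/p removes the logarithm. For p
  > 4 all three coefficients are positive, so the value controls the norm.\<close>

lemma energy_minus_deriv:
  assumes p: "p > 3" and w: "\<And>x. w x \<ge> 0" and u: "u \<in> wl2 w"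
  shows "energy a b p w u - 1 / p * energy_deriv a b p w u u
    = (1/2 - 1/p) * form a w u u + b * (1/4 - 1/p) * (dirichlet u u)\<^sup>2 + 2 / p\<^sup>2 * (\<Sum>\<^sub>\<infinity>x. \<bar>u x\<bar> powr p)"
proof -
  have u2: "u \<in> wl2 (\<lambda>_. 1)" using u wl2_subset by blast
  have s2: "(\<lambda>x. log_term p (u x) * u x) summable_on UNIV"
    by (rule l2_mult_summable[OF log_term_l2[OF p u2] u2])
  have "(\<Sum>\<^sub>\<infinity>x. log_prim p (u x)) = (\<Sum>\<^sub>\<infinity>x. 1 / p * (log_term p (u x) * u x) + 2 / p\<^sup>2 * \<bar>u x\<bar> powr p)"
    using log_prim_minus_log_term[of p] p by (intro infsum_cong) (smt (verit))
  also have "\<dots> = (\<Sum>\<^sub>\<infinity>x. 1 / p * (log_term p (u x) * u x)) + (\<Sum>\<^sub>\<infinity>x. 2 / p\<^sup>2 * \<bar>u x\<bar> powr p)"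
    using p u2 by (intro infsum_add summable_on_cmult_right s2 abs_powr_summable) auto
  finally have "(\<Sum>\<^sub>\<infinity>x. log_prim p (u x)) =
      1 / p * (\<Sum>\<^sub>\<infinity>x. log_term p (u x) * u x) + 2 / p\<^sup>2 * (\<Sum>\<^sub>\<infinity>x. \<bar>u x\<bar> powr p)"
    by (simp only: infsum_cmult_right')
  then show ?thesis
    by (simp add: energy_def energy_deriv_def power2_eq_square left_diff_distrib right_diff_distrib distrib_left)
qed

lemma nehari_energy_eq:
  assumes p: "p > 3" and w: "\<And>x. w x \<ge> 0" and u: "u \<in> wl2 w"
    and "energy_deriv a b p w u (pos_part u) = 0" "energy_deriv a b p w u (neg_part u) = 0"
  shows "energy a b p w u
    = (1/2 - 1/p) * form a w u u + b * (1/4 - 1/p) * (dirichlet u u)\<^sup>2 + 2 / p\<^sup>2 * (\<Sum>\<^sub>\<infinity>x. \<bar>u x\<bar> powr p)"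
proof -
  have "pos_part u \<in> wl2 w" "neg_part u \<in> wl2 w"
    by (rule wl2_bounded[of w u, OF w u]; rule abs_pos_part_le abs_neg_part_le)+
  from energy_deriv_add[OF p w u this] have "energy_deriv a b p w u u = 0"
    using assms(4,5) by (simp add: pos_neg_part_sum)
  then show ?thesis using energy_minus_deriv[OF p w u, of a b] by simp
qed

text \<open>The nonlinearity has the sign of \<open>-t\<close> for \<open>\<bar>t\<bar> \<le> 1\<close>, so a nonzero sign part with
  vanishing derivative must exceed 1 somewhere.\<close>

lemma truncation_exceeds_1:
  assumes a: "a > 0" and b: "b > 0" and w: "\<And>x. w x \<ge> 1"
    and u: "u \<in> wl2 w" and v: "\<And>x. v x = 0 \<or> v x = u x" "\<And>x y. (u y - u x) * (v y - v x) \<ge> 0"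
    and D: "energy_deriv a b p w u v = 0" and nz: "v \<noteq> (\<lambda>_. 0)"
  shows "\<exists>x. \<bar>v x\<bar> > 1"
proof (rule ccontr)
  assume "\<not> (\<exists>x. \<bar>v x\<bar> > 1)"
  then have le1: "\<bar>v x\<bar> \<le> 1" for x by (simp add: not_less)
  have w0: "w x \<ge> 0" for x using w[of x] by simp
  have vl: "v \<in> wl2 w" by (rule wl2_bounded[OF w0 u]) (metis abs_ge_zero abs_zero order_refl v(1))
  \<comment> \<open>The second hypothesis on v says that v increases with u. Hence every term of the
    derivative is nonnegative, and their sum 0 forces the l^2 norm of v to vanish.\<close>
  have grad: "grad_prod u v x \<ge> 0" for x using v(2) by (auto simp: grad_prod_def intro!: sum_nonneg)
  have Duv: "dirichlet u v \<ge> 0" unfolding form_def using grad by (intro infsum_nonneg) simp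
  have "w x * u x * v x = w x * v x * v x" for x using v(1)[of x] by auto
  then have "form 0 w u v = form 0 w v v" unfolding form_def by (intro infsum_cong) (simp only: mult_zero_left)
  also have "\<dots> \<ge> l2_inner v v" using w vl by (intro form_mono) auto
  finally have "form a w u v \<ge> l2_inner v v"
    using form_split[OF w0 u vl, of a] a Duv mult_nonneg_nonneg[of a "dirichlet u v"] by linarith
  moreover have "b * dirichlet u u * dirichlet u v \<ge> 0"
    using b Duv form_nonneg[of 1 "\<lambda>_. 0" u] by simp
  moreover have "(\<Sum>\<^sub>\<infinity>x. log_term p (u x) * v x) \<ge> 0"
  proof (rule infsum_nonneg)
    fix x
    have "(v x)\<^sup>2 \<le> 1" using le1[of x] by (simp add: abs_square_le_1)
    then have ln: "v x \<noteq> 0 \<Longrightarrow> ln ((v x)\<^sup>2) \<le> 0" by simp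
    show "log_term p (u x) * v x \<ge> 0"
    proof (cases "v x = 0")
      case False
      then have "log_term p (u x) * v x = (v x)\<^sup>2 * \<bar>v x\<bar> powr (p - 2) * (- ln ((v x)\<^sup>2))"
        using v(1)[of x] by (simp add: log_term_def power2_eq_square)
      also have "\<dots> \<ge> 0" using ln False by (intro mult_nonneg_nonneg) auto
      finally show ?thesis .
    qed simp
  qed
  ultimately have "l2_inner v v \<le> 0" using D by (simp add: energy_deriv_def)
  then have "sqrt (l2_inner v v) \<le> 0" by simp
  moreover have "\<bar>v x\<bar> \<le> sqrt (l2_inner v v)" for x
    using vl wl2_subset[of w] by (intro abs_le_l2) auto
  ultimately have "\<bar>v x\<bar> \<le> 0" for x by (rule order_trans[rotated])
  then show False using nz by auto
qed

subsection \<open>Nonemptiness of the sign-changing Nehari set\<close>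

text \<open>For \<tau> \<ge> 1 the powers \<tau>, \<tau>^2 and \<tau>^4 are at most \<tau>^p, and
  \<open>?R\<close> is the point beyond which the leading term (2/p) \<tau>^p ln \<tau> exceeds
  \<open>?c\<close> times \<tau>^p. The 1 in \<open>?c\<close> leaves -\<tau>^p \<le>
  -\<tau>.\<close>

lemma quartic_plus_log_prim_bound:
  assumes p: "p > 4" and C: "C \<ge> 0" and E: "E \<ge> 0"
  obtains R1 where "R1 \<ge> 1" "\<And>\<tau>. \<tau> \<ge> R1 \<Longrightarrow> C * \<tau>\<^sup>2 + E * \<tau> ^ 4 + log_prim p \<tau> \<le> - \<tau>"
proof
  let ?c = "C + E + 2 / p\<^sup>2 + 1"
  have c: "?c \<ge> 0" using C E by simp
  let ?R = "exp (p / 2 * ?c)"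
  show "?R \<ge> 1" using p c by simp
  fix \<tau> assume \<tau>: "\<tau> \<ge> ?R"
  have "1 \<le> ?R" using p c by simp
  then have \<tau>1: "\<tau> \<ge> 1" using \<tau> by linarith
  let ?P = "\<tau> powr p"
  have pow: "\<tau> ^ n \<le> ?P" if "n \<le> 4" for n :: nat
  proof -
    have "\<tau> ^ n = \<tau> powr real n" using \<tau>1 by (simp add: powr_realpow)
    also have "\<dots> \<le> ?P" using \<tau>1 p that by (intro powr_mono) auto
    finally show ?thesis .
  qed
  have "p / 2 * ?c \<le> ln \<tau>" using \<tau> \<tau>1 ln_ge_iff[of \<tau> "p / 2 * ?c"] by linarith
  then have "?c \<le> 2 / p * ln \<tau>" using p by (simp add: field_simps)
  then have "C + E + 2 / p\<^sup>2 - 2 / p * ln \<tau> \<le> -1" by simp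
  from mult_left_mono[OF this, of ?P] have main: "?P * (C + E + 2 / p\<^sup>2 - 2 / p * ln \<tau>) \<le> - ?P" by simp
  have "ln (\<tau>\<^sup>2) = 2 * ln \<tau>" using \<tau>1 ln_realpow[of \<tau> 2] by simp
  then have G: "log_prim p \<tau> = ?P * (2 / p\<^sup>2 - 2 / p * ln \<tau>)"
    using \<tau>1 by (simp add: log_prim_def algebra_simps)
  have "C * \<tau>\<^sup>2 \<le> C * ?P" "E * \<tau> ^ 4 \<le> E * ?P"
    using pow[of 2] pow[of 4] C E by (auto intro: mult_left_mono)
  then have "C * \<tau>\<^sup>2 + E * \<tau> ^ 4 + log_prim p \<tau> \<le> ?P * (C + E + 2 / p\<^sup>2 - 2 / p * ln \<tau>)"
    unfolding G by (simp add: algebra_simps)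
  also have "\<dots> \<le> - \<tau>" using main pow[of 1] by simp
  finally show "C * \<tau>\<^sup>2 + E * \<tau> ^ 4 + log_prim p \<tau> \<le> - \<tau>" .
qed

lemma isCont_log_prim: "p > 2 \<Longrightarrow> isCont (log_prim p) t"
  using log_prim_has_derivative DERIV_isCont by blast

lemma isCont_log_term: "p > 3 \<Longrightarrow> isCont (log_term p) t"
  using log_term_has_derivative DERIV_isCont by blast

lemma log_prim_nonneg:
  assumes p: "p > 0" and t: "\<bar>t\<bar> \<le> 1"
  shows "log_prim p t \<ge> 0"
proof (cases "t = 0")
  case False
  have "t\<^sup>2 \<le> 1" using t by (simp add: abs_square_le_1)
  then have "\<bar>t\<bar> powr p * ln (t\<^sup>2) \<le> 0" using False by (simp add: mult_nonneg_nonpos)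
  then have "1 / p * (\<bar>t\<bar> powr p * ln (t\<^sup>2)) \<le> 0" using p by (simp add: mult_nonneg_nonpos divide_nonpos_pos)
  moreover have "2 / p\<^sup>2 * \<bar>t\<bar> powr p \<ge> 0" by simp
  ultimately show ?thesis unfolding log_prim_def by linarith
qed simp

text \<open>The fibering function \<open>(s, t) \<mapsto> J(s e\<^sub>1 + t e\<^sub>2)\<close> tends to \<open>-\<infinity>\<close> because \<open>p > 4\<close>, and the
  nonnegative mixed terms keep its maximum off the coordinate axes.\<close>

lemma interior_local_maximum:
  fixes A1 A2 A12 D1 D2 D12 b p :: real
  defines "f \<equiv> \<lambda>s t. 1/2 * (s\<^sup>2 * A1 + 2 * s * t * A12 + t\<^sup>2 * A2)
      + b/4 * (s\<^sup>2 * D1 + 2 * s * t * D12 + t\<^sup>2 * D2)\<^sup>2 + (log_prim p s + log_prim p t)"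
  assumes A: "A1 > 0" "A2 > 0" "A12 \<ge> 0" and D: "D1 \<ge> 0" "D2 \<ge> 0" "D12 \<ge> 0"
    and b: "b > 0" and p: "p > 4"
  obtains s t d where "s > 0" "t > 0" "d > 0"
    "\<And>\<sigma>. \<bar>\<sigma>\<bar> < d \<Longrightarrow> f (s + \<sigma>) t \<le> f s t" "\<And>\<sigma>. \<bar>\<sigma>\<bar> < d \<Longrightarrow> f s (t + \<sigma>) \<le> f s t"
proof -
  \<comment> \<open>2st \<le> s^2 + t^2 and (s^2 + t^2)^2 \<le> 2 (s^4 + t^4) decouple the
    variables: with these constants f s t \<le> K s + K t on the quadrant.\<close>
  define C where "C = (A1 + A12 + A2) / 2"
  define B where "B = D1 + D12 + D2"
  define E where "E = b / 2 * B\<^sup>2"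
  define K where "K \<tau> = C * \<tau>\<^sup>2 + E * \<tau> ^ 4 + log_prim p \<tau>" for \<tau>
  have C0: "C \<ge> 0" and E0: "E \<ge> 0" using A b by (simp_all add: C_def E_def)
  have quad: "s\<^sup>2 * x + 2 * s * t * y + t\<^sup>2 * z \<le> (x + y + z) * (s\<^sup>2 + t\<^sup>2)"
    if "x \<ge> 0" "y \<ge> 0" "z \<ge> 0" for x y z s t :: real
  proof -
    have "2 * s * t * y \<le> (s\<^sup>2 + t\<^sup>2) * y"
      using sum_squares_bound[of s t] that by (intro mult_right_mono) auto
    moreover have "0 \<le> t\<^sup>2 * x" "0 \<le> s\<^sup>2 * z" using that by auto
    ultimately show ?thesis by (simp add: algebra_simps)
  qed
  have fK: "f s t \<le> K s + K t" if "s \<ge> 0" "t \<ge> 0" for s t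
  proof -
    let ?Q = "s\<^sup>2 * D1 + 2 * s * t * D12 + t\<^sup>2 * D2"
    have Q0: "?Q \<ge> 0" using that D by simp
    have "?Q\<^sup>2 \<le> (B * (s\<^sup>2 + t\<^sup>2))\<^sup>2"
      using quad[OF D(1,3,2), of s t] Q0 unfolding B_def by (intro power_mono) auto
    also have "\<dots> = B\<^sup>2 * (s\<^sup>2 + t\<^sup>2)\<^sup>2" by (rule power_mult_distrib)
    also have "\<dots> \<le> B\<^sup>2 * (2 * (s ^ 4 + t ^ 4))"
    proof (rule mult_left_mono)
      show "(s\<^sup>2 + t\<^sup>2)\<^sup>2 \<le> 2 * (s ^ 4 + t ^ 4)"
        using sum_squares_bound[of "s\<^sup>2" "t\<^sup>2"] by (simp add: power2_sum)
    qed simp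
    finally have "b/4 * ?Q\<^sup>2 \<le> b/4 * (B\<^sup>2 * (2 * (s ^ 4 + t ^ 4)))" using b by (intro mult_left_mono) auto
    also have "\<dots> = E * s ^ 4 + E * t ^ 4" by (simp add: E_def algebra_simps)
    finally have "b/4 * ?Q\<^sup>2 \<le> E * s ^ 4 + E * t ^ 4" .
    moreover have "1/2 * (s\<^sup>2 * A1 + 2 * s * t * A12 + t\<^sup>2 * A2) \<le> C * s\<^sup>2 + C * t\<^sup>2"
      using quad[of A1 A12 A2 s t] A by (simp add: C_def field_simps)
    ultimately show ?thesis unfolding f_def K_def by linarith
  qed
  obtain R1 where R1: "R1 \<ge> 1" "\<And>\<tau>. \<tau> \<ge> R1 \<Longrightarrow> K \<tau> \<le> - \<tau>"
    using quartic_plus_log_prim_bound[OF p C0 E0] unfolding K_def by metis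
  have contG: "continuous_on S (log_prim p)" for S
    using p isCont_log_prim by (intro continuous_at_imp_continuous_on) auto
  have "continuous_on {0..R1} K" unfolding K_def by (intro continuous_intros contG)
  then obtain m where m: "\<And>\<tau>. \<tau> \<in> {0..R1} \<Longrightarrow> K \<tau> \<le> K m"
    using continuous_attains_sup[of "{0..R1}" K] R1(1) by fastforce
  define M where "M = max (K m) 0"
  have KM: "K \<tau> \<le> M" if "\<tau> \<ge> 0" for \<tau>
    using m[of \<tau>] R1(1) R1(2)[of \<tau>] that by (cases "\<tau> \<le> R1") (auto simp: M_def)
  \<comment> \<open>K \<le> M on the half line and K R \<le> -R < -M, so f is negative on the edges
    s = R and t = R, whereas f 0 0 = 0. The maximum over the square thus avoids these edges.\<close>
  define R where "R = max R1 (M + 1)"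
  have R: "R \<ge> 1" and KR: "K R < - M" using R1(1) R1(2)[of R] by (auto simp: R_def)
  let ?S = "{0..R} \<times> {0..R}"
  have "continuous_on ?S (\<lambda>x. f (fst x) (snd x))"
    unfolding f_def by (intro continuous_intros continuous_on_compose2[OF contG[of UNIV]]) auto
  then obtain z where z: "z \<in> ?S" "\<And>y. y \<in> ?S \<Longrightarrow> f (fst y) (snd y) \<le> f (fst z) (snd z)"
    using continuous_attains_sup[of ?S "\<lambda>x. f (fst x) (snd x)"] R by (auto simp: compact_Times)
  obtain s t where st: "z = (s, t)" by (cases z)
  have s: "0 \<le> s" "s \<le> R" and t: "0 \<le> t" "t \<le> R" using z(1) st by auto
  have max: "f s' t' \<le> f s t" if "0 \<le> s'" "s' \<le> R" "0 \<le> t'" "t' \<le> R" for s' t'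
    using z(2)[of "(s', t')"] that st by simp
  have "f 0 0 = 0" by (simp add: f_def)
  then have f0: "f s t \<ge> 0" using max[of 0 0] R by simp
  have "s \<noteq> R" using fK[OF s(1) t(1)] KM[OF t(1)] KR f0 by auto
  then have sR: "s < R" using s by simp
  have "t \<noteq> R" using fK[OF s(1) t(1)] KM[OF s(1)] KR f0 by auto
  then have tR: "t < R" using t by simp
  have "s \<noteq> 0"
  proof
    assume s0: "s = 0"
    \<comment> \<open>Moving from (0, t) to (1, t) raises f strictly: A1 > 0, the mixed terms are
      nonnegative, and \<open>log_prim p 1\<close> is nonnegative.\<close>
    let ?Q = "1\<^sup>2 * D1 + 2 * 1 * t * D12 + t\<^sup>2 * D2"
    have "(t\<^sup>2 * D2)\<^sup>2 \<le> ?Q\<^sup>2" using t D by (intro power_mono) auto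
    then have "b/4 * (t\<^sup>2 * D2)\<^sup>2 \<le> b/4 * ?Q\<^sup>2" using b by (intro mult_left_mono) auto
    moreover have "1/2 * (t\<^sup>2 * A2) < 1/2 * (1\<^sup>2 * A1 + 2 * 1 * t * A12 + t\<^sup>2 * A2)"
      using A add_pos_nonneg[of A1 "2 * t * A12"] t by simp
    moreover have "log_prim p 1 \<ge> 0" using p by (intro log_prim_nonneg) auto
    moreover have "f 0 t = 1/2 * (t\<^sup>2 * A2) + b/4 * (t\<^sup>2 * D2)\<^sup>2 + log_prim p t" by (simp add: f_def)
    ultimately have "f 0 t < f 1 t" unfolding f_def by linarith
    then show False using max[of 1 t] R t s0 by simp
  qed
  then have spos: "s > 0" using s by simp
  have "t \<noteq> 0"
  proof
    assume t0: "t = 0"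
    let ?Q = "s\<^sup>2 * D1 + 2 * s * 1 * D12 + 1\<^sup>2 * D2"
    have "(s\<^sup>2 * D1)\<^sup>2 \<le> ?Q\<^sup>2" using s D by (intro power_mono) auto
    then have "b/4 * (s\<^sup>2 * D1)\<^sup>2 \<le> b/4 * ?Q\<^sup>2" using b by (intro mult_left_mono) auto
    moreover have "1/2 * (s\<^sup>2 * A1) < 1/2 * (s\<^sup>2 * A1 + 2 * s * 1 * A12 + 1\<^sup>2 * A2)"
      using A add_nonneg_pos[of "2 * s * A12" A2] s by simp
    moreover have "log_prim p 1 \<ge> 0" using p by (intro log_prim_nonneg) auto
    moreover have "f s 0 = 1/2 * (s\<^sup>2 * A1) + b/4 * (s\<^sup>2 * D1)\<^sup>2 + log_prim p s" by (simp add: f_def)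
    ultimately have "f s 0 < f s 1" unfolding f_def by linarith
    then show False using max[of s 1] R s t0 by simp
  qed
  then have tpos: "t > 0" using t by simp
  let ?d = "min (min s t) (min (R - s) (R - t))"
  show ?thesis
  proof (rule that[OF spos tpos])
    show "?d > 0" using spos tpos sR tR by simp
    show "f (s + \<sigma>) t \<le> f s t" if "\<bar>\<sigma>\<bar> < ?d" for \<sigma> using that s t by (intro max) auto
    show "f s (t + \<sigma>) \<le> f s t" if "\<bar>\<sigma>\<bar> < ?d" for \<sigma> using that s t by (intro max) auto
  qed
qed

text \<open>At a maximum the quadratic remainder gives \<sigma> L \<le> K \<sigma>^2 A for small
  \<sigma> of either sign, so |L| is at most a multiple of |\<sigma>|.\<close>

lemma energy_deriv_local_max:
  assumes a: "a > 0" and b: "b > 0" and p: "p > 3" and w: "\<And>x. w x \<ge> 1"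
    and u: "u \<in> wl2 w" and e: "e \<in> wl2 w" and d: "d > 0"
    and max: "\<And>\<sigma>. \<bar>\<sigma>\<bar> < d \<Longrightarrow> energy a b p w (\<lambda>x. u x + \<sigma> * e x) \<le> energy a b p w u"
  shows "energy_deriv a b p w u e = 0"
proof -
  have w0: "w x \<ge> 0" for x using w[of x] by simp
  obtain K where K: "K \<ge> 0" "\<And>\<phi>. \<phi> \<in> wl2 w \<Longrightarrow> form a w \<phi> \<phi> \<le> 1 \<Longrightarrow>
    \<bar>energy a b p w (\<lambda>x. u x + \<phi> x) - energy a b p w u - energy_deriv a b p w u \<phi>\<bar> \<le> K * form a w \<phi> \<phi>"
    using energy_remainder[OF a b p w u] by blast
  let ?A = "form a w e e" and ?L = "energy_deriv a b p w u e"
  have A0: "?A \<ge> 0" using a w0 by (intro form_nonneg) auto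
  have quad: "form a w (\<lambda>x. \<sigma> * e x) (\<lambda>x. \<sigma> * e x) = \<sigma>\<^sup>2 * ?A" for \<sigma>
    using form_commute[of a w "\<lambda>x. \<sigma> * e x" e] by (simp add: form_scale_right power2_eq_square)
  have step: "\<sigma> * ?L \<le> K * (\<sigma>\<^sup>2 * ?A)" if "\<bar>\<sigma>\<bar> < d" "\<sigma>\<^sup>2 * ?A \<le> 1" for \<sigma>
    using K(2)[OF wl2_scale[OF e, of \<sigma>]] max[OF that(1)] that(2)
    unfolding quad energy_deriv_scale by linarith
  have "\<bar>?L\<bar> \<le> 0"
  proof (rule field_le_epsilon)
    fix \<epsilon> :: real assume \<epsilon>: "\<epsilon> > 0"
    \<comment> \<open>\<open>d / 2\<close> keeps the step within \<open>max\<close>; the bounds 1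
      and \<open>1 / (?A + 1)\<close> give \<tau>^2 A \<le> 1 for the remainder estimate; the last
      bound makes the error at most \<epsilon>.\<close>
    define \<tau> where "\<tau> = min (d / 2) (min 1 (min (1 / (?A + 1)) (\<epsilon> / (K * ?A + 1))))"
    have \<tau>: "\<tau> > 0" "\<tau> < d" "\<tau> \<le> 1" "\<tau> \<le> 1 / (?A + 1)" "\<tau> \<le> \<epsilon> / (K * ?A + 1)"
      using d A0 K(1) \<epsilon> by (auto simp: \<tau>_def add_nonneg_pos)
    have "\<tau>\<^sup>2 \<le> \<tau>" using \<tau>(1,3) by (simp add: power2_eq_square mult_left_le)
    then have "\<tau>\<^sup>2 * ?A \<le> \<tau> * ?A" using A0 by (rule mult_right_mono)
    also have "\<dots> \<le> 1 / (?A + 1) * ?A" using \<tau>(4) A0 by (rule mult_right_mono)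
    also have "\<dots> \<le> 1" using A0 by (simp add: field_simps)
    finally have small: "\<tau>\<^sup>2 * ?A \<le> 1" .
    have "\<tau> * ?L \<le> K * (\<tau>\<^sup>2 * ?A)" "- \<tau> * ?L \<le> K * ((- \<tau>)\<^sup>2 * ?A)"
      using \<tau> small by (intro step; simp)+
    then have "\<tau> * \<bar>?L\<bar> \<le> \<tau> * (\<tau> * (K * ?A))" by (simp add: abs_if power2_eq_square mult_ac)
    then have "\<bar>?L\<bar> \<le> \<tau> * (K * ?A)" using \<tau>(1) by simp
    also have "\<dots> \<le> \<epsilon> / (K * ?A + 1) * (K * ?A)" using \<tau>(5) K(1) A0 by (intro mult_right_mono) auto
    also have "\<dots> \<le> \<epsilon>" using K(1) A0 \<epsilon> by (simp add: pos_divide_le_eq add_nonneg_pos distrib_left)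
    finally show "\<bar>?L\<bar> \<le> 0 + \<epsilon>" by simp
  qed
  then show ?thesis by simp
qed

lemma exists_sign_changing_nehari:
  assumes a: "a > 0" and b: "b > 0" and p: "p > 4" and x: "x1 \<noteq> x2"
  obtains v where "\<And>x. x \<noteq> x1 \<Longrightarrow> x \<noteq> x2 \<Longrightarrow> v x = 0"
    "pos_part v \<noteq> (\<lambda>_. 0)" "neg_part v \<noteq> (\<lambda>_. 0)"
    "energy_deriv a b p (\<lambda>_. 1) v (pos_part v) = 0" "energy_deriv a b p (\<lambda>_. 1) v (neg_part v) = 0"
proof -
  define e1 :: "int ^ 3 \<Rightarrow> real" where "e1 x = (if x = x1 then 1 else 0)" for x
  \<comment> \<open>The value -1 makes the combination change sign and the mixed gradient product
    nonnegative, also when the two points are neighbours. Disjoint supports make the logarithmic sum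
    split.\<close>
  define e2 :: "int ^ 3 \<Rightarrow> real" where "e2 x = (if x = x2 then -1 else 0)" for x
  let ?w = "\<lambda>_ :: int ^ 3. 1 :: real"
  have e1: "e1 \<in> wl2 w" for w by (rule wl2_finite_support[of "{x1}"]) (auto simp: e1_def)
  have e2: "e2 \<in> wl2 w" for w by (rule wl2_finite_support[of "{x2}"]) (auto simp: e2_def)
  let ?v = "\<lambda>s t x. s * e1 x + t * e2 x"
  have vl: "?v s t \<in> wl2 ?w" for s t using e1 e2 by (intro wl2_add wl2_scale) auto
  have form_v: "form c (\<lambda>_. d) (?v s t) (?v s t)
      = s\<^sup>2 * form c (\<lambda>_. d) e1 e1 + 2 * s * t * form c (\<lambda>_. d) e1 e2 + t\<^sup>2 * form c (\<lambda>_. d) e2 e2"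
    if "d \<ge> 0" for c d s t
  proof -
    have "form c (\<lambda>_. d) (\<lambda>x. s * f x) (\<lambda>x. t * g x) = s * t * form c (\<lambda>_. d) f g" for f g s t
      using form_commute[of c "\<lambda>_. d" "\<lambda>x. s * f x" g] form_commute[of c "\<lambda>_. d" f g]
      by (simp add: form_scale_right)
    then show ?thesis
      using form_add_self[OF _ wl2_scale[OF e1] wl2_scale[OF e2], of "\<lambda>_. d" c s t] that
      by (simp add: power2_eq_square)
  qed
  have lp: "(\<Sum>\<^sub>\<infinity>x. log_prim p (?v s t x)) = log_prim p s + log_prim p t" for s t
  proof -
    have "(\<Sum>\<^sub>\<infinity>x. log_prim p (?v s t x)) = (\<Sum>\<^sub>\<infinity>x\<in>{x1, x2}. log_prim p (?v s t x))"
      by (rule infsum_cong_neutral) (auto simp: e1_def e2_def)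
    then show ?thesis using x by (simp add: e1_def e2_def)
  qed
  have energy_v: "energy a b p ?w (?v s t)
     = 1/2 * (s\<^sup>2 * form a ?w e1 e1 + 2 * s * t * form a ?w e1 e2 + t\<^sup>2 * form a ?w e2 e2)
      + b/4 * (s\<^sup>2 * dirichlet e1 e1 + 2 * s * t * dirichlet e1 e2 + t\<^sup>2 * dirichlet e2 e2)\<^sup>2
      + (log_prim p s + log_prim p t)" for s t
    unfolding energy_def lp by (simp only: form_v[of 1 a s t, simplified] form_v[of 0 1 s t, simplified])
  have g: "grad_prod e1 e2 x \<ge> 0" for x
    using x by (auto simp: grad_prod_def e1_def e2_def intro!: sum_nonneg)
  have "a * grad_prod e1 e2 x + 1 * e1 x * e2 x \<ge> 0" for x
    using a g[of x] x by (simp add: e1_def e2_def)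
  then have A12: "form a ?w e1 e2 \<ge> 0" unfolding form_def by (rule infsum_nonneg)
  have D12: "dirichlet e1 e2 \<ge> 0" unfolding form_def using g by (intro infsum_nonneg) simp
  have Apos: "form a ?w e e > 0" if "e \<in> wl2 ?w" "\<bar>e y\<bar> = 1" for e y
  proof -
    have "1 \<le> l2_inner e e" using abs_le_l2[OF that(1), of y] that(2) by simp
    moreover have "a * dirichlet e e \<ge> 0" using a by (simp add: form_nonneg)
    ultimately show ?thesis using wl2_ge_1[OF _ that(1), of a] by simp
  qed
  have D: "dirichlet e1 e1 \<ge> 0" "dirichlet e2 e2 \<ge> 0" by (intro form_nonneg; simp)+
  have "form a ?w e1 e1 > 0" "form a ?w e2 e2 > 0"
    using Apos[OF e1, of x1] Apos[OF e2, of x2] by (simp_all add: e1_def e2_def)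
  then obtain s t d where st: "s > 0" "t > 0" "d > 0"
    "\<And>\<sigma>. \<bar>\<sigma>\<bar> < d \<Longrightarrow> energy a b p ?w (?v (s + \<sigma>) t) \<le> energy a b p ?w (?v s t)"
    "\<And>\<sigma>. \<bar>\<sigma>\<bar> < d \<Longrightarrow> energy a b p ?w (?v s (t + \<sigma>)) \<le> energy a b p ?w (?v s t)"
    using interior_local_maximum[OF _ _ A12 D D12 b p] unfolding energy_v by metis
  have p3: "p > 3" using p by simp
  have 1: "energy_deriv a b p ?w (?v s t) e1 = 0"
    using st(3,4) by (intro energy_deriv_local_max[OF a b p3 _ vl e1]) (auto simp: algebra_simps)
  have 2: "energy_deriv a b p ?w (?v s t) e2 = 0"
    using st(3,5) by (intro energy_deriv_local_max[OF a b p3 _ vl e2]) (auto simp: algebra_simps)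
  \<comment> \<open>Since s, t > 0, stationarity in the directions e1 and e2 is exactly the pair of
    Nehari conditions.\<close>
  have pos: "pos_part (?v s t) = (\<lambda>x. s * e1 x)" and neg: "neg_part (?v s t) = (\<lambda>x. t * e2 x)"
    using x st(1,2) by (auto simp: pos_part_def neg_part_def e1_def e2_def)
  show ?thesis
  proof (rule that)
    show "?v s t x = 0" if "x \<noteq> x1" "x \<noteq> x2" for x using that by (simp add: e1_def e2_def)
    show "pos_part (?v s t) \<noteq> (\<lambda>_. 0)" unfolding pos using st(1) by (auto simp: e1_def fun_eq_iff)
    show "neg_part (?v s t) \<noteq> (\<lambda>_. 0)" unfolding neg using st(2) by (auto simp: e2_def fun_eq_iff)
    show "energy_deriv a b p ?w (?v s t) (pos_part (?v s t)) = 0"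
      unfolding pos energy_deriv_scale 1 by simp
    show "energy_deriv a b p ?w (?v s t) (neg_part (?v s t)) = 0"
      unfolding neg energy_deriv_scale 2 by simp
  qed
qed

subsection \<open>Passage to the limit\<close>

lemma finite_pointwise_convergent_subsequence:
  fixes u :: "nat \<Rightarrow> 'x \<Rightarrow> real"
  assumes "finite A" "\<And>k x. \<bar>u k x\<bar> \<le> B"
  shows "\<exists>r. strict_mono (r :: nat \<Rightarrow> nat) \<and> (\<forall>x\<in>A. convergent (\<lambda>k. u (r k) x))"
  using assms(1)
proof (induction A rule: finite_induct)
  case empty
  then show ?case by (auto intro: exI[of _ id] strict_mono_id)
next
  case (insert y A)
  then obtain r where r: "strict_mono (r :: nat \<Rightarrow> nat)" "\<And>x. x \<in> A \<Longrightarrow> convergent (\<lambda>k. u (r k) x)" by blast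
  have "bounded (range (\<lambda>k. u (r k) y))" using assms(2) by (auto simp: bounded_iff)
  then obtain l q where q: "strict_mono (q :: nat \<Rightarrow> nat)" "((\<lambda>k. u (r k) y) \<circ> q) \<longlonglongrightarrow> l"
    using bounded_imp_convergent_subsequence by blast
  have "convergent (\<lambda>k. u ((r \<circ> q) k) x)" if "x \<in> insert y A" for x
  proof (cases "x = y")
    case True
    then show ?thesis using q(2) by (auto simp: convergent_def o_def)
  next
    case False
    then have "convergent (\<lambda>k. u (r k) x)" using r(2) that by blast
    then obtain m where "(\<lambda>k. u (r k) x) \<longlonglongrightarrow> m" by (auto simp: convergent_def)
    from LIMSEQ_subseq_LIMSEQ[OF this q(1)] show ?thesis by (auto simp: convergent_def o_def)
  qed
  moreover have "strict_mono (r \<circ> q)" using r(1) q(1) by (rule strict_mono_o)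
  ultimately show ?case by blast
qed

text \<open>Constant weights suffice for the limit passage: the weights with \<open>lam k\<close>
  blow up off \<Omega>, and they are removed before the limit is taken. The proof expands around u0
  and uses boundedness of the form on l^2.\<close>

lemma form_tendsto:
  assumes c: "c \<ge> 0" "d \<ge> 0" and u: "\<And>k. u k \<in> wl2 (\<lambda>_. 1)" "u0 \<in> wl2 (\<lambda>_. 1)"
    and lim: "(\<lambda>k. l2_inner (\<lambda>x. u k x - u0 x) (\<lambda>x. u k x - u0 x)) \<longlonglongrightarrow> 0"
  shows "\<phi> \<in> wl2 (\<lambda>_. 1) \<Longrightarrow> (\<lambda>k. form c (\<lambda>_. d) (u k) \<phi>) \<longlonglongrightarrow> form c (\<lambda>_. d) u0 \<phi>"
    and "(\<lambda>k. form c (\<lambda>_. d) (u k) (u k)) \<longlonglongrightarrow> form c (\<lambda>_. d) u0 u0"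
proof -
  let ?d = "\<lambda>k x. u k x - u0 x" and ?f = "form c (\<lambda>_. d)"
  have in_d: "v \<in> wl2 (\<lambda>_. d)" if "v \<in> wl2 (\<lambda>_. 1)" for v :: "int ^ 3 \<Rightarrow> real"
    using that by (auto simp: wl2_def intro: summable_on_cmult_right)
  have dl: "?d k \<in> wl2 (\<lambda>_. 1)" for k using u by (intro wl2_diff) auto
  have nn: "?f (?d k) (?d k) \<ge> 0" for k using c by (intro form_nonneg) auto
  have dd: "(\<lambda>k. ?f (?d k) (?d k)) \<longlonglongrightarrow> 0"
  proof (rule Lim_null_comparison)
    show "(\<lambda>k. (2 * c * card unit_steps + d) * l2_inner (?d k) (?d k)) \<longlonglongrightarrow> 0"
      using tendsto_mult_right_zero[OF lim] .
    show "\<forall>\<^sub>F k in sequentially. norm (?f (?d k) (?d k)) \<le> (2 * c * card unit_steps + d) * l2_inner (?d k) (?d k)"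
      using const_form_le_l2[OF c(1) dl] nn by simp
  qed
  have dphi: "(\<lambda>k. ?f (?d k) \<phi>) \<longlonglongrightarrow> 0" if \<phi>: "\<phi> \<in> wl2 (\<lambda>_. 1)" for \<phi>
  proof (rule Lim_null_comparison)
    have "(\<lambda>k. sqrt (?f (?d k) (?d k)) * sqrt (?f \<phi> \<phi>)) \<longlonglongrightarrow> sqrt 0 * sqrt (?f \<phi> \<phi>)"
      by (intro tendsto_intros dd)
    then show "(\<lambda>k. sqrt (?f (?d k) (?d k)) * sqrt (?f \<phi> \<phi>)) \<longlonglongrightarrow> 0" by simp
    have "\<bar>?f (?d k) \<phi>\<bar> \<le> sqrt (?f (?d k) (?d k)) * sqrt (?f \<phi> \<phi>)" for k
      by (rule form_Cauchy_Schwarz[OF c(1) _ in_d[OF dl] in_d[OF \<phi>]]) (rule c(2))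
    then show "\<forall>\<^sub>F k in sequentially. norm (?f (?d k) \<phi>) \<le> sqrt (?f (?d k) (?d k)) * sqrt (?f \<phi> \<phi>)" by simp
  qed
  show "(\<lambda>k. ?f (u k) \<phi>) \<longlonglongrightarrow> ?f u0 \<phi>" if \<phi>: "\<phi> \<in> wl2 (\<lambda>_. 1)" for \<phi>
  proof -
    have "?f (u k) \<phi> = ?f u0 \<phi> + ?f (?d k) \<phi>" for k
      using form_add_right[OF c(2) in_d[OF \<phi>] in_d[OF u(2)] in_d[OF dl[of k]], of c]
      by (simp add: form_commute[of c "\<lambda>_. d" \<phi>])
    then show ?thesis using tendsto_add[OF tendsto_const[of "?f u0 \<phi>"] dphi[OF \<phi>]] by simp
  qed
  have "?f (u k) (u k) = ?f u0 u0 + 2 * ?f (?d k) u0 + ?f (?d k) (?d k)" for k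
    using form_add_self[OF c(2) in_d[OF u(2)] in_d[OF dl[of k]], of c]
    by (simp add: form_commute[of c "\<lambda>_. d" u0 "?d k"])
  moreover have "(\<lambda>k. ?f u0 u0 + 2 * ?f (?d k) u0 + ?f (?d k) (?d k)) \<longlonglongrightarrow> ?f u0 u0 + 2 * 0 + 0"
    by (intro tendsto_intros dphi u(2) dd)
  ultimately show "(\<lambda>k. ?f (u k) (u k)) \<longlonglongrightarrow> ?f u0 u0" by simp
qed

section \<open>Derivatives and Nehari sets of the two concrete problems\<close>

lemma
  assumes a: "a > 0" and b: "b > 0" and p: "p > 3" and h: "\<And>x. l * h x \<ge> 0"
  shows sc_nehari_Hlam: "sc_nehari (Hlam h l) (Hlam_norm a h l) (J_lam a b p h l) =
      {u \<in> Hlam h l. pos_part u \<noteq> (\<lambda>_. 0) \<and> neg_part u \<noteq> (\<lambda>_. 0) \<and>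
        energy_deriv a b p (\<lambda>x. l * h x + 1) u (pos_part u) = 0 \<and>
        energy_deriv a b p (\<lambda>x. l * h x + 1) u (neg_part u) = 0}"
    and frechet_Hlam: "\<And>u \<phi>. u \<in> Hlam h l \<Longrightarrow> \<phi> \<in> Hlam h l \<Longrightarrow>
      frechet_on (Hlam h l) (Hlam_norm a h l) (J_lam a b p h l) u \<phi>
        = energy_deriv a b p (\<lambda>x. l * h x + 1) u \<phi>"
proof -
  let ?V = "Hlam h l" and ?w = "\<lambda>x. l * h x + 1"
  have w: "1 \<le> ?w x" and w0: "0 \<le> ?w x" for x using h[of x] by auto
  have V: "?V \<subseteq> wl2 ?w" by (simp add: Hlam_eq)
  have add: "(\<lambda>x. u x + v x) \<in> ?V" if "u \<in> ?V" "v \<in> ?V" for u v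
    using that unfolding Hlam_eq by (rule wl2_add[OF w0])
  have scale: "(\<lambda>x. c * v x) \<in> ?V" if "v \<in> ?V" for c v
    using that unfolding Hlam_eq by (rule wl2_scale)
  have dom: "v \<in> ?V" if "u \<in> ?V" "\<And>x. \<bar>v x\<bar> \<le> \<bar>u x\<bar>" for u v
    using wl2_bounded[of ?w u v] that w0 by (simp add: Hlam_eq)
  have N: "Hlam_norm a h l v = sqrt (form a ?w v v)" if "v \<in> ?V" for v by (rule Hlam_norm_form)
  have J: "J_lam a b p h l v = energy a b p ?w v" if "v \<in> ?V" for v
    using that a p h by (intro J_lam_energy) (auto simp: Hlam_eq wl2_def)
  show "sc_nehari ?V (Hlam_norm a h l) (J_lam a b p h l) =
      {u \<in> ?V. pos_part u \<noteq> (\<lambda>_. 0) \<and> neg_part u \<noteq> (\<lambda>_. 0) \<and>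
        energy_deriv a b p ?w u (pos_part u) = 0 \<and> energy_deriv a b p ?w u (neg_part u) = 0}"
    by (rule sc_nehari_energy[where w="?w" and V="?V" and N="Hlam_norm a h l" and J="J_lam a b p h l"])
      (fact a b p w V add scale dom N J)+
  show "frechet_on ?V (Hlam_norm a h l) (J_lam a b p h l) u \<phi> = energy_deriv a b p ?w u \<phi>"
    if "u \<in> ?V" "\<phi> \<in> ?V" for u \<phi>
    by (rule frechet_energy[where w="?w" and V="?V" and N="Hlam_norm a h l" and J="J_lam a b p h l"])
      (fact a b p w V add scale N J that)+
qed

lemma
  assumes a: "a > 0" and b: "b > 0" and p: "p > 3" and fin: "finite \<Omega>"
  shows sc_nehari_H01: "sc_nehari (H01 a \<Omega>) (H01_norm a \<Omega>) (J_Omega a b p \<Omega>) =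
      {u \<in> H01 a \<Omega>. pos_part u \<noteq> (\<lambda>_. 0) \<and> neg_part u \<noteq> (\<lambda>_. 0) \<and>
        energy_deriv a b p (\<lambda>_. 1) u (pos_part u) = 0 \<and> energy_deriv a b p (\<lambda>_. 1) u (neg_part u) = 0}"
    and frechet_H01: "\<And>u \<phi>. u \<in> H01 a \<Omega> \<Longrightarrow> \<phi> \<in> H01 a \<Omega> \<Longrightarrow>
      frechet_on (H01 a \<Omega>) (H01_norm a \<Omega>) (J_Omega a b p \<Omega>) u \<phi> = energy_deriv a b p (\<lambda>_. 1) u \<phi>"
proof -
  let ?V = "H01 a \<Omega>" and ?w = "\<lambda>_ :: int ^ 3. 1 :: real"
  have w: "1 \<le> ?w x" for x by simp
  have V: "?V \<subseteq> wl2 ?w" using fin by (auto simp: H01_eq intro: wl2_finite_support)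
  have add: "(\<lambda>x. u x + v x) \<in> ?V" if "u \<in> ?V" "v \<in> ?V" for u v
    using that fin by (simp add: H01_eq)
  have scale: "(\<lambda>x. c * v x) \<in> ?V" if "v \<in> ?V" for c v
    using that fin by (simp add: H01_eq)
  have dom: "v \<in> ?V" if uv: "u \<in> ?V" "\<And>x. \<bar>v x\<bar> \<le> \<bar>u x\<bar>" for u v
  proof -
    have "v x = 0" if "x \<notin> \<Omega>" for x using uv(2)[of x] uv(1) that fin by (simp add: H01_eq)
    then show ?thesis using fin by (simp add: H01_eq)
  qed
  have N: "H01_norm a \<Omega> v = sqrt (form a ?w v v)" if "v \<in> ?V" for v
    using that fin by (intro H01_norm_form) (auto simp: H01_eq)
  have J: "J_Omega a b p \<Omega> v = energy a b p ?w v" if "v \<in> ?V" for v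
    using that fin a p by (intro J_Omega_energy) (auto simp: H01_eq)
  show "sc_nehari ?V (H01_norm a \<Omega>) (J_Omega a b p \<Omega>) =
      {u \<in> ?V. pos_part u \<noteq> (\<lambda>_. 0) \<and> neg_part u \<noteq> (\<lambda>_. 0) \<and>
        energy_deriv a b p ?w u (pos_part u) = 0 \<and> energy_deriv a b p ?w u (neg_part u) = 0}"
    by (rule sc_nehari_energy[where w="?w" and V="?V" and N="H01_norm a \<Omega>" and J="J_Omega a b p \<Omega>"])
      (fact a b p w V add scale dom N J)+
  show "frechet_on ?V (H01_norm a \<Omega>) (J_Omega a b p \<Omega>) u \<phi> = energy_deriv a b p ?w u \<phi>"
    if "u \<in> ?V" "\<phi> \<in> ?V" for u \<phi>
    by (rule frechet_energy[where w="?w" and V="?V" and N="H01_norm a \<Omega>" and J="J_Omega a b p \<Omega>"])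
      (fact a b p w V add scale N J that)+
qed

text \<open>Both parts are nondecreasing functions of u with values 0 or u, as
  \<open>truncation_exceeds_1\<close> requires.\<close>

lemma truncation_parts:
  shows "pos_part u x = 0 \<or> pos_part u x = u x" "(u y - u x) * (pos_part u y - pos_part u x) \<ge> 0"
    and "neg_part u x = 0 \<or> neg_part u x = u x" "(u y - u x) * (neg_part u y - neg_part u x) \<ge> 0"
  by (auto simp: pos_part_def neg_part_def max_def min_def zero_le_mult_iff)

lemma l2_tendsto_pointwise:
  assumes "\<And>k. u k \<in> wl2 (\<lambda>_. 1)" "u0 \<in> wl2 (\<lambda>_. 1)"
    and lim: "(\<lambda>k. l2_inner (\<lambda>x. u k x - u0 x) (\<lambda>x. u k x - u0 x)) \<longlonglongrightarrow> 0" and e: "e > 0"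
  shows "\<forall>\<^sub>F k in sequentially. \<forall>x. \<bar>u k x - u0 x\<bar> < e"
proof -
  have "\<forall>\<^sub>F k in sequentially. l2_inner (\<lambda>x. u k x - u0 x) (\<lambda>x. u k x - u0 x) < e\<^sup>2"
    using order_tendstoD(2)[OF lim, of "e\<^sup>2"] e by simp
  then show ?thesis
  proof eventually_elim
    case (elim k)
    have "(\<lambda>x. u k x - u0 x) \<in> wl2 (\<lambda>_. 1)" using assms(1,2) by (intro wl2_diff) auto
    then have "\<bar>u k x - u0 x\<bar> \<le> sqrt (l2_inner (\<lambda>x. u k x - u0 x) (\<lambda>x. u k x - u0 x))" for x
      by (rule abs_le_l2)
    moreover have "sqrt (l2_inner (\<lambda>x. u k x - u0 x) (\<lambda>x. u k x - u0 x)) < e"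
      using real_sqrt_less_mono[OF elim] e by simp
    ultimately show ?case using le_less_trans by blast
  qed
qed

theorem theorem1p3:
  fixes a b p :: real
    and h :: "int ^ 3 \<Rightarrow> real"
    and \<Omega> :: "(int ^ 3) set"
    and lam :: "nat \<Rightarrow> real"
    and u :: "nat \<Rightarrow> int ^ 3 \<Rightarrow> real"
  assumes a: "a > 0" and b: "b > 0" and p: "p > 6"
    and Omega: "\<Omega> = {x. h x = 0}"
    and h1: "\<And>x. h x \<ge> 0" "\<Omega> \<noteq> {}" "graph_connected \<Omega>" "lattice_bounded \<Omega>"
    and h2: "\<exists>M>0. emeasure (count_space UNIV) {x. h x < M} < \<infinity>"
    and nondegenerate: "\<not> is_singleton \<Omega>"
    and lam: "\<And>k. lam k > 0" "filterlim lam at_top sequentially"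
    and u: "\<And>k. least_energy_sc_solution (Hlam h (lam k)) (Hlam_norm a h (lam k))
                   (J_lam a b p h (lam k)) (u k)"
  shows "\<exists>r u0. strict_mono (r :: nat \<Rightarrow> nat) \<and>
           least_energy_sc_solution (H01 a \<Omega>) (H01_norm a \<Omega>) (J_Omega a b p \<Omega>) u0 \<and>
           u0 \<in> H1 \<and> (\<lambda>k. H1_norm (\<lambda>x. u (r k) x - u0 x)) \<longlonglongrightarrow> 0"
proof -
  have p3: "p > 3" and p4: "p > 4" using p by auto
  obtain M where M: "M > 0" "finite {x. h x < M}"
    using h2 by (auto simp: emeasure_count_space split: if_splits)
  let ?F = "{x. h x < M}"
  have fin: "finite \<Omega>" by (rule finite_subset[OF _ M(2)]) (use Omega M(1) in auto)
  obtain x1 x2 where x12: "x1 \<in> \<Omega>" "x2 \<in> \<Omega>" "x1 \<noteq> x2"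
    using h1(2) nondegenerate by (metis is_singletonI' )
  let ?w = "\<lambda>k x. lam k * h x + 1"
  let ?E = "energy a b p (\<lambda>_. 1)" and ?D = "energy_deriv a b p (\<lambda>_. 1)"
  let ?NO = "sc_nehari (H01 a \<Omega>) (H01_norm a \<Omega>) (J_Omega a b p \<Omega>)"
  let ?NL = "\<lambda>k. sc_nehari (Hlam h (lam k)) (Hlam_norm a h (lam k)) (J_lam a b p h (lam k))"
  have lh: "lam k * h x \<ge> 0" for k x using lam(1)[of k] h1(1)[of x] by simp
  have w1: "?w k x \<ge> 1" and w0: "?w k x \<ge> 0" for k x using lh[of k x] by auto
  have wO: "?w k x = 1" if "x \<in> \<Omega>" for k x using that Omega by simp
  have NL: "?NL k = {v \<in> wl2 (?w k). pos_part v \<noteq> (\<lambda>_. 0) \<and> neg_part v \<noteq> (\<lambda>_. 0) \<and>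
      energy_deriv a b p (?w k) v (pos_part v) = 0 \<and> energy_deriv a b p (?w k) v (neg_part v) = 0}" for k
    using sc_nehari_Hlam[where l="lam k" and h=h, OF a b p3] lh by (simp add: Hlam_eq)
  have NO: "?NO = {v. (\<forall>x. x \<notin> \<Omega> \<longrightarrow> v x = 0) \<and> pos_part v \<noteq> (\<lambda>_. 0) \<and> neg_part v \<noteq> (\<lambda>_. 0) \<and>
      ?D v (pos_part v) = 0 \<and> ?D v (neg_part v) = 0}"
    using sc_nehari_H01[OF a b p3 fin] by (simp add: H01_eq[OF fin])
  have uH: "u k \<in> wl2 (?w k)" for k
    using u[of k] by (simp add: least_energy_sc_solution_def sc_solution_def Hlam_eq)
  have ul: "u k \<in> wl2 (\<lambda>_. 1)" for k using uH wl2_subset by blast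
  have uD: "energy_deriv a b p (?w k) (u k) \<phi> = 0" if "\<phi> \<in> wl2 (?w k)" for k \<phi>
    using u[of k] that frechet_Hlam[where l="lam k" and h=h and u="u k" and \<phi>=\<phi>, OF a b p3] lh uH[of k]
    by (simp add: least_energy_sc_solution_def sc_solution_def Hlam_eq)
  have upm: "pos_part (u k) \<noteq> (\<lambda>_. 0)" "neg_part (u k) \<noteq> (\<lambda>_. 0)" for k
    using u[of k] by (simp_all add: least_energy_sc_solution_def sc_solution_def)
  have parts: "pos_part (u k) \<in> wl2 (?w k)" "neg_part (u k) \<in> wl2 (?w k)" for k
    using wl2_bounded[of "?w k" "u k" "pos_part (u k)"] wl2_bounded[of "?w k" "u k" "neg_part (u k)"]
      w0 uH by (simp_all add: abs_pos_part_le abs_neg_part_le)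
  \<comment> \<open>The value of the functional on a Nehari function in terms of its squared norm,
    Dirichlet energy and power sum. Monotonicity in A and S allows the part outside \<Omega> to be
    dropped.\<close>
  define coer where "coer A d S = (1/2 - 1/p) * A + b * (1/4 - 1/p) * d\<^sup>2 + 2 / p\<^sup>2 * S" for A d S
  have coer_mono: "coer A d S \<le> coer A' d S'" if "A \<le> A'" "S \<le> S'" for A A' d S S'
    using that p by (auto simp: coer_def intro!: add_mono mult_left_mono divide_right_mono)
  have coer_ge: "(1/2 - 1/p) * A \<le> coer A d S" if "S \<ge> 0" for A d S
  proof -
    have "0 \<le> b * (1/4 - 1/p) * d\<^sup>2" using b p by (intro mult_nonneg_nonneg) (auto simp: field_simps)
    moreover have "0 \<le> 2 / p\<^sup>2 * S" using that by simp
    ultimately show ?thesis unfolding coer_def by linarith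
  qed
  let ?S = "\<lambda>v. \<Sum>\<^sub>\<infinity>x :: int ^ 3. \<bar>v x\<bar> powr p"
  have NL_coer: "J_lam a b p h (lam k) v = coer (form a (?w k) v v) (dirichlet v v) (?S v)"
    if "v \<in> ?NL k" for k v
  proof -
    have v: "v \<in> wl2 (?w k)" "energy_deriv a b p (?w k) v (pos_part v) = 0"
        "energy_deriv a b p (?w k) v (neg_part v) = 0"
      using that unfolding NL by simp_all
    have "J_lam a b p h (lam k) v = energy a b p (?w k) v"
      using v(1) a lh wl2_subset by (intro J_lam_energy p3) auto
    also have "\<dots> = coer (form a (?w k) v v) (dirichlet v v) (?S v)"
      unfolding coer_def by (rule nehari_energy_eq[where w="?w k"]) (fact p3 w0 v)+
    finally show ?thesis .
  qed
  have S0: "?S v \<ge> 0" for v by (rule infsum_nonneg) simp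
  have uNL: "u k \<in> ?NL k" for k
    using uH upm uD parts unfolding NL by simp
  \<comment> \<open>The sign parts of v are supported in \<Omega>, where the weight is 1 for every
    k; so neither the conditions nor the energy notice \<open>lam k\<close>.\<close>
  have NO_NL: "v \<in> ?NL k" and JO_JL: "J_lam a b p h (lam k) v = J_Omega a b p \<Omega> v" if "v \<in> ?NO" for v k
  proof -
    have v: "\<And>x. x \<notin> \<Omega> \<Longrightarrow> v x = 0" "pos_part v \<noteq> (\<lambda>_. 0)" "neg_part v \<noteq> (\<lambda>_. 0)"
        "?D v (pos_part v) = 0" "?D v (neg_part v) = 0"
      using that unfolding NO by simp_all
    have pn: "pos_part v x = 0" "neg_part v x = 0" if "x \<notin> \<Omega>" for x
      using v(1)[OF that] by (simp_all add: pos_part_def neg_part_def)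
    have vl: "v \<in> wl2 w" for w by (rule wl2_finite_support[OF fin v(1)])
    have cong: "energy_deriv a b p (?w k) v \<phi> = ?D v \<phi>" if "\<And>x. x \<notin> \<Omega> \<Longrightarrow> \<phi> x = 0" for \<phi>
      by (rule energy_deriv_support_cong[where \<Omega>=\<Omega>]) (use that wO in auto)
    show "v \<in> ?NL k"
      using cong[OF pn(1)] cong[OF pn(2)] v(2-5) vl unfolding NL by simp
    show "J_lam a b p h (lam k) v = J_Omega a b p \<Omega> v"
      using J_lam_energy[where l="lam k" and h=h and u=v, OF less_imp_le[OF a] p3] lh vl
        J_Omega_energy[OF less_imp_le[OF a] p3 fin v(1)]
        energy_support_cong[where \<Omega>=\<Omega> and u=v and w="?w k" and w'="\<lambda>_. 1"] v(1) wO by simp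
  qed
  have below: "J_lam a b p h (lam k) (u k) \<le> J_Omega a b p \<Omega> v" if "v \<in> ?NO" for v k
  proof -
    \<comment> \<open>Without a lower bound the real \<open>INF\<close> would not lie below the
      values; \<open>coer_ge\<close> supplies the bound 0.\<close>
    have "bdd_below (J_lam a b p h (lam k) ` ?NL k)"
    proof (rule bdd_belowI2)
      fix v assume v: "v \<in> ?NL k"
      have "form a (?w k) v v \<ge> 0" using a w0 by (intro form_nonneg) auto
      then have "0 \<le> (1/2 - 1/p) * form a (?w k) v v" using p by simp
      then show "0 \<le> J_lam a b p h (lam k) v" using coer_ge[OF S0[of v]] unfolding NL_coer[OF v] by (rule order_trans)
    qed
    then have "(INF v\<in>?NL k. J_lam a b p h (lam k) v) \<le> J_lam a b p h (lam k) v"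
      using NO_NL[OF that] by (rule cINF_lower)
    then show ?thesis using u[of k] JO_JL[OF that] by (simp add: least_energy_sc_solution_def)
  qed
  obtain v0 where v0: "v0 \<in> ?NO"
  proof -
    obtain v where v: "\<And>x. x \<noteq> x1 \<Longrightarrow> x \<noteq> x2 \<Longrightarrow> v x = 0"
      "pos_part v \<noteq> (\<lambda>_. 0)" "neg_part v \<noteq> (\<lambda>_. 0)" "?D v (pos_part v) = 0" "?D v (neg_part v) = 0"
      using exists_sign_changing_nehari[OF a b p4 x12(3)] by blast
    have "v x = 0" if "x \<notin> \<Omega>" for x using v(1)[of x] that x12 by blast
    then have "v \<in> ?NO" using v(2-5) unfolding NO by simp
    then show ?thesis by (rule that)
  qed
  \<comment> \<open>The competitor v0 is the same for all k, which makes the bound uniform.\<close>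
  define C where "C = J_Omega a b p \<Omega> v0 / (1/2 - 1/p)"
  have AC: "form a (?w k) (u k) (u k) \<le> C" for k
  proof -
    have "(1/2 - 1/p) * form a (?w k) (u k) (u k) \<le> J_Omega a b p \<Omega> v0"
      using coer_ge[OF S0[of "u k"]] below[OF v0, of k] unfolding NL_coer[OF uNL] by (rule order_trans)
    moreover have "1/2 - 1/p > 0" using p by (simp add: field_simps)
    ultimately show ?thesis by (simp add: C_def pos_le_divide_eq mult.commute)
  qed
  have hC: "lam k * (\<Sum>\<^sub>\<infinity>x. h x * (u k x)\<^sup>2) \<le> C"
    and hs: "(\<lambda>x. h x * (u k x)\<^sup>2) summable_on UNIV"
    and lC: "l2_inner (u k) (u k) \<le> C" for k
  proof -
    have s: "(\<lambda>x. lam k * (h x * (u k x)\<^sup>2)) summable_on UNIV"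
      using uH[of k] unfolding Hlam_eq[symmetric] by (simp add: Hlam_def mult.assoc)
    then show hs: "(\<lambda>x. h x * (u k x)\<^sup>2) summable_on UNIV"
      using summable_on_cmult_right[of "\<lambda>x. lam k * (h x * (u k x)\<^sup>2)" UNIV "1 / lam k"] lam(1)[of k] by simp
    have ad: "a * dirichlet (u k) (u k) \<ge> 0" using a by (simp add: form_nonneg)
    show "l2_inner (u k) (u k) \<le> C" using wl2_ge_1[where w="?w k" and c=a, OF _ uH] w1 ad AC[of k] by simp
    \<comment> \<open>Dropping the gradient and the 1 in the weight isolates the penalty term, so
      the mass weighted by h is at most C / \<open>lam k\<close>.\<close>
    have "form 0 (\<lambda>x. lam k * h x) (u k) (u k) \<le> form a (?w k) (u k) (u k)"
      using a lh uH by (intro form_mono) auto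
    then show "lam k * (\<Sum>\<^sub>\<infinity>x. h x * (u k x)\<^sup>2) \<le> C"
      using AC[of k] by (simp add: form_def infsum_cmult_right'[symmetric] power2_eq_square mult.assoc)
  qed
  have ub: "\<bar>u k x\<bar> \<le> sqrt C" for k x
    using abs_le_l2[OF ul] real_sqrt_le_mono[OF lC] by (rule order_trans)
  obtain r where r: "strict_mono (r :: nat \<Rightarrow> nat)" "\<And>x. x \<in> \<Omega> \<Longrightarrow> convergent (\<lambda>k. u (r k) x)"
    using finite_pointwise_convergent_subsequence[where u=u, OF fin ub] by blast
  \<comment> \<open>Convergence has been extracted on \<Omega> only; elsewhere h > 0, and the
    penalty bound forces the limit 0.\<close>
  define u0 where "u0 x = (if x \<in> \<Omega> then lim (\<lambda>k. u (r k) x) else 0)" for x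
  have u0O: "u0 x = 0" if "x \<notin> \<Omega>" for x using that by (simp add: u0_def)
  have u0l: "u0 \<in> wl2 w" for w by (rule wl2_finite_support[OF fin u0O])
  have C0: "C \<ge> 0" using lC[of 0] form_nonneg[of 0 "\<lambda>_. 1" "u 0"] by simp
  have lamr: "filterlim (\<lambda>k. lam (r k)) at_top sequentially"
    using filterlim_compose[OF lam(2) filterlim_subseq[OF r(1)]] .
  have Clam: "(\<lambda>k. C / lam (r k)) \<longlonglongrightarrow> 0"
    by (rule tendsto_divide_0[OF tendsto_const filterlim_at_top_imp_at_infinity[OF lamr]])
  have hsum: "(\<Sum>\<^sub>\<infinity>x. h x * (u k x)\<^sup>2) \<le> C / lam k" for k
    using hC[of k] lam(1)[of k] by (simp add: pos_le_divide_eq mult.commute)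
  have ptw: "(\<lambda>k. u (r k) x) \<longlonglongrightarrow> u0 x" for x
  proof (cases "x \<in> \<Omega>")
    case True
    then show ?thesis using r(2)[OF True] by (simp add: u0_def convergent_LIMSEQ_iff)
  next
    case False
    then have hx: "h x > 0" using h1(1)[of x] Omega by auto
    have hu: "h x * (u k x)\<^sup>2 \<le> C / lam k" for k
      using finite_sum_le_infsum[OF hs[of k], of "{x}"] hsum[of k] h1(1) by simp
    have usqrt: "\<bar>u k x\<bar> \<le> sqrt (C / lam k / h x)" for k
      using hu[of k] hx lam(1)[of k] by (intro real_le_rsqrt) (simp add: pos_le_divide_eq mult_ac)
    have "(\<lambda>k. sqrt (C / lam (r k) / h x)) \<longlonglongrightarrow> sqrt (0 / h x)"
      by (intro tendsto_intros Clam) (use hx in auto)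
    then have lim0: "(\<lambda>k. sqrt (C / lam (r k) / h x)) \<longlonglongrightarrow> 0" by simp
    have "(\<lambda>k. u (r k) x) \<longlonglongrightarrow> 0"
      by (rule Lim_null_comparison[OF _ lim0]) (use usqrt in simp)
    then show ?thesis by (simp only: u0O[OF False])
  qed
  let ?d = "\<lambda>k x. u (r k) x - u0 x"
  have l2lim: "(\<lambda>k. l2_inner (?d k) (?d k)) \<longlonglongrightarrow> 0"
  proof (rule Lim_null_comparison)
    \<comment> \<open>On the finite set \<open>?F\<close> pointwise convergence suffices. Off it u0
      vanishes and 1 \<le> h / M, so the tail is at most 1 / M times the mass weighted by h: no mass
      escapes to infinity.\<close>
    let ?b = "\<lambda>k. (\<Sum>x\<in>?F. (?d k x)\<^sup>2) + C / lam (r k) / M"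
    have "?b \<longlonglongrightarrow> (\<Sum>x\<in>?F. (u0 x - u0 x)\<^sup>2) + 0 / M"
      by (intro tendsto_intros ptw Clam) (use M in auto)
    then show "?b \<longlonglongrightarrow> 0" by simp
    have "l2_inner (?d k) (?d k) \<le> ?b k" for k
    proof -
      let ?g = "\<lambda>x. if x \<in> ?F then (?d k x)\<^sup>2 else 0" and ?t = "\<lambda>x. 1 / M * (h x * (u (r k) x)\<^sup>2)"
      have gs: "?g summable_on UNIV" and gi: "infsum ?g UNIV = (\<Sum>x\<in>?F. (?d k x)\<^sup>2)"
      proof -
        have "?g summable_on UNIV \<longleftrightarrow> (\<lambda>x. (?d k x)\<^sup>2) summable_on ?F"
          by (rule summable_on_cong_neutral) auto
        then show "?g summable_on UNIV" using M(2) by simp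
        have "infsum ?g UNIV = (\<Sum>\<^sub>\<infinity>x\<in>?F. (?d k x)\<^sup>2)" by (rule infsum_cong_neutral) auto
        then show "infsum ?g UNIV = (\<Sum>x\<in>?F. (?d k x)\<^sup>2)" using M(2) by simp
      qed
      have ts: "?t summable_on UNIV" by (rule summable_on_cmult_right[OF hs])
      have dl: "?d k \<in> wl2 (\<lambda>_. 1)" using ul u0l by (intro wl2_diff) auto
      have pw: "(?d k x)\<^sup>2 \<le> ?g x + ?t x" for x
      proof (cases "x \<in> ?F")
        case True
        then show ?thesis using h1(1)[of x] M(1) by simp
      next
        case False
        then have "M \<le> h x" by simp
        then have "1 \<le> h x / M" using M(1) by simp
        from mult_right_mono[OF this, of "(u (r k) x)\<^sup>2"]
        have "(u (r k) x)\<^sup>2 \<le> ?t x" by simp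
        moreover have "u0 x = 0" using False M(1) Omega by (intro u0O) auto
        ultimately show ?thesis using False by simp
      qed
      have "l2_inner (?d k) (?d k) \<le> (\<Sum>\<^sub>\<infinity>x. ?g x + ?t x)"
        unfolding l2_inner_self using dl pw by (intro infsum_mono summable_on_add gs ts) (auto simp: wl2_def)
      also have "\<dots> = infsum ?g UNIV + infsum ?t UNIV" by (rule infsum_add[OF gs ts])
      also have "\<dots> \<le> ?b k"
        unfolding gi infsum_cmult_right' using mult_left_mono[OF hsum[of "r k"], of "1 / M"] M(1) by (simp add: mult.commute[of M])
      finally show ?thesis .
    qed
    moreover have "l2_inner (?d k) (?d k) \<ge> 0" for k by (rule form_nonneg) auto
    ultimately show "\<forall>\<^sub>F k in sequentially. norm (l2_inner (?d k) (?d k)) \<le> ?b k" by simp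
  qed
  have H1lim: "(\<lambda>k. H1_norm (?d k)) \<longlonglongrightarrow> 0"
  proof (rule Lim_null_comparison)
    have "(\<lambda>k. sqrt ((2 * real (card unit_steps) + 1) * l2_inner (?d k) (?d k)))
        \<longlonglongrightarrow> sqrt ((2 * real (card unit_steps) + 1) * 0)"
      by (intro tendsto_intros l2lim)
    then show "(\<lambda>k. sqrt ((2 * real (card unit_steps) + 1) * l2_inner (?d k) (?d k))) \<longlonglongrightarrow> 0" by simp
    have "?d k \<in> wl2 (\<lambda>_. 1)" for k using ul u0l by (intro wl2_diff) auto
    from H1_norm_le_l2[OF this]
    show "\<forall>\<^sub>F k in sequentially. norm (H1_norm (?d k)) \<le> sqrt ((2 * real (card unit_steps) + 1) * l2_inner (?d k) (?d k))"
      by (simp add: H1_norm_form form_nonneg)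
  qed
  note flim = form_tendsto[where u="\<lambda>k. u (r k)" and ?u0.0=u0, OF _ _ ul u0l l2lim]
  \<comment> \<open>Testing inside \<Omega> replaces the weight by 1 and makes the logarithmic sum
    finite, so pointwise convergence handles it.\<close>
  have sol: "?D u0 \<phi> = 0" if \<phi>: "\<And>x. x \<notin> \<Omega> \<Longrightarrow> \<phi> x = 0" for \<phi>
  proof -
    have \<phi>l: "\<phi> \<in> wl2 w" for w by (rule wl2_finite_support[OF fin \<phi>])
    have lt: "(\<Sum>\<^sub>\<infinity>x. log_term p (v x) * \<phi> x) = (\<Sum>x\<in>\<Omega>. log_term p (v x) * \<phi> x)" for v
    proof -
      have "(\<Sum>\<^sub>\<infinity>x. log_term p (v x) * \<phi> x) = (\<Sum>\<^sub>\<infinity>x\<in>\<Omega>. log_term p (v x) * \<phi> x)"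
        by (rule infsum_cong_neutral) (auto simp: \<phi>)
      then show ?thesis using fin by simp
    qed
    have zero: "?D (u k) \<phi> = 0" for k
      using uD[OF \<phi>l, of k] energy_deriv_support_cong[where \<Omega>=\<Omega> and \<phi>=\<phi> and w="?w k" and w'="\<lambda>_. 1"] \<phi> wO
      by simp
    have "(\<lambda>k. ?D (u (r k)) \<phi>) \<longlonglongrightarrow> ?D u0 \<phi>"
      unfolding energy_deriv_def lt using a
      by (intro tendsto_intros flim \<phi>l isCont_tendsto_compose[OF isCont_log_term[OF p3]] ptw) auto
    then show ?thesis unfolding zero by (simp add: LIMSEQ_const_iff)
  qed
  \<comment> \<open>One index is enough: where a sign part of \<open>u k\<close> exceeds 1 in
    absolute value, u0 is within distance less than 1 and keeps that sign.\<close>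
  have near: "\<exists>k. \<forall>x. \<bar>u k x - u0 x\<bar> < 1"
  proof -
    have "\<forall>\<^sub>F k in sequentially. \<forall>x. \<bar>u (r k) x - u0 x\<bar> < 1"
      using ul u0l l2lim by (intro l2_tendsto_pointwise) auto
    then show ?thesis by (auto simp: eventually_sequentially)
  qed
  then obtain k where k: "\<And>x. \<bar>u k x - u0 x\<bar> < 1" by blast
  have pos0: "pos_part u0 \<noteq> (\<lambda>_. 0)"
  proof
    assume z: "pos_part u0 = (\<lambda>_. 0)"
    obtain x where "\<bar>pos_part (u k) x\<bar> > 1"
      using truncation_exceeds_1[where w="?w k" and u="u k" and v="pos_part (u k)", OF a b w1 uH
          truncation_parts(1,2) uD[OF parts(1)] upm(1)] by blast
    then have "u k x > 1" by (auto simp: pos_part_def max_def split: if_splits)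
    moreover have "u0 x \<le> 0" using fun_cong[OF z, of x] by (simp add: pos_part_def max_def split: if_splits)
    ultimately show False using k[of x] by simp
  qed
  have neg0: "neg_part u0 \<noteq> (\<lambda>_. 0)"
  proof
    assume z: "neg_part u0 = (\<lambda>_. 0)"
    obtain x where "\<bar>neg_part (u k) x\<bar> > 1"
      using truncation_exceeds_1[where w="?w k" and u="u k" and v="neg_part (u k)", OF a b w1 uH
          truncation_parts(3,4) uD[OF parts(2)] upm(2)] by blast
    then have "u k x < -1" by (auto simp: neg_part_def min_def split: if_splits)
    moreover have "u0 x \<ge> 0" using fun_cong[OF z, of x] by (simp add: neg_part_def min_def split: if_splits)
    ultimately show False using k[of x] by simp
  qed
  have u0H: "u0 \<in> H01 a \<Omega>" using u0O by (simp add: H01_eq[OF fin])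
  have pn0: "pos_part u0 x = 0" "neg_part u0 x = 0" if "x \<notin> \<Omega>" for x
    using u0O[OF that] by (simp_all add: pos_part_def neg_part_def)
  have D0: "?D u0 (pos_part u0) = 0" "?D u0 (neg_part u0) = 0" using sol pn0 by blast+
  have u0N: "u0 \<in> ?NO"
    unfolding NO using u0O pos0 neg0 D0 by simp
  have S\<Omega>: "?S u0 = (\<Sum>x\<in>\<Omega>. \<bar>u0 x\<bar> powr p)"
  proof -
    have "?S u0 = (\<Sum>\<^sub>\<infinity>x\<in>\<Omega>. \<bar>u0 x\<bar> powr p)" by (rule infsum_cong_neutral) (auto simp: u0O)
    then show ?thesis using fin by simp
  qed
  have J0: "J_Omega a b p \<Omega> u0 = coer (form a (\<lambda>_. 1) u0 u0) (dirichlet u0 u0) (\<Sum>x\<in>\<Omega>. \<bar>u0 x\<bar> powr p)"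
    using J_Omega_energy[OF less_imp_le[OF a] p3 fin u0O] nehari_energy_eq[where w="\<lambda>_. 1", OF p3 _ u0l D0]
    by (simp add: coer_def S\<Omega>)
  have min0: "J_Omega a b p \<Omega> u0 \<le> J_Omega a b p \<Omega> v" if v: "v \<in> ?NO" for v
  proof (rule LIMSEQ_le_const2)
    \<comment> \<open>This is the energy of \<open>u (r k)\<close> with the penalty and the powers
      outside \<Omega> dropped: it stays below that energy, and each of its ingredients
      converges.\<close>
    let ?c = "\<lambda>k. coer (form a (\<lambda>_. 1) (u (r k)) (u (r k))) (dirichlet (u (r k)) (u (r k))) (\<Sum>x\<in>\<Omega>. \<bar>u (r k) x\<bar> powr p)"
    show "?c \<longlonglongrightarrow> J_Omega a b p \<Omega> u0"
      unfolding J0 coer_def using a p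
      by (intro tendsto_intros flim ptw) auto
    have "?c k \<le> J_Omega a b p \<Omega> v" for k
    proof -
      have "form a (\<lambda>_. 1) (u (r k)) (u (r k)) \<le> form a (?w (r k)) (u (r k)) (u (r k))"
        using a w1 uH by (intro form_mono) auto
      moreover have "(\<Sum>x\<in>\<Omega>. \<bar>u (r k) x\<bar> powr p) \<le> ?S (u (r k))"
        using p fin by (intro finite_sum_le_infsum abs_powr_summable ul) auto
      ultimately have "?c k \<le> J_lam a b p h (lam (r k)) (u (r k))"
        unfolding NL_coer[OF uNL] by (rule coer_mono)
      also have "\<dots> \<le> J_Omega a b p \<Omega> v" by (rule below[OF v])
      finally show ?thesis .
    qed
    then show "\<exists>N. \<forall>n\<ge>N. ?c n \<le> J_Omega a b p \<Omega> v" by blast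
  qed
  have "J_Omega a b p \<Omega> u0 = (INF v\<in>?NO. J_Omega a b p \<Omega> v)"
    using u0N min0 by (intro cInf_eq_minimum[symmetric]) auto
  moreover have "sc_solution (H01 a \<Omega>) (H01_norm a \<Omega>) (J_Omega a b p \<Omega>) u0"
    unfolding sc_solution_def using u0H pos0 neg0 frechet_H01[OF a b p3 fin u0H] sol
    by (auto simp: H01_eq[OF fin])
  ultimately have "least_energy_sc_solution (H01 a \<Omega>) (H01_norm a \<Omega>) (J_Omega a b p \<Omega>) u0"
    by (simp add: least_energy_sc_solution_def)
  moreover have "u0 \<in> H1" unfolding H1_eq_l2 by (rule u0l)
  ultimately show ?thesis using r(1) H1lim by blast
qed

end
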